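(* The adversarial recoverable selection problem \textsc{AREC} under the continuous budgeted uncertainty set $\mathcal{U}^c$, i.e. the problem, for a given $\mathbf{x}\in\Phi$, $$\max_{\mathbf{c}\in\mathcal{U}^c}\ \min_{\mathbf{y}\in\Phi^k_{\mathbf{x}}}\mathbf{c}\mathbf{y},$$ can be solved in $O(n\log n)$ time.
   Context: Let $[n]=\{1,\dots,n\}$ and $p\in[n]$. The input consists of $n$, $p$, a recovery parameter $k\in[p]\cup\{0\}$, a vector $\mathbf{x}\in\Phi$, nonnegative item costs $\underline{c}_i\le\overline{c}_i$ with $d_i=\overline{c}_i-\underline{c}_i\ge 0$ for $i\in[n]$, and a budget $\Gamma\ge 0$. Products such as $\mathbf{c}\mathbf{y}$ denote $\sum_{i\in[n]}c_iy_i$. $\Phi=\{\mathbf{x}\in\{0,1\}^n:\sum_{i\in[n]}x_i=p\}$. For $\mathbf{x}\in\Phi$, $\Phi^k_{\mathbf{x}}=\{\mathbf{y}\in\{0,1\}^n:\sum_{i\in[n]}y_i=p,\ \sum_{i\in[n]}x_iy_i\ge p-k\}$. The continuous budgeted uncertainty set is $\mathcal{U}^c=\{(\underline{c}_i+\delta_i)_{i\in[n]}:\delta_i\in[0,d_i],\ \sum_{i\in[n]}\delta_i\le\Gamma\}$. Running time counts elementary arithmetic operations and comparisons on the input numbers (standard unit-cost model). *)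

theory Defs
  imports Complex_Main "HOL-Library.FuncSet" "HOL-Library.Landau_Symbols"
begin

section \<open>A uniform real RAM with unit costs\<close>

text \<open>
  Programs are structured imperative programs over scalar variables and arrays of two sorts:
  indices (natural numbers) and real numbers.  The names occurring in a program are fixed in its
  text, so a program uses finitely many variables and arrays; arrays are unbounded and give
  indirect addressing.  There is no rounding and no conversion between the two sorts, index
  arithmetic is restricted to addition and truncated subtraction, and numeric constants are
  natural numbers, so that no information can be smuggled in through a real constant.
  Division by zero yields zero.
\<close>

type_synonym name = string

record state =
  ivar :: "name \<Rightarrow> nat"
  rvar :: "name \<Rightarrow> real"
  iarr :: "name \<Rightarrow> nat \<Rightarrow> nat"
  rarr :: "name \<Rightarrow> nat \<Rightarrow> real"

datatype iexp =
    IConst nat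
  | IVar name
  | IArr name iexp
  | IAdd iexp iexp
  | ISub iexp iexp

datatype rexp =
    RConst nat
  | RVar name
  | RArr name iexp
  | RAdd rexp rexp
  | RSub rexp rexp
  | RMul rexp rexp
  | RDiv rexp rexp

datatype bexp =
    ILess iexp iexp
  | RLess rexp rexp
  | BNot bexp
  | BAnd bexp bexp

fun ieval :: "iexp \<Rightarrow> state \<Rightarrow> nat" where
  "ieval (IConst m) s = m"
| "ieval (IVar v) s = ivar s v"
| "ieval (IArr a e) s = iarr s a (ieval e s)"
| "ieval (IAdd e f) s = ieval e s + ieval f s"
| "ieval (ISub e f) s = ieval e s - ieval f s"

fun reval :: "rexp \<Rightarrow> state \<Rightarrow> real" where
  "reval (RConst m) s = real m"
| "reval (RVar v) s = rvar s v"
| "reval (RArr a e) s = rarr s a (ieval e s)"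
| "reval (RAdd e f) s = reval e s + reval f s"
| "reval (RSub e f) s = reval e s - reval f s"
| "reval (RMul e f) s = reval e s * reval f s"
| "reval (RDiv e f) s = reval e s / reval f s"

fun beval :: "bexp \<Rightarrow> state \<Rightarrow> bool" where
  "beval (ILess e f) s \<longleftrightarrow> ieval e s < ieval f s"
| "beval (RLess e f) s \<longleftrightarrow> reval e s < reval f s"
| "beval (BNot b) s \<longleftrightarrow> \<not> beval b s"
| "beval (BAnd b c) s \<longleftrightarrow> beval b s \<and> beval c s"

text \<open>
  Every constant, variable access, array access, arithmetic operation, comparison and Boolean
  connective costs one unit.
\<close>

fun icost :: "iexp \<Rightarrow> nat" where
  "icost (IConst m) = 1"
| "icost (IVar v) = 1"
| "icost (IArr a e) = 1 + icost e"
| "icost (IAdd e f) = 1 + icost e + icost f"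
| "icost (ISub e f) = 1 + icost e + icost f"

fun rcost :: "rexp \<Rightarrow> nat" where
  "rcost (RConst m) = 1"
| "rcost (RVar v) = 1"
| "rcost (RArr a e) = 1 + icost e"
| "rcost (RAdd e f) = 1 + rcost e + rcost f"
| "rcost (RSub e f) = 1 + rcost e + rcost f"
| "rcost (RMul e f) = 1 + rcost e + rcost f"
| "rcost (RDiv e f) = 1 + rcost e + rcost f"

fun bcost :: "bexp \<Rightarrow> nat" where
  "bcost (ILess e f) = 1 + icost e + icost f"
| "bcost (RLess e f) = 1 + rcost e + rcost f"
| "bcost (BNot b) = 1 + bcost b"
| "bcost (BAnd b c) = 1 + bcost b + bcost c"

datatype com =
    Skip
  | ISet name iexp
  | RSet name rexp
  | IStore name iexp iexp
  | RStore name iexp rexp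
  | Seq com com
  | Cond bexp com com
  | While bexp com

text \<open>
  \<open>exec c s t s'\<close>: started in \<open>s\<close>, the program \<open>c\<close> terminates in \<open>s'\<close> after exactly \<open>t\<close>
  elementary steps.
\<close>

inductive exec :: "com \<Rightarrow> state \<Rightarrow> nat \<Rightarrow> state \<Rightarrow> bool" where
  Skip: "exec Skip s 1 s"
| ISet: "exec (ISet v e) s (1 + icost e)
     (s\<lparr>ivar := (ivar s)(v := ieval e s)\<rparr>)"
| RSet: "exec (RSet v e) s (1 + rcost e)
     (s\<lparr>rvar := (rvar s)(v := reval e s)\<rparr>)"
| IStore: "exec (IStore a i e) s (1 + icost i + icost e)
     (s\<lparr>iarr := (iarr s)(a := (iarr s a)(ieval i s := ieval e s))\<rparr>)"
| RStore: "exec (RStore a i e) s (1 + icost i + rcost e)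
     (s\<lparr>rarr := (rarr s)(a := (rarr s a)(ieval i s := reval e s))\<rparr>)"
| Seq: "exec c s t s' \<Longrightarrow> exec d s' u s'' \<Longrightarrow> exec (Seq c d) s (t + u) s''"
| CondTrue: "beval b s \<Longrightarrow> exec c s t s' \<Longrightarrow> exec (Cond b c d) s (1 + bcost b + t) s'"
| CondFalse: "\<not> beval b s \<Longrightarrow> exec d s t s' \<Longrightarrow> exec (Cond b c d) s (1 + bcost b + t) s'"
| WhileFalse: "\<not> beval b s \<Longrightarrow> exec (While b c) s (1 + bcost b) s"
| WhileTrue: "beval b s \<Longrightarrow> exec c s t s' \<Longrightarrow> exec (While b c) s' u s'' \<Longrightarrow>
     exec (While b c) s (1 + bcost b + t + u) s''"

lemma exec_deterministic:
  "exec c s t s' \<Longrightarrow> exec c s u s'' \<Longrightarrow> u = t \<and> s'' = s'"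
proof (induction arbitrary: u s'' rule: exec.induct)
  case (Skip s)
  then show ?case by cases simp
next
  case (ISet v e s)
  then show ?case by cases simp
next
  case (RSet v e s)
  then show ?case by cases simp
next
  case (IStore a i e s)
  then show ?case by cases simp
next
  case (RStore a i e s)
  then show ?case by cases simp
next
  case (Seq c s t s' d v s1)
  from Seq.prems show ?case
    by cases (use Seq.IH in blast)
next
  case (CondTrue b s c t s' d)
  from CondTrue.prems show ?case
    by cases (use CondTrue.IH CondTrue.hyps in blast)+
next
  case (CondFalse b s d t s' c)
  from CondFalse.prems show ?case
    by cases (use CondFalse.IH CondFalse.hyps in blast)+
next
  case (WhileFalse b s c)
  from WhileFalse.prems show ?case
    by cases (use WhileFalse.hyps in blast)+
next
  case (WhileTrue b s c t s' v s1)
  from WhileTrue.prems show ?case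
    by cases (use WhileTrue.IH WhileTrue.hyps in blast)+
qed


section \<open>The adversarial recoverable selection problem\<close>

text \<open>
  A vector indexed by \<open>{1..n}\<close> is an extensional function on \<open>{1..n}\<close>, so that distinct functions
  are distinct vectors.
\<close>

definition selections :: "nat \<Rightarrow> nat \<Rightarrow> (nat \<Rightarrow> nat) set" where
  "selections n p = {x \<in> {1..n} \<rightarrow>\<^sub>E {0, 1}. (\<Sum>i\<in>{1..n}. x i) = p}"

definition recovery_selections ::
  "nat \<Rightarrow> nat \<Rightarrow> nat \<Rightarrow> (nat \<Rightarrow> nat) \<Rightarrow> (nat \<Rightarrow> nat) set"
where
  "recovery_selections n p k x =
    {y \<in> {1..n} \<rightarrow>\<^sub>E {0, 1}. (\<Sum>i\<in>{1..n}. y i) = p \<and> (\<Sum>i\<in>{1..n}. x i * y i) \<ge> p - k}"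

definition budgeted_costs ::
  "nat \<Rightarrow> (nat \<Rightarrow> real) \<Rightarrow> (nat \<Rightarrow> real) \<Rightarrow> real \<Rightarrow> (nat \<Rightarrow> real) set"
where
  "budgeted_costs n cl cu \<Gamma> =
    {(\<lambda>i\<in>{1..n}. cl i + \<delta> i) | \<delta>.
       (\<forall>i\<in>{1..n}. \<delta> i \<in> {0..cu i - cl i}) \<and> (\<Sum>i\<in>{1..n}. \<delta> i) \<le> \<Gamma>}"

definition recovery_cost ::
  "nat \<Rightarrow> nat \<Rightarrow> nat \<Rightarrow> (nat \<Rightarrow> nat) \<Rightarrow> (nat \<Rightarrow> real) \<Rightarrow> real"
where
  "recovery_cost n p k x c =
    Min ((\<lambda>y. \<Sum>i\<in>{1..n}. c i * real (y i)) ` recovery_selections n p k x)"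

lemma finite_recovery_selections: "finite (recovery_selections n p k x)"
proof (rule finite_subset)
  show "recovery_selections n p k x \<subseteq> {1..n} \<rightarrow>\<^sub>E {0, 1}"
    by (auto simp: recovery_selections_def)
  show "finite ({1..n} \<rightarrow>\<^sub>E {0::nat, 1})"
    by (rule finite_PiE) auto
qed

lemma self_in_recovery_selections:
  assumes "x \<in> selections n p"
  shows "x \<in> recovery_selections n p k x"
proof -
  have "x i * x i = x i" if "i \<in> {1..n}" for i
  proof -
    have "x i \<in> {0, 1}" using assms that by (auto simp: selections_def)
    then show ?thesis by auto
  qed
  then have "(\<Sum>i\<in>{1..n}. x i * x i) = (\<Sum>i\<in>{1..n}. x i)" by (rule sum.cong[OF refl])
  with assms show ?thesis by (simp add: selections_def recovery_selections_def)
qed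

definition arec_instance ::
  "nat \<Rightarrow> nat \<Rightarrow> nat \<Rightarrow> (nat \<Rightarrow> nat) \<Rightarrow> (nat \<Rightarrow> real) \<Rightarrow> (nat \<Rightarrow> real) \<Rightarrow> real \<Rightarrow> bool"
where
  "arec_instance n p k x cl cu \<Gamma> \<longleftrightarrow>
    p \<in> {1..n} \<and> k \<in> {0..p} \<and> x \<in> selections n p \<and>
    (\<forall>i\<in>{1..n}. 0 \<le> cl i \<and> cl i \<le> cu i) \<and> 0 \<le> \<Gamma>"

text \<open>
  Solving an instance means finding a cost vector attaining the maximum together with the maximum.
\<close>

definition arec_solution ::
  "nat \<Rightarrow> nat \<Rightarrow> nat \<Rightarrow> (nat \<Rightarrow> nat) \<Rightarrow> (nat \<Rightarrow> real) \<Rightarrow> (nat \<Rightarrow> real) \<Rightarrow> real \<Rightarrow>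
    (nat \<Rightarrow> real) \<Rightarrow> real \<Rightarrow> bool"
where
  "arec_solution n p k x cl cu \<Gamma> c v \<longleftrightarrow>
    is_arg_max (recovery_cost n p k x) (\<lambda>c. c \<in> budgeted_costs n cl cu \<Gamma>) c \<and>
    v = recovery_cost n p k x c"

text \<open>Memory not holding input has arbitrary initial contents.\<close>

definition arec_input ::
  "nat \<Rightarrow> nat \<Rightarrow> nat \<Rightarrow> (nat \<Rightarrow> nat) \<Rightarrow> (nat \<Rightarrow> real) \<Rightarrow> (nat \<Rightarrow> real) \<Rightarrow> real \<Rightarrow> state \<Rightarrow> bool"
where
  "arec_input n p k x cl cu \<Gamma> s \<longleftrightarrow>
    ivar s ''n'' = n \<and> ivar s ''p'' = p \<and> ivar s ''k'' = k \<and> rvar s ''Gamma'' = \<Gamma> \<and>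
    (\<forall>i\<in>{1..n}. iarr s ''x'' i = x i \<and> rarr s ''cl'' i = cl i \<and> rarr s ''cu'' i = cu i)"

definition arec_output ::
  "nat \<Rightarrow> nat \<Rightarrow> nat \<Rightarrow> (nat \<Rightarrow> nat) \<Rightarrow> (nat \<Rightarrow> real) \<Rightarrow> (nat \<Rightarrow> real) \<Rightarrow> real \<Rightarrow> state \<Rightarrow> bool"
where
  "arec_output n p k x cl cu \<Gamma> s \<longleftrightarrow>
    arec_solution n p k x cl cu \<Gamma> (restrict (rarr s ''c'') {1..n}) (rvar s ''opt'')"

end

theory Submission imports Defs "HOL-Analysis.Convex" begin

text \<open>
  For fixed costs \<open>c\<close>, linear programming duality turns the recovery problem into the maximization of
  \<open>(p - k) * g + k * a - (\<Sum>i. max 0 (t i - c i))\<close> over \<open>a \<le> g\<close>, where \<open>t i\<close> is \<open>g\<close> for items selected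
  by \<open>x\<close> and \<open>a\<close> for the others.  At fixed thresholds the adversary only raises costs towards the
  thresholds, so the robust value at \<open>(g, a)\<close> is the minimum of two separable concave piecewise linear
  functions: the one of the lower costs plus \<open>\<Gamma>\<close>, and the one of the upper costs.  Inside a cell of
  the grid spanned by the \<open>2 * n\<close> item costs, a point can be moved along a direction in which the
  difference of the two functions is constant, so some optimal point has a coordinate on the grid or
  lies on the diagonal.  This leaves \<open>O(n)\<close> lines.  On each of them the objective is concave: a binary
  search over the sorted breakpoints finds the best grid point, and the optimum on the line is on one
  of the two adjacent segments, at an endpoint or where the two functions cross.
\<close>

section \<open>Linear programming duality for the recovery problem\<close>

text \<open>Duality replaces the inner minimum by a maximum, so the max-min problem becomes a joint
  maximum over costs and thresholds, and the costs may be chosen last. At fixed thresholds, a unit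
  of budget spent on an item below its threshold removes a unit of penalty, until the item reaches
  its threshold or its upper cost; hence only two extreme functions remain. The obstacle is their
  minimum: it is not separable, its maximizers may lie on a crossing line inside a cell, and the
  grid has quadratically many cells. In a cell, two variables face the single linear condition of a
  constant difference, so a direction of the required kind always exists, and its sign can be
  chosen. Each of the two functions splits into a part in \<open>g\<close> and a part in
  \<open>a\<close>; four tables over the grid therefore give the objective at any grid pair in
  constant time, which makes a line cost only O(log n).\<close>

text \<open>
  \<open>a\<close> is the dual variable of the cardinality constraint and \<open>g - a\<close> that of the overlap constraint.
\<close>

definition dual_value ::
  "nat \<Rightarrow> nat \<Rightarrow> nat \<Rightarrow> (nat \<Rightarrow> nat) \<Rightarrow> (nat \<Rightarrow> real) \<Rightarrow> real \<Rightarrow> real \<Rightarrow> real"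
where
  "dual_value n p k x c g a =
    real (p - k) * g + real k * a - (\<Sum>i\<in>{1..n}. max 0 ((if x i = 1 then g else a) - c i))"

lemma selections_values: "x \<in> selections n p \<Longrightarrow> i \<in> {1..n} \<Longrightarrow> x i = 0 \<or> x i = 1"
  by (auto simp: selections_def)

lemma recovery_selections_values:
  "y \<in> recovery_selections n p k x \<Longrightarrow> i \<in> {1..n} \<Longrightarrow> y i = 0 \<or> y i = 1"
  by (auto simp: recovery_selections_def)

text \<open>For \<open>x i\<close> in {0, 1} the threshold is \<open>a + (g - a) * x i\<close>, and
  \<open>y\<close> selects exactly \<open>p\<close> items. The last summand isolates the overlap
  surplus, the only part of the duality gap that is not attributable to a single item.\<close>

lemma sum_threshold:
  assumes x: "x \<in> selections n p" and y: "y \<in> recovery_selections n p k x" and "k \<le> p"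
  shows "(\<Sum>i\<in>{1..n}. (if x i = 1 then g else a) * real (y i)) =
    real (p - k) * g + real k * a + (g - a) * (real (\<Sum>i\<in>{1..n}. x i * y i) - real (p - k))"
proof -
  have "(if x i = 1 then g else a) * real (y i) = a * real (y i) + (g - a) * real (x i * y i)"
    if "i \<in> {1..n}" for i
    using selections_values[OF x that] by (auto simp: algebra_simps)
  then have "(\<Sum>i\<in>{1..n}. (if x i = 1 then g else a) * real (y i)) =
      a * real (\<Sum>i\<in>{1..n}. y i) + (g - a) * real (\<Sum>i\<in>{1..n}. x i * y i)"
    by (simp add: sum.distrib sum_distrib_left)
  also have "(\<Sum>i\<in>{1..n}. y i) = p" using y by (simp add: recovery_selections_def)
  finally show ?thesis using \<open>k \<le> p\<close> by (simp add: algebra_simps of_nat_diff)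
qed

text \<open>Item by item, \<open>t * y - max 0 (t - c) \<le> c * y\<close> for \<open>y\<close> in
  {0, 1}; the overlap surplus times \<open>g - a\<close> is nonnegative and is dropped.\<close>

lemma weak_duality:
  assumes x: "x \<in> selections n p" and y: "y \<in> recovery_selections n p k x" and "k \<le> p"
    and "a \<le> g"
  shows "dual_value n p k x c g a \<le> (\<Sum>i\<in>{1..n}. c i * real (y i))"
proof -
  let ?t = "\<lambda>i. if x i = 1 then g else a"
  have "(\<Sum>i\<in>{1..n}. ?t i * real (y i)) - (\<Sum>i\<in>{1..n}. max 0 (?t i - c i))
      \<le> (\<Sum>i\<in>{1..n}. c i * real (y i))"
    unfolding sum_subtractf[symmetric]
  proof (rule sum_mono)
    fix i assume "i \<in> {1..n}"
    then show "?t i * real (y i) - max 0 (?t i - c i) \<le> c i * real (y i)"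
      using recovery_selections_values[OF y] by fastforce
  qed
  moreover have "0 \<le> (g - a) * (real (\<Sum>i\<in>{1..n}. x i * y i) - real (p - k))"
    using y \<open>a \<le> g\<close> unfolding recovery_selections_def
    by (intro mult_nonneg_nonneg) (auto simp del: of_nat_diff of_nat_sum)
  ultimately show ?thesis
    unfolding dual_value_def using sum_threshold[OF x y \<open>k \<le> p\<close>, of g a] by linarith
qed

text \<open>Each estimate behind weak duality becomes an equality: an item on the proper side of its
  threshold has no gap, and the overlap term vanishes if its surplus or its multiplier does.\<close>

lemma complementary_slackness:
  assumes x: "x \<in> selections n p" and y: "y \<in> recovery_selections n p k x" and "k \<le> p"
    and sel: "\<And>i. i \<in> {1..n} \<Longrightarrow> y i = 1 \<Longrightarrow> c i \<le> (if x i = 1 then g else a)"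
    and unsel: "\<And>i. i \<in> {1..n} \<Longrightarrow> y i = 0 \<Longrightarrow> (if x i = 1 then g else a) \<le> c i"
    and "g = a \<or> (\<Sum>i\<in>{1..n}. x i * y i) = p - k"
  shows "(\<Sum>i\<in>{1..n}. c i * real (y i)) = dual_value n p k x c g a"
proof -
  let ?t = "\<lambda>i. if x i = 1 then g else a"
  have "(\<Sum>i\<in>{1..n}. c i * real (y i)) =
      (\<Sum>i\<in>{1..n}. ?t i * real (y i)) - (\<Sum>i\<in>{1..n}. max 0 (?t i - c i))"
    unfolding sum_subtractf[symmetric]
  proof (rule sum.cong[OF refl])
    fix i assume i: "i \<in> {1..n}"
    show "c i * real (y i) = ?t i * real (y i) - max 0 (?t i - c i)"
      using recovery_selections_values[OF y i] sel[OF i] unsel[OF i] by (auto simp: max_def)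
  qed
  moreover have "(g - a) * (real (\<Sum>i\<in>{1..n}. x i * y i) - real (p - k)) = 0"
    using assms(6) by (auto simp del: of_nat_sum of_nat_diff)
  ultimately show ?thesis
    unfolding dual_value_def using sum_threshold[OF x y \<open>k \<le> p\<close>, of g a] by linarith
qed

text \<open>The exchange step. The overlap constraint survives either because the new item
  contributes at least as much to it as the old one, or because there is room for losing
  \<open>x i\<close>.\<close>

lemma swap_recovery_selection:
  assumes y: "y \<in> recovery_selections n p k x"
    and i: "i \<in> {1..n}" "y i = 1" and j: "j \<in> {1..n}" "y j = 0"
    and sw: "x i \<le> x j \<or> p - k + x i \<le> (\<Sum>l\<in>{1..n}. x l * y l)"
  shows "y(i := 0, j := 1) \<in> recovery_selections n p k x"
    and "(\<Sum>l\<in>{1..n}. c l * real ((y(i := 0, j := 1)) l)) =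
      (\<Sum>l\<in>{1..n}. c l * real (y l)) - c i + c j"
proof -
  let ?y = "y(i := 0, j := 1)"
  have ij: "i \<noteq> j" using i j by auto
  \<comment> \<open>Adding the indicator of \<open>i\<close> on one side and of \<open>j\<close> on
    the other makes the summands agree pointwise and avoids subtraction; the next two sums are
    treated alike.\<close>
  have "(\<Sum>l\<in>{1..n}. ?y l + (if l = i then 1 else 0)) = (\<Sum>l\<in>{1..n}. y l + (if l = j then 1 else 0))"
    using i j ij by (intro sum.cong) auto
  then have 1: "(\<Sum>l\<in>{1..n}. ?y l) = (\<Sum>l\<in>{1..n}. y l)"
    using i j unfolding sum.distrib by (simp add: sum.delta)
  have "(\<Sum>l\<in>{1..n}. x l * ?y l + (if l = i then x i else 0)) =
      (\<Sum>l\<in>{1..n}. x l * y l + (if l = j then x j else 0))"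
    using i j ij by (intro sum.cong) auto
  then have 2: "(\<Sum>l\<in>{1..n}. x l * ?y l) + x i = (\<Sum>l\<in>{1..n}. x l * y l) + x j"
    using i j unfolding sum.distrib by (simp add: sum.delta)
  have "(\<Sum>l\<in>{1..n}. c l * real (?y l) + (if l = i then c i else 0)) =
      (\<Sum>l\<in>{1..n}. c l * real (y l) + (if l = j then c j else 0))"
    using i j ij by (intro sum.cong) auto
  then show "(\<Sum>l\<in>{1..n}. c l * real (?y l)) = (\<Sum>l\<in>{1..n}. c l * real (y l)) - c i + c j"
    using i j unfolding sum.distrib by (simp add: sum.delta)
  have "?y \<in> {1..n} \<rightarrow>\<^sub>E {0, 1}"
    using y i j by (auto simp: recovery_selections_def PiE_iff extensional_def)
  moreover have "p - k \<le> (\<Sum>l\<in>{1..n}. x l * ?y l)"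
    using 2 sw y by (auto simp: recovery_selections_def)
  ultimately show "?y \<in> recovery_selections n p k x"
    using 1 y by (simp add: recovery_selections_def)
qed

lemma recovery_cost_le:
  "y \<in> recovery_selections n p k x \<Longrightarrow>
    recovery_cost n p k x c \<le> (\<Sum>i\<in>{1..n}. c i * real (y i))"
  unfolding recovery_cost_def by (rule Min_le) (auto intro: finite_recovery_selections)

lemma recovery_cost_attained:
  assumes "x \<in> selections n p"
  obtains y where "y \<in> recovery_selections n p k x"
    "recovery_cost n p k x c = (\<Sum>i\<in>{1..n}. c i * real (y i))"
proof -
  have "recovery_cost n p k x c \<in> (\<lambda>y. \<Sum>i\<in>{1..n}. c i * real (y i)) ` recovery_selections n p k x"
    unfolding recovery_cost_def using self_in_recovery_selections[OF assms]
    by (intro Min_in) (auto intro: finite_recovery_selections)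
  then show ?thesis using that by blast
qed

text \<open>The multipliers are read off an optimal selection, whose exchange inequalities yield
  complementary slackness. Keeping them in the cost range \<open>lo..hi\<close> matters because the
  search covers only that range.\<close>

lemma strong_duality:
  assumes x: "x \<in> selections n p" and "1 \<le> p" and "k \<le> p"
    and c: "\<And>i. i \<in> {1..n} \<Longrightarrow> lo \<le> c i \<and> c i \<le> hi"
  obtains g a where "lo \<le> a" "a \<le> g" "g \<le> hi" "recovery_cost n p k x c = dual_value n p k x c g a"
proof -
  obtain y where y: "y \<in> recovery_selections n p k x"
    and opt: "recovery_cost n p k x c = (\<Sum>i\<in>{1..n}. c i * real (y i))"
    using recovery_cost_attained[OF x] .
  have swap: "c i \<le> c j" if "i \<in> {1..n}" "y i = 1" "j \<in> {1..n}" "y j = 0"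
      "x i \<le> x j \<or> p - k + x i \<le> (\<Sum>l\<in>{1..n}. x l * y l)" for i j
    using recovery_cost_le[OF swap_recovery_selection(1)[OF y that], of c]
      swap_recovery_selection(2)[OF y that, of c] opt by linarith
  have ysum: "(\<Sum>i\<in>{1..n}. y i) = p" and ge: "p - k \<le> (\<Sum>i\<in>{1..n}. x i * y i)"
    using y by (auto simp: recovery_selections_def)
  have ex1: "\<exists>i\<in>{1..n}. y i = 1"
  proof (rule ccontr)
    assume "\<not> ?thesis"
    then have "(\<Sum>i\<in>{1..n}. y i) = 0" using recovery_selections_values[OF y] by (intro sum.neutral) blast
    then show False using ysum \<open>1 \<le> p\<close> by simp
  qed
  show ?thesis
  proof (cases "(\<Sum>i\<in>{1..n}. x i * y i) = p - k")
    \<comment> \<open>Slack in the overlap constraint permits any exchange, so its multiplier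
      \<open>g - a\<close> is zero and the largest selected cost serves as common threshold.\<close>
    case False
    define S where "S = {i\<in>{1..n}. y i = 1}"
    define t where "t = Max (c ` S)"
    have S: "finite (c ` S)" "c ` S \<noteq> {}" using ex1 by (auto simp: S_def)
    obtain m where m: "m \<in> S" "t = c m" using Max_in[OF S] by (auto simp: t_def)
    have sw: "p - k + x m \<le> (\<Sum>l\<in>{1..n}. x l * y l)"
      using False ge selections_values[OF x, of m] m by (auto simp: S_def)
    have "(\<Sum>i\<in>{1..n}. c i * real (y i)) = dual_value n p k x c t t"
    proof (rule complementary_slackness[OF x y \<open>k \<le> p\<close>])
      fix i assume "i \<in> {1..n}" "y i = 1"
      then show "c i \<le> (if x i = 1 then t else t)" using S by (auto simp: t_def S_def)
    next
      fix i assume "i \<in> {1..n}" "y i = 0"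
      then show "(if x i = 1 then t else t) \<le> c i" using swap[of m i] sw m by (auto simp: S_def)
    qed simp
    then show ?thesis using that[of t t] opt c[of m] m by (auto simp: S_def)
  next
    \<comment> \<open>A tight overlap still permits exchanges with \<open>x i \<le> x j\<close>.
      They make \<open>g\<close> the least unselected cost in \<open>x\<close> and \<open>a\<close>
      the largest selected cost outside \<open>x\<close>; if there is no such item, an end of the
      cost range respects the remaining inequalities.\<close>
    case True
    define X0 where "X0 = {i\<in>{1..n}. x i = 1 \<and> y i = 0}"
    define Y1 where "Y1 = {i\<in>{1..n}. x i = 0 \<and> y i = 1}"
    define g where "g = (if X0 = {} then hi else Min (c ` X0))"
    define a where "a = (if Y1 = {} then lo else Max (c ` Y1))"
    have fin: "finite (c ` X0)" "finite (c ` Y1)" by (auto simp: X0_def Y1_def)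
    have gX0: "g \<le> c i" if "i \<in> X0" for i using that fin by (auto simp: g_def)
    have aY1: "c i \<le> a" if "i \<in> Y1" for i using that fin by (auto simp: a_def)
    have g_ge: "z \<le> g" if "z \<le> hi" "\<And>i. i \<in> X0 \<Longrightarrow> z \<le> c i" for z
      using that fin by (auto simp: g_def)
    have a_le: "a \<le> z" if "lo \<le> z" "\<And>i. i \<in> Y1 \<Longrightarrow> c i \<le> z" for z
      using that fin by (auto simp: a_def)
    have lohi: "lo \<le> hi" using ex1 c by force
    have "lo \<le> g" using lohi c by (intro g_ge) (auto simp: X0_def)
    then have "a \<le> g"
    proof (rule a_le)
      fix i assume i: "i \<in> Y1"
      show "c i \<le> g"
        using i c by (intro g_ge swap) (auto simp: X0_def Y1_def)
    qed
    moreover have "lo \<le> a"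
    proof (cases "Y1 = {}")
      case False
      then obtain i where "i \<in> Y1" by blast
      then show ?thesis using aY1[of i] c[of i] by (auto simp: Y1_def)
    qed (simp add: a_def)
    moreover have "g \<le> hi"
    proof (cases "X0 = {}")
      case False
      then obtain i where "i \<in> X0" by blast
      then show ?thesis using gX0[of i] c[of i] by (auto simp: X0_def)
    qed (simp add: g_def)
    moreover have "(\<Sum>i\<in>{1..n}. c i * real (y i)) = dual_value n p k x c g a"
    proof (rule complementary_slackness[OF x y \<open>k \<le> p\<close>])
      fix i assume i: "i \<in> {1..n}" "y i = 1"
      then show "c i \<le> (if x i = 1 then g else a)"
        using selections_values[OF x i(1)] c[OF i(1)] aY1[of i] swap[OF i]
        by (auto simp: Y1_def X0_def intro!: g_ge)
    next
      fix i assume i: "i \<in> {1..n}" "y i = 0"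
      then show "(if x i = 1 then g else a) \<le> c i"
        using selections_values[OF x i(1)] c[OF i(1)] gX0[of i] swap[OF _ _ i]
        by (auto simp: Y1_def X0_def intro!: a_le)
    qed (use True in simp)
    ultimately show ?thesis using that opt by simp
  qed
qed

section \<open>The robust value and a certificate of optimality\<close>

definition robust_value ::
  "nat \<Rightarrow> nat \<Rightarrow> nat \<Rightarrow> (nat \<Rightarrow> nat) \<Rightarrow> (nat \<Rightarrow> real) \<Rightarrow> (nat \<Rightarrow> real) \<Rightarrow> real \<Rightarrow> real \<Rightarrow> real \<Rightarrow> real"
where
  "robust_value n p k x cl cu \<Gamma> g a =
    min (dual_value n p k x cl g a + \<Gamma>) (dual_value n p k x cu g a)"

text \<open>Raising costs by a total of at most \<open>\<Gamma>\<close> lowers the penalties by at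
  most \<open>\<Gamma>\<close>, and no cost exceeds its upper value: these are the two arguments of
  the minimum.\<close>

lemma dual_value_le_robust_value:
  assumes "c \<in> budgeted_costs n cl cu \<Gamma>"
  shows "dual_value n p k x c g a \<le> robust_value n p k x cl cu \<Gamma> g a"
proof -
  let ?t = "\<lambda>i. if x i = 1 then g else a"
  obtain \<delta> where c: "c = (\<lambda>i\<in>{1..n}. cl i + \<delta> i)"
    and \<delta>: "\<And>i. i \<in> {1..n} \<Longrightarrow> 0 \<le> \<delta> i \<and> \<delta> i \<le> cu i - cl i" and s: "(\<Sum>i\<in>{1..n}. \<delta> i) \<le> \<Gamma>"
    using assms by (auto simp: budgeted_costs_def)
  have "(\<Sum>i\<in>{1..n}. max 0 (?t i - cl i)) - (\<Sum>i\<in>{1..n}. \<delta> i) \<le> (\<Sum>i\<in>{1..n}. max 0 (?t i - c i))"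
    unfolding sum_subtractf[symmetric]
  proof (rule sum_mono)
    fix i assume "i \<in> {1..n}"
    then show "max 0 (?t i - cl i) - \<delta> i \<le> max 0 (?t i - c i)" using \<delta>[of i] c by auto
  qed
  moreover have "(\<Sum>i\<in>{1..n}. max 0 (?t i - cu i)) \<le> (\<Sum>i\<in>{1..n}. max 0 (?t i - c i))"
  proof (rule sum_mono)
    fix i assume "i \<in> {1..n}"
    then show "max 0 (?t i - cu i) \<le> max 0 (?t i - c i)" using \<delta>[of i] c by auto
  qed
  ultimately show ?thesis using s by (simp add: robust_value_def dual_value_def)
qed

text \<open>A sandwich: strong duality and the maximality of \<open>(g, a)\<close> bound every
  admissible cost vector from above, weak duality at \<open>(g, a)\<close> bounds the vector built
  from \<open>\<delta>\<close> from below. Within its cap, each unit of \<open>\<delta> i\<close>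
  saves a full unit of penalty, so an exhausted budget reaches the first argument of
  \<open>robust_value\<close> and full caps reach the second.\<close>

lemma arec_solutionI:
  assumes inst: "arec_instance n p k x cl cu \<Gamma>"
    and bounds: "\<And>i. i \<in> {1..n} \<Longrightarrow> lo \<le> cl i \<and> cu i \<le> hi"
    and "a \<le> g"
    and opt: "\<And>g' a'. lo \<le> a' \<Longrightarrow> a' \<le> g' \<Longrightarrow> g' \<le> hi \<Longrightarrow>
      robust_value n p k x cl cu \<Gamma> g' a' \<le> robust_value n p k x cl cu \<Gamma> g a"
    and \<delta>: "\<And>i. i \<in> {1..n} \<Longrightarrow>
      0 \<le> \<delta> i \<and> \<delta> i \<le> min (cu i - cl i) (max 0 ((if x i = 1 then g else a) - cl i))"
    and "(\<Sum>i\<in>{1..n}. \<delta> i) \<le> \<Gamma>"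
    and greedy: "(\<Sum>i\<in>{1..n}. \<delta> i) = \<Gamma> \<or>
      (\<forall>i\<in>{1..n}. \<delta> i = min (cu i - cl i) (max 0 ((if x i = 1 then g else a) - cl i)))"
  shows "arec_solution n p k x cl cu \<Gamma> (\<lambda>i\<in>{1..n}. cl i + \<delta> i) (robust_value n p k x cl cu \<Gamma> g a)"
proof -
  let ?t = "\<lambda>i. if x i = 1 then g else a"
  let ?M = "robust_value n p k x cl cu \<Gamma>"
  define c where "c = (\<lambda>i\<in>{1..n}. cl i + \<delta> i)"
  have x: "x \<in> selections n p" and p: "1 \<le> p" "k \<le> p" using inst by (auto simp: arec_instance_def)
  have c_in: "c \<in> budgeted_costs n cl cu \<Gamma>"
    unfolding budgeted_costs_def c_def
    by (rule CollectI, rule exI[of _ \<delta>]) (use \<delta> \<open>(\<Sum>i\<in>{1..n}. \<delta> i) \<le> \<Gamma>\<close> in auto)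
  have upper: "recovery_cost n p k x c' \<le> ?M g a" if c': "c' \<in> budgeted_costs n cl cu \<Gamma>" for c'
  proof -
    have "lo \<le> c' i \<and> c' i \<le> hi" if "i \<in> {1..n}" for i
    proof -
      obtain \<delta>' where "c' = (\<lambda>i\<in>{1..n}. cl i + \<delta>' i)" "\<forall>i\<in>{1..n}. \<delta>' i \<in> {0..cu i - cl i}"
        using c' by (auto simp: budgeted_costs_def)
      then show ?thesis using bounds[OF that] that by fastforce
    qed
    then obtain g' a' where "lo \<le> a'" "a' \<le> g'" "g' \<le> hi"
      "recovery_cost n p k x c' = dual_value n p k x c' g' a'"
      using strong_duality[OF x p] by metis
    then show ?thesis using opt[of a' g'] dual_value_le_robust_value[OF c', of p k x g' a'] by linarith
  qed
  have "?M g a \<le> dual_value n p k x c g a"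
    using greedy
  proof
    assume tight: "(\<Sum>i\<in>{1..n}. \<delta> i) = \<Gamma>"
    have "(\<Sum>i\<in>{1..n}. max 0 (?t i - c i)) = (\<Sum>i\<in>{1..n}. max 0 (?t i - cl i) - \<delta> i)"
    proof (rule sum.cong[OF refl])
      fix i assume "i \<in> {1..n}"
      then show "max 0 (?t i - c i) = max 0 (?t i - cl i) - \<delta> i" using \<delta>[of i] by (auto simp: c_def)
    qed
    then show ?thesis using tight by (simp add: robust_value_def dual_value_def sum_subtractf)
  next
    assume full: "\<forall>i\<in>{1..n}. \<delta> i = min (cu i - cl i) (max 0 (?t i - cl i))"
    have "(\<Sum>i\<in>{1..n}. max 0 (?t i - c i)) = (\<Sum>i\<in>{1..n}. max 0 (?t i - cu i))"
    proof (rule sum.cong[OF refl])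
      fix i assume i: "i \<in> {1..n}"
      then have "cl i \<le> cu i" using inst by (auto simp: arec_instance_def)
      then show "max 0 (?t i - c i) = max 0 (?t i - cu i)"
        using full i by (auto simp: c_def min_def max_def)
    qed
    then show ?thesis by (simp add: robust_value_def dual_value_def)
  qed
  moreover obtain y where "y \<in> recovery_selections n p k x"
      "recovery_cost n p k x c = (\<Sum>i\<in>{1..n}. c i * real (y i))"
    using recovery_cost_attained[OF x] .
  ultimately have lower: "?M g a \<le> recovery_cost n p k x c"
    using weak_duality[OF x _ p(2) \<open>a \<le> g\<close>, of y c] by linarith
  have eq: "recovery_cost n p k x c = ?M g a" using lower upper[OF c_in] by linarith
  show ?thesis
    unfolding arec_solution_def c_def[symmetric] eq is_arg_max_linorder using c_in upper by simp
qed

section \<open>Concave piecewise linear functions\<close>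

text \<open>The slope is \<open>s\<close> to the left of all breakpoints and drops by
  \<open>w e\<close> at \<open>b e\<close>.\<close>

definition hinge :: "nat \<Rightarrow> real \<Rightarrow> (nat \<Rightarrow> real) \<Rightarrow> (nat \<Rightarrow> real) \<Rightarrow> real \<Rightarrow> real" where
  "hinge N s w b t = s * t - (\<Sum>e<N. w e * max 0 (t - b e))"

lemma concave_on_max0: "concave_on UNIV (\<lambda>t::real. - max 0 (t - c))"
  unfolding concave_on_iff
proof (intro conjI ballI allI impI)
  fix x y u v :: real
  assume uv: "0 \<le> u" "0 \<le> v" "u + v = 1"
  have c: "c = u * c + v * c" using uv by (metis distrib_right mult_1)
  have "u * (x - c) \<le> u * max 0 (x - c)" "v * (y - c) \<le> v * max 0 (y - c)"
    using uv by (auto intro: mult_left_mono)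
  moreover have "0 \<le> u * max 0 (x - c)" "0 \<le> v * max 0 (y - c)" using uv by auto
  moreover have "u * x + v * y - c = u * (x - c) + v * (y - c)"
    using c by (simp add: algebra_simps)
  ultimately show "u * - max 0 (x - c) + v * - max 0 (y - c) \<le> - max 0 (u *\<^sub>R x + v *\<^sub>R y - c)"
    by simp
qed simp

lemma concave_on_linear: "concave_on UNIV (\<lambda>t::real. s * t)"
  by (simp add: concave_on_iff algebra_simps)

lemma concave_on_hinge:
  assumes "\<And>e. e < N \<Longrightarrow> 0 \<le> w e"
  shows "concave_on UNIV (hinge N s w b)"
proof -
  have "concave_on UNIV (\<lambda>t. s * t + (\<Sum>e<N. w e * - max 0 (t - b e)))"
    if "\<forall>e<N. 0 \<le> w e"
    using that
  proof (induction N)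
    case 0
    then show ?case using concave_on_linear by simp
  next
    case (Suc N)
    then have "concave_on UNIV (\<lambda>t. w N * - max 0 (t - b N))"
      by (intro concave_on_cmul concave_on_max0) auto
    moreover have "concave_on UNIV (\<lambda>t. s * t + (\<Sum>e<N. w e * - max 0 (t - b e)))"
      using Suc by simp
    ultimately show ?case using concave_on_add by (fastforce simp: add.assoc)
  qed
  then show ?thesis using assms unfolding hinge_def by (simp add: sum_negf)
qed

lemma concave_on_min:
  assumes "concave_on S f" "concave_on S g"
  shows "concave_on S (\<lambda>t. min (f t) (g t))"
  unfolding concave_on_iff
proof (intro conjI ballI allI impI)
  show "convex S" using assms(1) by (rule concave_on_imp_convex)
  fix x y and u v :: real
  assume xy: "x \<in> S" "y \<in> S" and uv: "0 \<le> u" "0 \<le> v" "u + v = 1"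
  have "u * f x + v * f y \<le> f (u *\<^sub>R x + v *\<^sub>R y)" "u * g x + v * g y \<le> g (u *\<^sub>R x + v *\<^sub>R y)"
    using assms xy uv by (auto simp: concave_on_iff)
  moreover have "u * min (f x) (g x) \<le> u * f x" "u * min (f x) (g x) \<le> u * g x"
    "v * min (f y) (g y) \<le> v * f y" "v * min (f y) (g y) \<le> v * g y"
    using uv by (auto intro: mult_left_mono)
  ultimately show "u * min (f x) (g x) + v * min (f y) (g y)
      \<le> min (f (u *\<^sub>R x + v *\<^sub>R y)) (g (u *\<^sub>R x + v *\<^sub>R y))"
    by linarith
qed

definition affine_on :: "real set \<Rightarrow> (real \<Rightarrow> real) \<Rightarrow> bool" where
  "affine_on S f \<longleftrightarrow> (\<exists>c d. \<forall>t\<in>S. f t = c + d * t)"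

lemma affine_on_hinge:
  assumes "\<And>e. e < N \<Longrightarrow> b e \<le> u \<or> v \<le> b e"
  shows "affine_on {u..v} (hinge N s w b)"
proof -
  have "hinge N s w b t = (\<Sum>e<N. if b e \<le> u then w e * b e else 0) +
      (s - (\<Sum>e<N. if b e \<le> u then w e else 0)) * t" if "t \<in> {u..v}" for t
  proof -
    have "(\<Sum>e<N. w e * max 0 (t - b e)) =
        (\<Sum>e<N. t * (if b e \<le> u then w e else 0) - (if b e \<le> u then w e * b e else 0))"
    proof (rule sum.cong[OF refl])
      fix e assume "e \<in> {..<N}"
      then show "w e * max 0 (t - b e) =
          t * (if b e \<le> u then w e else 0) - (if b e \<le> u then w e * b e else 0)"
        using assms[of e] that by (auto simp: max_def algebra_simps)
    qed
    also have "\<dots> = t * (\<Sum>e<N. if b e \<le> u then w e else 0) - (\<Sum>e<N. if b e \<le> u then w e * b e else 0)"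
      unfolding sum_subtractf sum_distrib_left ..
    finally show ?thesis unfolding hinge_def by (simp add: algebra_simps)
  qed
  then show ?thesis unfolding affine_on_def by blast
qed

lemma affine_on_add:
  assumes "affine_on S f" "affine_on S g"
  shows "affine_on S (\<lambda>t. f t + g t)"
proof -
  obtain c d c' d' where "\<forall>t\<in>S. f t = c + d * t" "\<forall>t\<in>S. g t = c' + d' * t"
    using assms by (auto simp: affine_on_def)
  then have "\<forall>t\<in>S. f t + g t = (c + c') + (d + d') * t" by (simp add: algebra_simps)
  then show ?thesis unfolding affine_on_def by blast
qed

lemma affine_on_const: "affine_on S (\<lambda>t. c)"
  unfolding affine_on_def by (rule exI[of _ c], rule exI[of _ 0]) simp

lemma affine_on_segment:
  assumes "affine_on {u..v} f" "u \<le> v" "0 \<le> \<theta>" "\<theta> \<le> 1"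
  shows "f (u + \<theta> * (v - u)) = f u + \<theta> * (f v - f u)"
proof -
  obtain c d where f: "\<And>t. t \<in> {u..v} \<Longrightarrow> f t = c + d * t" using assms by (auto simp: affine_on_def)
  have "\<theta> * (v - u) \<le> 1 * (v - u)" using assms by (intro mult_right_mono) auto
  then have "u + \<theta> * (v - u) \<in> {u..v}" using assms by auto
  then show ?thesis using f assms(2) by (simp add: algebra_simps)
qed

text \<open>Where the two functions cross with opposite monotonicity, the lower one on either side
  is bounded by the value at the crossing parameter \<open>\<theta>'\<close>. If their difference is
  constant, the quotient is 0 by the convention on division, and the crossing hypothesis is
  void.\<close>

lemma min_affine_le:
  fixes A0 A1 B0 B1 \<theta> K :: real
  defines "\<theta>' \<equiv> (B0 - A0) / ((B0 - A0) - (B1 - A1))"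
  assumes \<theta>: "0 \<le> \<theta>" "\<theta> \<le> 1"
    and K0: "min A0 B0 \<le> K" and K1: "min A1 B1 \<le> K"
    and K': "0 < \<theta>' \<Longrightarrow> \<theta>' < 1 \<Longrightarrow> min (A0 + \<theta>' * (A1 - A0)) (B0 + \<theta>' * (B1 - B0)) \<le> K"
  shows "min (A0 + \<theta> * (A1 - A0)) (B0 + \<theta> * (B1 - B0)) \<le> K"
proof -
  have comb: "a + r * (b - a) \<le> K" if "a \<le> K" "b \<le> K" "0 \<le> r" "r \<le> 1" for a b r :: real
  proof -
    have "(1 - r) * a + r * b \<le> K" using that by (intro convex_bound_le) auto
    then show ?thesis by (simp add: algebra_simps)
  qed
  \<comment> \<open>Either one function is at most \<open>K\<close> at both ends, or each end is
    controlled by a different function; the crossing matters only in the latter two cases.\<close>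
  consider "A0 \<le> K" "A1 \<le> K" | "B0 \<le> K" "B1 \<le> K"
    | "A0 \<le> K" "B1 \<le> K" "K < A1" "K < B0" | "B0 \<le> K" "A1 \<le> K" "K < A0" "K < B1"
    using K0 K1 by linarith
  then show ?thesis
  proof cases
    case 1
    then show ?thesis using comb[of A0 A1 \<theta>] \<theta> by linarith
  next
    case 2
    then show ?thesis using comb[of B0 B1 \<theta>] \<theta> by linarith
  next
    case 3
    define D where "D = (B0 - A0) - (B1 - A1)"
    have D: "0 < D" "\<theta>' = (B0 - A0) / D" using 3 by (auto simp: D_def \<theta>'_def)
    have b: "0 < \<theta>'" "\<theta>' < 1" using 3 D by (auto simp: D_def)
    have "\<theta>' * D = B0 - A0" using D by simp
    then have "A0 + \<theta>' * (A1 - A0) = B0 + \<theta>' * (B1 - B0)" by (simp add: D_def algebra_simps)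
    then have V: "A0 + \<theta>' * (A1 - A0) \<le> K" "B0 + \<theta>' * (B1 - B0) \<le> K" using K'[OF b] by auto
    show ?thesis
    proof (cases "\<theta> \<le> \<theta>'")
      case True
      have "\<theta> * (A1 - A0) \<le> \<theta>' * (A1 - A0)" using 3 True by (intro mult_right_mono) auto
      then show ?thesis using V by linarith
    next
      case False
      then have "\<theta> * (B1 - B0) \<le> \<theta>' * (B1 - B0)" using 3 by (intro mult_right_mono_neg) auto
      then show ?thesis using V by linarith
    qed
  next
    case 4
    define D where "D = (A0 - B0) - (A1 - B1)"
    \<comment> \<open>Reversing both signs makes the denominator positive, as in the previous
      case.\<close>
    have "\<theta>' = - (A0 - B0) / - D" unfolding \<theta>'_def D_def by (rule arg_cong2[of _ _ _ _ "(/)"]) auto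
    then have D: "0 < D" "\<theta>' = (A0 - B0) / D" unfolding minus_divide_divide using 4 by (simp_all add: D_def)
    have b: "0 < \<theta>'" "\<theta>' < 1" using 4 D by (auto simp: D_def)
    have "\<theta>' * D = A0 - B0" using D by simp
    then have "A0 + \<theta>' * (A1 - A0) = B0 + \<theta>' * (B1 - B0)" by (simp add: D_def algebra_simps)
    then have V: "A0 + \<theta>' * (A1 - A0) \<le> K" "B0 + \<theta>' * (B1 - B0) \<le> K" using K'[OF b] by auto
    show ?thesis
    proof (cases "\<theta> \<le> \<theta>'")
      case True
      have "\<theta> * (B1 - B0) \<le> \<theta>' * (B1 - B0)" using 4 True by (intro mult_right_mono) auto
      then show ?thesis using V by linarith
    next
      case False
      then have "\<theta> * (A1 - A0) \<le> \<theta>' * (A1 - A0)" using 4 by (intro mult_right_mono_neg) auto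
      then show ?thesis using V by linarith
    qed
  qed
qed

text \<open>\<open>s\<close> is a proper convex combination of \<open>t\<close> and
  \<open>u\<close>, so \<open>h t > h u\<close> would force \<open>h s > h u\<close>.\<close>

lemma concave_le_beyond:
  fixes h :: "real \<Rightarrow> real"
  assumes h: "concave_on UNIV h" and s: "t < s \<and> s < u \<or> u < s \<and> s < t" and "h s \<le> h u"
  shows "h t \<le> h u"
proof -
  define r where "r = (s - t) / (u - t)"
  have r: "0 < r" "r < 1" using s by (auto simp: r_def divide_simps)
  have "r * (u - t) = s - t" using s by (auto simp: r_def)
  then have "s = (1 - r) *\<^sub>R t + r *\<^sub>R u" by (simp add: algebra_simps)
  then have "(1 - r) * h t + r * h u \<le> h s" using h r by (auto simp: concave_on_iff)
  then have "(1 - r) * h t \<le> (1 - r) * h u" using assms(3) by (simp add: algebra_simps)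
  then show ?thesis using \<open>r < 1\<close> by simp
qed

text \<open>Beyond the two neighbours of \<open>pos\<close>, \<open>concave_le_beyond\<close>
  applies with the neighbour as intermediate point, so only the adjacent segments need to be
  examined. At an end of the range a segment degenerates to a point.\<close>

lemma concave_grid_max:
  fixes h :: "real \<Rightarrow> real" and b :: "nat \<Rightarrow> real"
  assumes h: "concave_on UNIV h"
    and b: "\<And>i j. i < j \<Longrightarrow> j \<le> hi \<Longrightarrow> b i < b j"
    and pos: "lo \<le> pos" "pos \<le> hi"
    and left: "lo < pos \<Longrightarrow> h (b (pos - 1)) \<le> h (b pos)"
    and right: "pos < hi \<Longrightarrow> h (b (pos + 1)) \<le> h (b pos)"
    and K1: "\<And>t. t \<in> {b (if lo < pos then pos - 1 else pos)..b pos} \<Longrightarrow> h t \<le> K"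
    and K2: "\<And>t. t \<in> {b pos..b (if pos < hi then pos + 1 else pos)} \<Longrightarrow> h t \<le> K"
    and t: "t \<in> {b lo..b hi}"
  shows "h t \<le> K"
proof -
  have K: "h (b pos) \<le> K" using K2[of "b pos"] b[of pos "pos + 1"] by (cases "pos < hi") auto
  consider "t \<in> {b (if lo < pos then pos - 1 else pos)..b pos}"
    | "t \<in> {b pos..b (if pos < hi then pos + 1 else pos)}"
    | "t < b (if lo < pos then pos - 1 else pos)" | "b (if pos < hi then pos + 1 else pos) < t"
    by atomize_elim (simp only: atLeastAtMost_iff, linarith)
  then show ?thesis
  proof cases
    case 3
    then have *: "lo < pos" "t < b (pos - 1)" using t pos by (auto split: if_splits)
    then have "h t \<le> h (b pos)"
      using b[of "pos - 1" pos] pos left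
      by (intro concave_le_beyond[OF h, of t "b (pos - 1)"]) auto
    then show ?thesis using K by simp
  next
    case 4
    then have *: "pos < hi" "b (pos + 1) < t" using t pos by (auto split: if_splits)
    then have "h t \<le> h (b pos)"
      using b[of pos "pos + 1"] pos right
      by (intro concave_le_beyond[OF h, of t "b (pos + 1)"]) auto
    then show ?thesis using K by simp
  qed (use K1 K2 in auto)
qed

section \<open>Moving a point onto a grid line or the diagonal\<close>

lemma first_hit:
  fixes c v :: "'a \<Rightarrow> real"
  assumes "finite I" and c: "\<And>i. i \<in> I \<Longrightarrow> 0 < c i" and v: "\<exists>i\<in>I. v i < 0"
  obtains \<epsilon> where "0 \<le> \<epsilon>" "\<And>i. i \<in> I \<Longrightarrow> 0 \<le> c i + \<epsilon> * v i" "\<exists>i\<in>I. c i + \<epsilon> * v i = 0"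
proof -
  define J where "J = {i\<in>I. v i < 0}"
  \<comment> \<open>The ratio test of the simplex method: the first constraint to become tight
    determines the step length.\<close>
  define \<epsilon> where "\<epsilon> = Min ((\<lambda>i. c i / - v i) ` J)"
  have J: "finite J" "J \<noteq> {}" using assms by (auto simp: J_def)
  have le: "\<epsilon> \<le> c i / - v i" if "i \<in> J" for i using J that by (auto simp: \<epsilon>_def)
  have "\<epsilon> \<in> (\<lambda>i. c i / - v i) ` J" unfolding \<epsilon>_def using J by (intro Min_in) auto
  then obtain m where m: "m \<in> J" "\<epsilon> = c m / - v m" by blast
  have "0 \<le> \<epsilon>" using m c[of m] by (auto simp: J_def divide_nonneg_neg less_imp_le)
  show ?thesis
  proof (rule that[of \<epsilon>])
    fix i assume i: "i \<in> I"
    show "0 \<le> c i + \<epsilon> * v i"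
    proof (cases "v i < 0")
      case True
      then have "\<epsilon> \<le> c i / - v i" using le i by (auto simp: J_def)
      then have "\<epsilon> * - v i \<le> c i" using True pos_le_divide_eq[of "- v i" \<epsilon> "c i"] by linarith
      then show ?thesis by simp
    next
      case False
      then show ?thesis using c[OF i] \<open>0 \<le> \<epsilon>\<close> by (simp add: add_nonneg_nonneg)
    qed
  next
    show "\<exists>i\<in>I. c i + \<epsilon> * v i = 0" using m by (intro bexI[of _ m]) (auto simp: J_def)
  qed fact
qed

lemma grid_cell:
  fixes b :: "nat \<Rightarrow> real"
  assumes "b 0 \<le> t" "t \<le> b m" "t \<notin> b ` {..m}"
  obtains i where "i < m" "b i < t" "t < b (Suc i)"
proof -
  define P where "P j \<longleftrightarrow> t < b j" for j
  have "P m" using assms by (auto simp: P_def less_le)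
  define j where "j = (LEAST j. P j)"
  have j: "P j" "j \<le> m" unfolding j_def using \<open>P m\<close> by (auto intro: LeastI Least_le)
  have "j \<noteq> 0" using j assms by (auto simp: P_def intro!: Nat.gr0I)
  then obtain i where i: "j = Suc i" using not0_implies_Suc by blast
  have "\<not> P i" unfolding i[symmetric] using i not_less_Least[of i P] by (simp add: j_def)
  moreover have "b i \<noteq> t" using assms(3) i j by auto
  ultimately show ?thesis using that[of i] i j by (auto simp: P_def)
qed

text \<open>
  In the interior of a cell, both functions are affine, so the point can be moved along a direction
  in which their difference is constant and neither decreases, until it reaches a grid line or the
  diagonal.
\<close>

lemma move_to_line:
  fixes f1 f2 g1 g2 :: "real \<Rightarrow> real" and b :: "nat \<Rightarrow> real" and K :: real
  assumes aff: "\<And>i. i < m \<Longrightarrow> affine_on {b i..b (Suc i)} f1 \<and> affine_on {b i..b (Suc i)} f2 \<and>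
      affine_on {b i..b (Suc i)} g1 \<and> affine_on {b i..b (Suc i)} g2"
    and b: "\<And>i j. i \<le> j \<Longrightarrow> j \<le> m \<Longrightarrow> b i \<le> b j"
    and ga: "b 0 \<le> a" "a \<le> g" "g \<le> b m"
  obtains g' a' where "b 0 \<le> a'" "a' \<le> g'" "g' \<le> b m"
    "g' \<in> b ` {..m} \<or> a' \<in> b ` {..m} \<or> g' = a'"
    "min (f1 g + g1 a + \<Gamma>) (f2 g + g2 a) \<le> min (f1 g' + g1 a' + \<Gamma>) (f2 g' + g2 a')"
proof (cases "g \<in> b ` {..m} \<or> a \<in> b ` {..m} \<or> g = a")
  case True
  then show ?thesis using that ga by blast
next
  case False
  obtain i where i: "i < m" "b i < g" "g < b (Suc i)" using grid_cell[of b g m] ga False by auto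
  obtain j where j: "j < m" "b j < a" "a < b (Suc j)" using grid_cell[of b a m] ga False by auto
  obtain c1 d1 where f1: "\<And>t. t \<in> {b i..b (Suc i)} \<Longrightarrow> f1 t = c1 + d1 * t"
    using aff[OF i(1)] unfolding affine_on_def by blast
  obtain c2 d2 where f2: "\<And>t. t \<in> {b i..b (Suc i)} \<Longrightarrow> f2 t = c2 + d2 * t"
    using aff[OF i(1)] unfolding affine_on_def by blast
  obtain c3 d3 where g1: "\<And>t. t \<in> {b j..b (Suc j)} \<Longrightarrow> g1 t = c3 + d3 * t"
    using aff[OF j(1)] unfolding affine_on_def by blast
  obtain c4 d4 where g2: "\<And>t. t \<in> {b j..b (Suc j)} \<Longrightarrow> g2 t = c4 + d4 * t"
    using aff[OF j(1)] unfolding affine_on_def by blast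
  \<comment> \<open>One homogeneous linear equation in two unknowns has a nonzero solution; flipping
    its sign makes the common rate of change nonnegative.\<close>
  obtain u w where uw: "u \<noteq> 0 \<or> w \<noteq> 0" "(d2 - d1) * u + (d4 - d3) * w = 0" "0 \<le> d1 * u + d3 * w"
  proof -
    obtain u w where *: "u \<noteq> 0 \<or> w \<noteq> 0" "(d2 - d1) * u + (d4 - d3) * w = 0"
    proof (cases "d2 = d1 \<and> d4 = d3")
      case True
      then show ?thesis using that[of 1 0] by simp
    next
      case False
      then show ?thesis using that[of "d4 - d3" "d1 - d2"] by (auto simp: algebra_simps)
    qed
    show ?thesis
    proof (cases "0 \<le> d1 * u + d3 * w")
      case True
      then show ?thesis using that * by blast
    next
      case False
      then show ?thesis using that[of "- u" "- w"] * by (simp add: algebra_simps)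
    qed
  qed
  \<comment> \<open>Each pair holds the distance to a side of a cell or to the diagonal, and its
    rate of change. A nonzero direction makes one of \<open>u\<close>, \<open>- u\<close>,
    \<open>w\<close>, \<open>- w\<close> negative, so some constraint is hit.\<close>
  define I where "I = {(g - b i, u), (b (Suc i) - g, - u), (a - b j, w), (b (Suc j) - a, - w), (g - a, u - w)}"
  obtain \<epsilon> where \<epsilon>: "0 \<le> \<epsilon>" "\<forall>q\<in>I. 0 \<le> fst q + \<epsilon> * snd q" "\<exists>q\<in>I. fst q + \<epsilon> * snd q = 0"
  proof (rule first_hit)
    show "finite I" by (simp add: I_def)
    show "0 < fst q" if "q \<in> I" for q using that i j ga False by (auto simp: I_def)
    show "\<exists>q\<in>I. snd q < 0" using uw(1) by (auto simp: I_def)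
  qed blast
  define g' where "g' = g + \<epsilon> * u"
  define a' where "a' = a + \<epsilon> * w"
  have cell: "b i \<le> g'" "g' \<le> b (Suc i)" "b j \<le> a'" "a' \<le> b (Suc j)" "a' \<le> g'"
    using \<epsilon>(2) unfolding I_def g'_def a'_def by (simp_all add: algebra_simps)
  have hit: "g' = b i \<or> g' = b (Suc i) \<or> a' = b j \<or> a' = b (Suc j) \<or> g' = a'"
    using \<epsilon>(3) unfolding I_def g'_def a'_def by (simp add: algebra_simps) argo
  have A: "f1 g' + g1 a' = f1 g + g1 a + \<epsilon> * (d1 * u + d3 * w)"
    using cell i j by (simp add: f1 g1) (simp add: g'_def a'_def algebra_simps)
  have B: "f2 g' + g2 a' = f2 g + g2 a + \<epsilon> * (d2 * u + d4 * w)"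
    using cell i j by (simp add: f2 g2) (simp add: g'_def a'_def algebra_simps)
  have "d2 * u + d4 * w = d1 * u + d3 * w" using uw(2) by (simp add: algebra_simps)
  then have B': "f2 g' + g2 a' = f2 g + g2 a + \<epsilon> * (d1 * u + d3 * w)" using B by simp
  have "0 \<le> \<epsilon> * (d1 * u + d3 * w)" using \<epsilon> uw by simp
  then have le: "min (f1 g + g1 a + \<Gamma>) (f2 g + g2 a) \<le> min (f1 g' + g1 a' + \<Gamma>) (f2 g' + g2 a')"
    using A B' by (intro min.mono) linarith+
  have "b 0 \<le> b j" "b (Suc i) \<le> b m" using b i j by auto
  moreover have "g' \<in> b ` {..m} \<or> a' \<in> b ` {..m} \<or> g' = a'" using hit i j by force
  ultimately show ?thesis using that[of a' g'] cell le by linarith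
qed

section \<open>The dual values as sums of hinge functions\<close>

lemma shift_sum: "(\<Sum>i\<in>{1..n}. f i) = (\<Sum>e<n. f (Suc e))"
  using sum.atLeast1_atMost_eq[of f n] by simp

text \<open>One zero-based list of \<open>2 * n\<close> entries puts all functions on a common grid;
  the weights below pick out the half and the items that concern each of them.\<close>

definition breakpoint :: "nat \<Rightarrow> (nat \<Rightarrow> real) \<Rightarrow> (nat \<Rightarrow> real) \<Rightarrow> nat \<Rightarrow> real" where
  "breakpoint n cl cu e = (if e < n then cl (Suc e) else cu (Suc (e - n)))"

definition low_weight :: "nat \<Rightarrow> (nat \<Rightarrow> nat) \<Rightarrow> nat \<Rightarrow> nat \<Rightarrow> real" where
  "low_weight n x r e = (if e < n \<and> x (Suc e) = r then 1 else 0)"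

definition high_weight :: "nat \<Rightarrow> (nat \<Rightarrow> nat) \<Rightarrow> nat \<Rightarrow> nat \<Rightarrow> real" where
  "high_weight n x r e = (if n \<le> e \<and> x (Suc (e - n)) = r then 1 else 0)"

lemma sum_low_high:
  fixes f :: "nat \<Rightarrow> real"
  shows "(\<Sum>e<n + m. f e) = (\<Sum>e<n. f e) + (\<Sum>e<m. f (n + e))"
  by (induction m) auto

text \<open>Every item sees only one of the two thresholds, so the penalty splits into a function of
  \<open>g\<close> and a function of \<open>a\<close>. Zero weights switch off the upper
  costs.\<close>

lemma dual_value_low:
  assumes "x \<in> selections n p"
  shows "dual_value n p k x cl g a =
    hinge (n + n) (real (p - k)) (low_weight n x 1) (breakpoint n cl cu) g +
    hinge (n + n) (real k) (low_weight n x 0) (breakpoint n cl cu) a"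
proof -
  have "(\<Sum>i\<in>{1..n}. max 0 ((if x i = 1 then g else a) - cl i)) =
      (\<Sum>e<n. low_weight n x 1 e * max 0 (g - breakpoint n cl cu e)) +
      (\<Sum>e<n. low_weight n x 0 e * max 0 (a - breakpoint n cl cu e))"
    unfolding shift_sum sum.distrib[symmetric]
  proof (rule sum.cong[OF refl])
    fix e assume "e \<in> {..<n}"
    then show "max 0 ((if x (Suc e) = 1 then g else a) - cl (Suc e)) =
      low_weight n x 1 e * max 0 (g - breakpoint n cl cu e) +
        low_weight n x 0 e * max 0 (a - breakpoint n cl cu e)"
      using selections_values[OF assms, of "Suc e"] by (auto simp: low_weight_def breakpoint_def)
  qed
  then show ?thesis
    unfolding dual_value_def hinge_def sum_low_high by (simp add: low_weight_def sum.distrib)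
qed

lemma dual_value_high:
  assumes "x \<in> selections n p"
  shows "dual_value n p k x cu g a =
    hinge (n + n) (real (p - k)) (high_weight n x 1) (breakpoint n cl cu) g +
    hinge (n + n) (real k) (high_weight n x 0) (breakpoint n cl cu) a"
proof -
  have "(\<Sum>i\<in>{1..n}. max 0 ((if x i = 1 then g else a) - cu i)) =
      (\<Sum>e<n. high_weight n x 1 (n + e) * max 0 (g - breakpoint n cl cu (n + e))) +
      (\<Sum>e<n. high_weight n x 0 (n + e) * max 0 (a - breakpoint n cl cu (n + e)))"
    unfolding shift_sum sum.distrib[symmetric]
  proof (rule sum.cong[OF refl])
    fix e assume "e \<in> {..<n}"
    then show "max 0 ((if x (Suc e) = 1 then g else a) - cu (Suc e)) =
      high_weight n x 1 (n + e) * max 0 (g - breakpoint n cl cu (n + e)) +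
        high_weight n x 0 (n + e) * max 0 (a - breakpoint n cl cu (n + e))"
      using selections_values[OF assms, of "Suc e"] by (auto simp: high_weight_def breakpoint_def)
  qed
  then show ?thesis
    unfolding dual_value_def hinge_def sum_low_high by (simp add: high_weight_def sum.distrib)
qed

section \<open>Total correctness with running times\<close>

definition triple :: "(state \<Rightarrow> bool) \<Rightarrow> com \<Rightarrow> (state \<Rightarrow> bool) \<Rightarrow> nat \<Rightarrow> bool" where
  "triple P c Q T \<longleftrightarrow> (\<forall>s. P s \<longrightarrow> (\<exists>t s'. exec c s t s' \<and> t \<le> T \<and> Q s'))"

lemma tripleD: "triple P c Q T \<Longrightarrow> P s \<Longrightarrow> \<exists>t s'. exec c s t s' \<and> t \<le> T \<and> Q s'"
  by (simp add: triple_def)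

lemma triple_conseq:
  assumes "triple P c Q T" "\<And>s. P' s \<Longrightarrow> P s" "\<And>s. Q s \<Longrightarrow> Q' s" "T \<le> T'"
  shows "triple P' c Q' T'"
  unfolding triple_def using assms le_trans by (metis triple_def)

lemma triple_seq:
  assumes "triple P c Q T" "triple Q d R U"
  shows "triple P (Seq c d) R (T + U)"
  unfolding triple_def
proof (intro allI impI)
  fix s assume "P s"
  then obtain t s' where 1: "exec c s t s'" "t \<le> T" "Q s'" using tripleD[OF assms(1)] by blast
  then obtain u s'' where "exec d s' u s''" "u \<le> U" "R s''" using tripleD[OF assms(2)] by blast
  with 1 show "\<exists>t s'. exec (Seq c d) s t s' \<and> t \<le> T + U \<and> R s'"
    by (meson exec.Seq add_mono)
qed

fun cost_bound :: "com \<Rightarrow> nat" where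
  "cost_bound Skip = 1"
| "cost_bound (ISet v e) = 1 + icost e"
| "cost_bound (RSet v e) = 1 + rcost e"
| "cost_bound (IStore a i e) = 1 + icost i + icost e"
| "cost_bound (RStore a i e) = 1 + icost i + rcost e"
| "cost_bound (Seq c d) = cost_bound c + cost_bound d"
| "cost_bound (Cond b c d) = 1 + bcost b + max (cost_bound c) (cost_bound d)"
| "cost_bound (While b c) = 0"

text \<open>Loops are handled by separate rules: \<open>wp\<close> rejects them, so their \<open>cost_bound\<close> is irrelevant.\<close>

fun wp :: "com \<Rightarrow> (state \<Rightarrow> bool) \<Rightarrow> state \<Rightarrow> bool" where
  "wp Skip Q s = Q s"
| "wp (ISet v e) Q s = Q (s\<lparr>ivar := (ivar s)(v := ieval e s)\<rparr>)"
| "wp (RSet v e) Q s = Q (s\<lparr>rvar := (rvar s)(v := reval e s)\<rparr>)"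
| "wp (IStore a i e) Q s = Q (s\<lparr>iarr := (iarr s)(a := (iarr s a)(ieval i s := ieval e s))\<rparr>)"
| "wp (RStore a i e) Q s = Q (s\<lparr>rarr := (rarr s)(a := (rarr s a)(ieval i s := reval e s))\<rparr>)"
| "wp (Seq c d) Q s = wp c (wp d Q) s"
| "wp (Cond b c d) Q s = (if beval b s then wp c Q s else wp d Q s)"
| "wp (While b c) Q s = False"

lemma wp_exec: "wp c Q s \<Longrightarrow> \<exists>t s'. exec c s t s' \<and> t \<le> cost_bound c \<and> Q s'"
proof (induction c arbitrary: Q s)
  case (Seq c d)
  then obtain t s' where 1: "exec c s t s'" "t \<le> cost_bound c" "wp d Q s'" by fastforce
  then obtain u s'' where "exec d s' u s''" "u \<le> cost_bound d" "Q s''" using Seq.IH(2) by blast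
  with 1 show ?case by (metis add_mono cost_bound.simps(6) exec.Seq)
next
  case (Cond b c d)
  show ?case
  proof (cases "beval b s")
    case True
    then obtain t s' where "exec c s t s'" "t \<le> cost_bound c" "Q s'"
      using Cond by fastforce
    then show ?thesis using exec.CondTrue[OF True, of c t s' d]
      by (intro exI[of _ "1 + bcost b + t"] exI[of _ s']) simp
  next
    case False
    then obtain t s' where "exec d s t s'" "t \<le> cost_bound d" "Q s'"
      using Cond by fastforce
    then show ?thesis using exec.CondFalse[OF False, of d t s' c]
      by (intro exI[of _ "1 + bcost b + t"] exI[of _ s']) simp
  qed
qed (fastforce intro: exec.intros simp del: One_nat_def)+

lemma triple_wp: "(\<And>s. P s \<Longrightarrow> wp c Q s) \<Longrightarrow> triple P c Q (cost_bound c)"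
  unfolding triple_def using wp_exec by blast

text \<open>The variant drops in every pass, so there are at most \<open>M\<close> passes; the
  additional factor 1 pays for the failing test.\<close>

lemma triple_while:
  fixes V :: "state \<Rightarrow> nat"
  assumes body: "\<And>m. triple (\<lambda>s. I s \<and> beval b s \<and> V s = m) c (\<lambda>s. I s \<and> V s < m) T"
  shows "triple (\<lambda>s. I s \<and> V s \<le> M) (While b c) (\<lambda>s. I s \<and> \<not> beval b s) ((M + 1) * (1 + bcost b + T))"
  unfolding triple_def
proof (intro allI impI)
  fix s assume "I s \<and> V s \<le> M"
  then show "\<exists>t s'. exec (While b c) s t s' \<and> t \<le> (M + 1) * (1 + bcost b + T) \<and> I s' \<and> \<not> beval b s'"
  proof (induction M arbitrary: s rule: less_induct)
    case (less M)
    show ?case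
    proof (cases "beval b s")
      case False
      then show ?thesis using exec.WhileFalse[OF False, of c] less.prems
        by (intro exI[of _ "1 + bcost b"] exI[of _ s]) auto
    next
      case True
      then obtain t s' where 1: "exec c s t s'" "t \<le> T" "I s'" "V s' < V s"
        using tripleD[OF body, of s "V s"] less.prems by blast
      then obtain u s'' where 2: "exec (While b c) s' u s''" "u \<le> (V s' + 1) * (1 + bcost b + T)"
          "I s''" "\<not> beval b s''"
        using less.IH[of "V s'" s'] less.prems by auto
      have "(V s' + 1) * (1 + bcost b + T) \<le> M * (1 + bcost b + T)"
        using 1 less.prems by (intro mult_right_mono) auto
      then have "1 + bcost b + t + u \<le> (M + 1) * (1 + bcost b + T)"
        using 1 2 by (simp add: algebra_simps)
      then show ?thesis using exec.WhileTrue[OF True 1(1) 2(1)] 2 by blast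
    qed
  qed
qed

definition For :: "name \<Rightarrow> name \<Rightarrow> com \<Rightarrow> com" where
  "For v w c = Seq (ISet v (IConst 0))
    (While (ILess (IVar v) (IVar w)) (Seq c (ISet v (IAdd (IVar v) (IConst 1)))))"

text \<open>The 2 pays for the initialization, the 8 for the loop test (4) and the increment (4) of
  each pass.\<close>

definition for_cost :: "nat \<Rightarrow> nat \<Rightarrow> nat" where
  "for_cost B T = 2 + (B + 1) * (T + 8)"

lemma for_cost_mono: "B \<le> B' \<Longrightarrow> T \<le> T' \<Longrightarrow> for_cost B T \<le> for_cost B' T'"
  unfolding for_cost_def by (intro add_mono mult_mono) auto

text \<open>The body has to establish the invariant as it reads after the increment. The second
  premise makes every invariant record counter and bound, and \<open>B - ivar s v\<close> is the
  variant.\<close>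

lemma triple_for:
  assumes init: "\<And>s. P s \<Longrightarrow> I 0 (s\<lparr>ivar := (ivar s)(v := 0)\<rparr>)"
    and inv: "\<And>m s. I m s \<Longrightarrow> ivar s v = m \<and> m \<le> B \<and> ivar s w = B"
    and body: "\<And>m. m < B \<Longrightarrow>
      triple (I m) c (\<lambda>s. I (Suc m) (s\<lparr>ivar := (ivar s)(v := Suc (ivar s v))\<rparr>)) T"
    and final: "\<And>s. I B s \<Longrightarrow> Q s"
  shows "triple P (For v w c) Q (for_cost B T)"
proof -
  let ?J = "\<lambda>s. I (ivar s v) s"
  have incr: "triple (\<lambda>s. I (Suc m) (s\<lparr>ivar := (ivar s)(v := Suc (ivar s v))\<rparr>))
      (ISet v (IAdd (IVar v) (IConst 1))) (I (Suc m)) 4" for m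
    using triple_wp[of "\<lambda>s. I (Suc m) (s\<lparr>ivar := (ivar s)(v := Suc (ivar s v))\<rparr>)"
        "ISet v (IAdd (IVar v) (IConst 1))" "I (Suc m)"]
    by (simp add: eval_nat_numeral)
  have "triple (\<lambda>s. ?J s \<and> beval (ILess (IVar v) (IVar w)) s \<and> B - ivar s v = m)
      (Seq c (ISet v (IAdd (IVar v) (IConst 1)))) (\<lambda>s. ?J s \<and> B - ivar s v < m) (T + 4)" for m
  proof (cases "0 < m \<and> m \<le> B")
    case True
    then have "B - m < B" by auto
    from triple_seq[OF body[OF this] incr] show ?thesis
    proof (rule triple_conseq)
      fix s assume *: "I (ivar s v) s \<and> beval (ILess (IVar v) (IVar w)) s \<and> B - ivar s v = m"
      then have "ivar s v = B - m" using inv[of "ivar s v" s] by auto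
      then show "I (B - m) s" using * by simp
    next
      fix s assume "I (Suc (B - m)) s"
      moreover from inv[OF this] have "ivar s v = Suc (B - m)" by simp
      ultimately show "I (ivar s v) s \<and> B - ivar s v < m" using True by simp
    qed simp
  next
    case False
    have "\<not> (?J s \<and> beval (ILess (IVar v) (IVar w)) s \<and> B - ivar s v = m)" for s
      using False inv[of "ivar s v" s] by auto
    then show ?thesis unfolding triple_def by blast
  qed
  from triple_while[OF this, of B]
  have loop: "triple ?J (While (ILess (IVar v) (IVar w)) (Seq c (ISet v (IAdd (IVar v) (IConst 1)))))
      Q ((B + 1) * (T + 8))"
  proof (rule triple_conseq)
    fix s assume *: "I (ivar s v) s \<and> \<not> beval (ILess (IVar v) (IVar w)) s"
    then have "ivar s v = B" using inv[of "ivar s v" s] by auto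
    then show "Q s" using * final by metis
  qed auto
  have "triple P (ISet v (IConst 0)) ?J 2"
    by (rule triple_conseq[OF triple_wp[of P "ISet v (IConst 0)"]]) (use init in auto)
  from triple_seq[OF this loop] show ?thesis by (simp add: For_def for_cost_def)
qed

section \<open>Powers of two and breakpoint tables\<close>

notation Seq (infixr ";;" 60)

text \<open>The binary logarithm rounded up. It counts both the merge passes and the steps of a
  binary search.\<close>

definition log_up :: "nat \<Rightarrow> nat" where
  "log_up N = (LEAST e. N \<le> 2 ^ e)"

lemma le_two_power_log_up: "N \<le> 2 ^ log_up N"
proof -
  have "N \<le> 2 ^ N" by (simp add: less_imp_le)
  then show ?thesis unfolding log_up_def by (rule LeastI)
qed

lemma log_up_eqI:
  assumes "N \<le> 2 ^ e" "\<And>d. d < e \<Longrightarrow> 2 ^ d < N"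
  shows "log_up N = e"
  unfolding log_up_def using assms by (intro Least_equality) (auto simp: not_le[symmetric])

definition powers_code :: com where
  "powers_code =
    ISet ''N'' (IAdd (IVar ''n'') (IVar ''n'')) ;;
    IStore ''pw'' (IConst 0) (IConst 1) ;;
    ISet ''E'' (IConst 0)"

definition doubling_code :: com where
  "doubling_code =
    IStore ''pw'' (IAdd (IVar ''E'') (IConst 1))
      (IAdd (IArr ''pw'' (IVar ''E'')) (IArr ''pw'' (IVar ''E''))) ;;
    ISet ''E'' (IAdd (IVar ''E'') (IConst 1))"

text \<open>With no conversion between the sorts, \<open>real k\<close> and
  \<open>real (p - k)\<close> are obtained by adding 1 in those of the \<open>n\<close> iterations
  whose index is below \<open>k\<close> or \<open>p - k\<close>; a branch turns \<open>x\<close>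
  into real weights.\<close>

definition items_code :: com where
  "items_code =
    RStore ''key'' (IVar ''i'') (RArr ''cl'' (IAdd (IVar ''i'') (IConst 1))) ;;
    RStore ''key'' (IAdd (IVar ''n'') (IVar ''i'')) (RArr ''cu'' (IAdd (IVar ''i'') (IConst 1))) ;;
    IStore ''P'' (IVar ''i'') (IVar ''i'') ;;
    IStore ''P'' (IAdd (IVar ''n'') (IVar ''i'')) (IAdd (IVar ''n'') (IVar ''i'')) ;;
    Cond (ILess (IConst 0) (IArr ''x'' (IAdd (IVar ''i'') (IConst 1)))) (RSet ''v'' (RConst 1)) (RSet ''v'' (RConst 0)) ;;
    RStore ''w1'' (IVar ''i'') (RVar ''v'') ;;
    RStore ''w1'' (IAdd (IVar ''n'') (IVar ''i'')) (RConst 0) ;;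
    RStore ''w2'' (IVar ''i'') (RConst 0) ;;
    RStore ''w2'' (IAdd (IVar ''n'') (IVar ''i'')) (RVar ''v'') ;;
    RStore ''w3'' (IVar ''i'') (RSub (RConst 1) (RVar ''v'')) ;;
    RStore ''w3'' (IAdd (IVar ''n'') (IVar ''i'')) (RConst 0) ;;
    RStore ''w4'' (IVar ''i'') (RConst 0) ;;
    RStore ''w4'' (IAdd (IVar ''n'') (IVar ''i'')) (RSub (RConst 1) (RVar ''v'')) ;;
    Cond (ILess (IVar ''i'') (IVar ''k'')) (RSet ''rk'' (RAdd (RVar ''rk'') (RConst 1))) Skip ;;
    Cond (ILess (IVar ''i'') (ISub (IVar ''p'') (IVar ''k'')))
      (RSet ''rq'' (RAdd (RVar ''rq'') (RConst 1))) Skip"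


definition counters_code :: com where
  "counters_code = RSet ''rk'' (RConst 0) ;; RSet ''rq'' (RConst 0)"

definition prepare_code :: com where
  "prepare_code =
    (powers_code ;; While (ILess (IArr ''pw'' (IVar ''E'')) (IVar ''N'')) doubling_code) ;;
    counters_code ;;
    For ''i'' ''n'' items_code"

locale arec =
  fixes n p k :: nat and x :: "nat \<Rightarrow> nat" and cl cu :: "nat \<Rightarrow> real" and \<Gamma> :: real
  assumes inst: "arec_instance n p k x cl cu \<Gamma>"
begin

abbreviation N where "N \<equiv> n + n"
abbreviation E where "E \<equiv> log_up N"
abbreviation bp where "bp \<equiv> breakpoint n cl cu"
abbreviation input where "input \<equiv> arec_input n p k x cl cu \<Gamma>"

definition powers_table :: "nat \<Rightarrow> (nat \<Rightarrow> nat) \<Rightarrow> bool" where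
  "powers_table e pw \<longleftrightarrow> (\<forall>d\<le>e. pw d = 2 ^ d) \<and> (\<forall>d<e. 2 ^ d < N)"

text \<open>Iteration \<open>i\<close> fills positions \<open>i\<close> and \<open>n + i\<close>, so
  two separate stretches of length \<open>m\<close> are valid in between.\<close>

definition item_tables ::
  "nat \<Rightarrow> (nat \<Rightarrow> real) \<Rightarrow> (nat \<Rightarrow> real) \<Rightarrow> (nat \<Rightarrow> real) \<Rightarrow> (nat \<Rightarrow> real) \<Rightarrow> (nat \<Rightarrow> real) \<Rightarrow> (nat \<Rightarrow> nat) \<Rightarrow> bool"
where
  "item_tables m key w1 w2 w3 w4 P \<longleftrightarrow> (\<forall>e. e < m \<or> n \<le> e \<and> e < n + m \<longrightarrow>
    key e = bp e \<and> w1 e = low_weight n x 1 e \<and> w2 e = high_weight n x 1 e \<and>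
    w3 e = low_weight n x 0 e \<and> w4 e = high_weight n x 0 e \<and> P e = e)"

definition base :: "state \<Rightarrow> bool" where
  "base s \<longleftrightarrow> input s \<and> ivar s ''E'' = E \<and> ivar s ''N'' = N \<and> powers_table E (iarr s ''pw'')"

definition prepared :: "state \<Rightarrow> bool" where
  "prepared s \<longleftrightarrow> base s \<and> rvar s ''rk'' = real k \<and> rvar s ''rq'' = real (p - k) \<and>
    item_tables n (rarr s ''key'') (rarr s ''w1'') (rarr s ''w2'') (rarr s ''w3'') (rarr s ''w4'') (iarr s ''P'')"

lemma item_tables_Suc:
  assumes tabs: "item_tables m key w1 w2 w3 w4 P" and m: "m < n"
    and x: "x (Suc m) = 0 \<and> r = 0 \<and> q = 1 \<or> x (Suc m) = 1 \<and> r = 1 \<and> q = 0"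
  shows "item_tables (Suc m) (key(m := cl (Suc m), n + m := cu (Suc m))) (w1(m := r, n + m := 0))
    (w2(m := 0, n + m := r)) (w3(m := q, n + m := 0)) (w4(m := 0, n + m := q)) (P(m := m, n + m := n + m))"
  unfolding item_tables_def
proof (intro allI impI)
  fix e assume "e < Suc m \<or> n \<le> e \<and> e < n + Suc m"
  then consider "e = m" | "e = n + m" | "e \<noteq> m" "e \<noteq> n + m" "e < m \<or> n \<le> e \<and> e < n + m"
    by linarith
  then show "(key(m := cl (Suc m), n + m := cu (Suc m))) e = bp e \<and>
      (w1(m := r, n + m := 0)) e = low_weight n x 1 e \<and> (w2(m := 0, n + m := r)) e = high_weight n x 1 e \<and>
      (w3(m := q, n + m := 0)) e = low_weight n x 0 e \<and> (w4(m := 0, n + m := q)) e = high_weight n x 0 e \<and>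
      (P(m := m, n + m := n + m)) e = e"
  proof cases
    case 3
    then show ?thesis using tabs unfolding item_tables_def by auto
  qed (use m x in \<open>auto simp: breakpoint_def low_weight_def high_weight_def\<close>)
qed

text \<open>The variant \<open>N - 2 ^ ivar s ''E''\<close> bounds the number of doublings only by
  \<open>N\<close>; this crude bound is still linear.\<close>

lemma powers_triple:
  "triple input (powers_code ;; While (ILess (IArr ''pw'' (IVar ''E'')) (IVar ''N'')) doubling_code) base
    (cost_bound powers_code + (N + 1) * (1 + bcost (ILess (IArr ''pw'' (IVar ''E'')) (IVar ''N'')) + cost_bound doubling_code))"
proof -
  let ?J = "\<lambda>s. input s \<and> ivar s ''N'' = N \<and> powers_table (ivar s ''E'') (iarr s ''pw'')"
  let ?b = "ILess (IArr ''pw'' (IVar ''E'')) (IVar ''N'')"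
  let ?V = "\<lambda>s. N - 2 ^ ivar s ''E''"
  have 1: "triple input powers_code (\<lambda>s. ?J s \<and> ?V s \<le> N) (cost_bound powers_code)"
    by (rule triple_wp) (simp add: powers_code_def arec_input_def powers_table_def)
  have "triple (\<lambda>s. ?J s \<and> beval ?b s \<and> ?V s = m) doubling_code (\<lambda>s. ?J s \<and> ?V s < m)
      (cost_bound doubling_code)" for m
  proof (rule triple_wp)
    fix s assume *: "?J s \<and> beval ?b s \<and> ?V s = m"
    then have "2 ^ ivar s ''E'' < N" by (auto simp: powers_table_def)
    then have "N - 2 * 2 ^ ivar s ''E'' < N - 2 ^ ivar s ''E''" by (intro diff_less_mono2) auto
    then show "wp doubling_code (\<lambda>s. ?J s \<and> ?V s < m) s"
      using * by (auto simp: doubling_code_def arec_input_def powers_table_def less_Suc_eq le_Suc_eq)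
  qed
  from triple_while[OF this, of N]
  have 2: "triple (\<lambda>s. ?J s \<and> ?V s \<le> N) (While ?b doubling_code) base
      ((N + 1) * (1 + bcost ?b + cost_bound doubling_code))"
  proof (rule triple_conseq)
    fix s assume *: "?J s \<and> \<not> beval ?b s"
    then have "ivar s ''E'' = E" by (intro log_up_eqI[symmetric]) (auto simp: powers_table_def)
    then show "base s" using * by (simp add: base_def)
  qed auto
  show ?thesis using triple_seq[OF 1 2] .
qed

lemma items_triple:
  "triple base (counters_code ;; For ''i'' ''n'' items_code)
    prepared (cost_bound counters_code + for_cost n (cost_bound items_code))"
proof -
  let ?I = "\<lambda>m s. base s \<and> ivar s ''i'' = m \<and> m \<le> n \<and>
    rvar s ''rk'' = real (min m k) \<and> rvar s ''rq'' = real (min m (p - k)) \<and>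
    item_tables m (rarr s ''key'') (rarr s ''w1'') (rarr s ''w2'') (rarr s ''w3'') (rarr s ''w4'') (iarr s ''P'')"
  have kp: "k \<le> n" "p \<le> n" using inst by (auto simp: arec_instance_def)
  have 1: "triple base counters_code
      (\<lambda>s. base s \<and> rvar s ''rk'' = 0 \<and> rvar s ''rq'' = 0) (cost_bound counters_code)"
    by (rule triple_wp) (simp add: counters_code_def base_def arec_input_def)
  have "triple (\<lambda>s. base s \<and> rvar s ''rk'' = 0 \<and> rvar s ''rq'' = 0) (For ''i'' ''n'' items_code)
    prepared (for_cost n (cost_bound items_code))"
  proof (rule triple_for[where I = ?I])
    fix m assume m: "m < n"
    show "triple (?I m) items_code (\<lambda>s. ?I (Suc m) (s\<lparr>ivar := (ivar s)(''i'' := Suc (ivar s ''i''))\<rparr>))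
        (cost_bound items_code)"
    proof (rule triple_wp)
      fix s assume *: "?I m s"
      have x: "iarr s ''x'' (Suc m) = x (Suc m)" "x (Suc m) = 0 \<or> x (Suc m) = 1"
        "rarr s ''cl'' (Suc m) = cl (Suc m)" "rarr s ''cu'' (Suc m) = cu (Suc m)"
        using * m inst selections_values[of x n p "Suc m"]
        by (auto simp: base_def arec_input_def arec_instance_def)
      have nv: "ivar s ''n'' = n" "ivar s ''k'' = k" "ivar s ''p'' = p"
        using * by (auto simp: base_def arec_input_def)
      show "wp items_code (\<lambda>s. ?I (Suc m) (s\<lparr>ivar := (ivar s)(''i'' := Suc (ivar s ''i''))\<rparr>)) s"
        using * m x nv
        using item_tables_Suc[of m _ _ _ _ _ _ "real (x (Suc m))" "1 - real (x (Suc m))"]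
        by (auto simp: items_code_def base_def arec_input_def)
    qed
  qed (use kp in \<open>auto simp: base_def arec_input_def item_tables_def prepared_def\<close>)
  from triple_seq[OF 1 this] show ?thesis .
qed

end

section \<open>Merge sort\<close>

definition blocks_sorted :: "(nat \<Rightarrow> real) \<Rightarrow> nat \<Rightarrow> nat \<Rightarrow> (nat \<Rightarrow> nat) \<Rightarrow> bool" where
  "blocks_sorted key w m P \<longleftrightarrow>
    (\<forall>q r. q \<le> r \<and> r < m \<and> q div w = r div w \<longrightarrow> key (P q) \<le> key (P r))"

text \<open>\<open>lo\<close> starts the output block, \<open>i\<close> and \<open>j\<close> are the
  read positions in its two halves. The alternative \<open>j = lo + w \<or> j \<le> N\<close> covers
  a last block cut off by \<open>N\<close> before its right half begins. Contents are compared as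
  images; injectivity is recovered later by counting.\<close>

definition merge_inv ::
  "(nat \<Rightarrow> real) \<Rightarrow> nat \<Rightarrow> nat \<Rightarrow> (nat \<Rightarrow> nat) \<Rightarrow> (nat \<Rightarrow> nat) \<Rightarrow> nat \<Rightarrow> nat \<Rightarrow> nat \<Rightarrow> nat \<Rightarrow> bool"
where
  "merge_inv key N w P Q lo m i j \<longleftrightarrow>
    2 * w dvd lo \<and> lo \<le> i \<and> i \<le> lo + w \<and> lo + w \<le> j \<and> j \<le> lo + 2 * w \<and> (j = lo + w \<or> j \<le> N) \<and>
    i + j = m + (lo + w) \<and>
    Q ` {..<m} = P ` ({..<i} \<union> {lo + w..<j}) \<and> blocks_sorted key (2 * w) m Q \<and>
    (\<forall>q. lo \<le> q \<and> q < m \<longrightarrow>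
      (\<forall>r. r < N \<and> (i \<le> r \<and> r < lo + w \<or> j \<le> r \<and> r < lo + 2 * w) \<longrightarrow> key (Q q) \<le> key (P r)))"

lemma merge_inv_start:
  assumes "2 * w dvd m" "Q ` {..<m} = P ` {..<m}" "blocks_sorted key (2 * w) m Q"
  shows "merge_inv key N w P Q m m m (m + w)"
  using assms by (simp add: merge_inv_def)

lemma merge_inv_full:
  assumes "merge_inv key N w P Q lo m i j" "m = lo + 2 * w"
  shows "2 * w dvd m" "Q ` {..<m} = P ` {..<m}" "blocks_sorted key (2 * w) m Q"
proof -
  have "i = lo + w" "j = lo + 2 * w" using assms by (auto simp: merge_inv_def)
  then have "{..<i} \<union> {lo + w..<j} = {..<m}" using assms(2) by auto
  then show "2 * w dvd m" "Q ` {..<m} = P ` {..<m}" "blocks_sorted key (2 * w) m Q"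
    using assms by (auto simp: merge_inv_def)
qed

text \<open>If \<open>j = lo + w\<close>, counting gives \<open>i = N\<close>; otherwise
  \<open>i \<le> lo + w\<close>, \<open>j \<le> N\<close> and the counting clause force both
  equalities. Either way exactly the positions below \<open>N\<close> are consumed.\<close>

lemma merge_inv_end:
  assumes "merge_inv key N w P Q lo N i j"
  shows "Q ` {..<N} = P ` {..<N}" "blocks_sorted key (2 * w) N Q"
proof -
  have "{..<i} \<union> {lo + w..<j} = {..<N}" using assms by (auto simp: merge_inv_def)
  then show "Q ` {..<N} = P ` {..<N}" "blocks_sorted key (2 * w) N Q"
    using assms by (auto simp: merge_inv_def)
qed

text \<open>As \<open>lo\<close> is a multiple of \<open>W\<close>, a position in the block of
  \<open>m\<close> cannot precede \<open>lo\<close>, so the new entry is only compared with the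
  current block.\<close>

lemma blocks_sorted_snoc:
  assumes sorted: "blocks_sorted key W m Q" and lo: "W dvd lo" "lo \<le> m" "m < lo + W"
    and ge: "\<And>q. lo \<le> q \<Longrightarrow> q < m \<Longrightarrow> key (Q q) \<le> key v"
  shows "blocks_sorted key W (Suc m) (Q(m := v))"
  unfolding blocks_sorted_def
proof (intro allI impI, elim conjE)
  fix q r assume qr: "q \<le> r" "r < Suc m" "q div W = r div W"
  show "key ((Q(m := v)) q) \<le> key ((Q(m := v)) r)"
  proof (cases "r = m")
    case True
    obtain d where d: "lo = W * d" using lo by blast
    have "0 < W" using lo by auto
    have "d \<le> m div W" using d lo \<open>0 < W\<close> by (simp add: less_eq_div_iff_mult_less_eq mult.commute)
    then have "d \<le> q div W" using qr True by simp
    then have "lo \<le> q" using d \<open>0 < W\<close> by (simp add: less_eq_div_iff_mult_less_eq mult.commute)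
    then show ?thesis using ge[of q] True qr by auto
  next
    case False
    then show ?thesis using qr sorted by (auto simp: blocks_sorted_def)
  qed
qed

lemma same_half_block:
  assumes "2 * w dvd lo" "0 < (w :: nat)"
  shows "lo \<le> r \<Longrightarrow> r < lo + w \<Longrightarrow> r div w = lo div w"
    and "lo + w \<le> r \<Longrightarrow> r < lo + 2 * w \<Longrightarrow> r div w = Suc (lo div w)"
proof -
  have "w dvd lo" using assms dvd_mult_right by blast
  then obtain d where d: "lo = w * d" by blast
  then have *: "lo div w = d" using assms by simp
  show "lo \<le> r \<Longrightarrow> r < lo + w \<Longrightarrow> r div w = lo div w"
    unfolding * using d by (intro div_nat_eqI) (auto simp: algebra_simps)
  show "lo + w \<le> r \<Longrightarrow> r < lo + 2 * w \<Longrightarrow> r div w = Suc (lo div w)"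
    unfolding * using d by (intro div_nat_eqI) (auto simp: algebra_simps)
qed

text \<open>Both runs are sorted, so \<open>P i\<close> is at most every entry of them that is still
  unread; this preserves the last clause of the invariant.\<close>

lemma merge_inv_left:
  assumes inv: "merge_inv key N w P Q lo m i j" and P: "blocks_sorted key w N P"
    and m: "m < N" "m < lo + 2 * w" and i: "i < lo + w"
    and le: "j < lo + 2 * w \<Longrightarrow> j < N \<Longrightarrow> key (P i) \<le> key (P j)"
  shows "merge_inv key N w P (Q(m := P i)) lo (Suc m) (Suc i) j"
proof -
  note I = inv[unfolded merge_inv_def]
  have w: "0 < w" using I i by auto
  have iN: "i < N" using I m by auto
  have left: "key (P i) \<le> key (P r)" if "i \<le> r" "r < lo + w" "r < N" for r
    using P same_half_block(1)[of w lo i] same_half_block(1)[of w lo r] I that w i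
    by (simp add: blocks_sorted_def)
  have right: "key (P i) \<le> key (P r)" if "j \<le> r" "r < lo + 2 * w" "r < N" for r
  proof -
    have "key (P j) \<le> key (P r)"
      using P same_half_block(2)[of w lo j] same_half_block(2)[of w lo r] I that w
      by (simp add: blocks_sorted_def)
    then show ?thesis using le that by auto
  qed
  have "(Q(m := P i)) ` {..<Suc m} = insert (P i) (Q ` {..<m})" by (auto simp: lessThan_Suc)
  also have "\<dots> = P ` ({..<Suc i} \<union> {lo + w..<j})" using I by (auto simp: lessThan_Suc)
  finally have img: "(Q(m := P i)) ` {..<Suc m} = P ` ({..<Suc i} \<union> {lo + w..<j})" .
  have "blocks_sorted key (2 * w) (Suc m) (Q(m := P i))"
    by (rule blocks_sorted_snoc[where lo = lo]) (use I m i iN in auto)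
  then show ?thesis
    unfolding merge_inv_def using I img i left right by (auto simp: less_Suc_eq)
qed

lemma merge_inv_right:
  assumes inv: "merge_inv key N w P Q lo m i j" and P: "blocks_sorted key w N P"
    and m: "m < N" "m < lo + 2 * w"
    and ge: "\<not> i < lo + w \<or> j < lo + 2 * w \<and> j < N \<and> key (P j) < key (P i)"
  shows "merge_inv key N w P (Q(m := P j)) lo (Suc m) i (Suc j)"
proof -
  note I = inv[unfolded merge_inv_def]
  have w: "0 < w" using I m by auto
  \<comment> \<open>If the left run is exhausted, the counting clause gives
    \<open>j = m\<close>.\<close>
  have j: "j < N" "j < lo + 2 * w" using I m ge by auto
  have right: "key (P j) \<le> key (P r)" if "j \<le> r" "r < lo + 2 * w" "r < N" for r
    using P same_half_block(2)[of w lo j] same_half_block(2)[of w lo r] I that w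
    by (simp add: blocks_sorted_def)
  have left: "key (P j) \<le> key (P r)" if "i \<le> r" "r < lo + w" "r < N" for r
  proof -
    have "key (P i) \<le> key (P r)"
      using P same_half_block(1)[of w lo i] same_half_block(1)[of w lo r] I that w
      by (simp add: blocks_sorted_def)
    then show ?thesis using ge that by auto
  qed
  have "(Q(m := P j)) ` {..<Suc m} = insert (P j) (Q ` {..<m})" by (auto simp: lessThan_Suc)
  also have "\<dots> = P ` ({..<i} \<union> {lo + w..<Suc j})" using I by (auto simp: atLeastLessThanSuc)
  finally have img: "(Q(m := P j)) ` {..<Suc m} = P ` ({..<i} \<union> {lo + w..<Suc j})" .
  have "blocks_sorted key (2 * w) (Suc m) (Q(m := P j))"
    by (rule blocks_sorted_snoc[where lo = lo]) (use I m j in auto)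
  then show ?thesis
    unfolding merge_inv_def using I img j left right by (auto simp: less_Suc_eq)
qed

definition merge_start_code :: com where
  "merge_start_code = ISet ''w'' (IArr ''pw'' (IVar ''e'')) ;; ISet ''hi'' (IConst 0)"

text \<open>Each iteration writes one output position and resets the pointers when a block is full.
  A pass is thus one counted loop, and its linear cost needs no amortization; \<open>hi = 0\<close>
  triggers the first reset.\<close>

definition merge_code :: com where
  "merge_code =
    Cond (ILess (IVar ''o'') (IVar ''hi'')) Skip
      (ISet ''i'' (IVar ''o'') ;;
       ISet ''mid'' (IAdd (IVar ''o'') (IVar ''w'')) ;;
       ISet ''j'' (IVar ''mid'') ;;
       ISet ''hi'' (IAdd (IVar ''mid'') (IVar ''w''))) ;;
    Cond
      (BAnd (ILess (IVar ''i'') (IVar ''mid''))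
        (BNot (BAnd (BAnd (ILess (IVar ''j'') (IVar ''hi'')) (ILess (IVar ''j'') (IVar ''N'')))
          (RLess (RArr ''key'' (IArr ''P'' (IVar ''j''))) (RArr ''key'' (IArr ''P'' (IVar ''i'')))))))
      (IStore ''Q'' (IVar ''o'') (IArr ''P'' (IVar ''i'')) ;;
       ISet ''i'' (IAdd (IVar ''i'') (IConst 1)))
      (IStore ''Q'' (IVar ''o'') (IArr ''P'' (IVar ''j'')) ;;
       ISet ''j'' (IAdd (IVar ''j'') (IConst 1)))"

definition copy_code :: com where
  "copy_code = IStore ''P'' (IVar ''o'') (IArr ''Q'' (IVar ''o''))"

definition pass_code :: com where
  "pass_code = merge_start_code ;; For ''o'' ''N'' merge_code ;; For ''o'' ''N'' copy_code"

definition pass_cost :: "nat \<Rightarrow> nat" where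
  "pass_cost n = cost_bound merge_start_code +
    (for_cost (n + n) (cost_bound merge_code) + for_cost (n + n) (cost_bound copy_code))"

section \<open>Correctness of the merge passes\<close>

context arec
begin

definition weight_tables ::
  "(nat \<Rightarrow> real) \<Rightarrow> (nat \<Rightarrow> real) \<Rightarrow> (nat \<Rightarrow> real) \<Rightarrow> (nat \<Rightarrow> real) \<Rightarrow> (nat \<Rightarrow> real) \<Rightarrow> bool"
where
  "weight_tables key w1 w2 w3 w4 \<longleftrightarrow> (\<forall>e<N. key e = bp e \<and>
    w1 e = low_weight n x 1 e \<and> w2 e = high_weight n x 1 e \<and>
    w3 e = low_weight n x 0 e \<and> w4 e = high_weight n x 0 e)"

definition tabs :: "state \<Rightarrow> bool" where
  "tabs s \<longleftrightarrow> base s \<and> rvar s ''rk'' = real k \<and> rvar s ''rq'' = real (p - k) \<and>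
    weight_tables (rarr s ''key'') (rarr s ''w1'') (rarr s ''w2'') (rarr s ''w3'') (rarr s ''w4'')"

lemmas tabs_defs = tabs_def base_def arec_input_def

lemma item_tables_full:
  assumes "item_tables n key w1 w2 w3 w4 P" "e < N"
  shows "key e = bp e \<and> w1 e = low_weight n x 1 e \<and> w2 e = high_weight n x 1 e \<and>
    w3 e = low_weight n x 0 e \<and> w4 e = high_weight n x 0 e \<and> P e = e"
  using assms by (cases "e < n") (auto simp: item_tables_def)

lemma prepared_tabs:
  assumes "prepared s"
  shows "tabs s" "\<And>e. e < N \<Longrightarrow> iarr s ''P'' e = e"
  using assms item_tables_full[of "rarr s ''key''"]
  by (auto simp: prepared_def tabs_def weight_tables_def)

lemma tabs_key: "tabs s \<Longrightarrow> e < N \<Longrightarrow> rarr s ''key'' e = bp e"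
  by (simp add: tabs_def weight_tables_def)

lemma merge_triple:
  assumes "0 < w" and img: "Pf ` {..<N} = {..<N}" and P: "blocks_sorted bp w N Pf"
  shows "triple (\<lambda>s. tabs s \<and> ivar s ''e'' = d \<and> iarr s ''P'' = Pf \<and> ivar s ''w'' = w \<and> ivar s ''hi'' = 0)
    (For ''o'' ''N'' merge_code)
    (\<lambda>s. tabs s \<and> ivar s ''e'' = d \<and> iarr s ''Q'' ` {..<N} = {..<N} \<and> blocks_sorted bp (2 * w) N (iarr s ''Q''))
    (for_cost N (cost_bound merge_code))"
proof -
  define I where "I m s \<longleftrightarrow> tabs s \<and> ivar s ''e'' = d \<and> iarr s ''P'' = Pf \<and> ivar s ''w'' = w \<and>
    ivar s ''o'' = m \<and> m \<le> N \<and>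
    (m = 0 \<and> ivar s ''hi'' = 0 \<or>
     (\<exists>lo. ivar s ''mid'' = lo + w \<and> ivar s ''hi'' = lo + 2 * w \<and>
       merge_inv bp N w Pf (iarr s ''Q'') lo m (ivar s ''i'') (ivar s ''j'')))" for m s
  show ?thesis
  proof (rule triple_for[where I = I])
    fix m assume m: "m < N"
    show "triple (I m) merge_code (\<lambda>s. I (Suc m) (s\<lparr>ivar := (ivar s)(''o'' := Suc (ivar s ''o''))\<rparr>))
        (cost_bound merge_code)"
    proof (rule triple_wp)
      fix s assume s: "I m s"
      \<comment> \<open>The pointers after the possible reset, which lets both situations share the
        rest of the argument.\<close>
      define lo i j mid hi where "lo = (if m < ivar s ''hi'' then ivar s ''mid'' - w else m)"
        and "i = (if m < ivar s ''hi'' then ivar s ''i'' else m)"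
        and "j = (if m < ivar s ''hi'' then ivar s ''j'' else m + w)"
        and "mid = (if m < ivar s ''hi'' then ivar s ''mid'' else m + w)"
        and "hi = (if m < ivar s ''hi'' then ivar s ''hi'' else m + w + w)"
      have *: "mid = lo + w \<and> hi = lo + 2 * w \<and> m < hi \<and> merge_inv bp N w Pf (iarr s ''Q'') lo m i j"
      proof (cases "m < ivar s ''hi''")
        case True
        then show ?thesis using s by (auto simp: I_def lo_def i_def j_def mid_def hi_def)
      next
        case False
        have "2 * w dvd m \<and> iarr s ''Q'' ` {..<m} = Pf ` {..<m} \<and> blocks_sorted bp (2 * w) m (iarr s ''Q'')"
        proof (cases "m = 0")
          case True
          then show ?thesis by (simp add: blocks_sorted_def)
        next
          case m0: False
          then obtain lo where lo: "ivar s ''hi'' = lo + 2 * w"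
            "merge_inv bp N w Pf (iarr s ''Q'') lo m (ivar s ''i'') (ivar s ''j'')"
            using s by (auto simp: I_def)
          have "m = lo + 2 * w" using lo False by (auto simp: merge_inv_def)
          then show ?thesis using merge_inv_full[OF lo(2)] by blast
        qed
        then show ?thesis using False \<open>0 < w\<close> merge_inv_start[of w m]
          by (auto simp: lo_def i_def j_def mid_def hi_def)
      qed
      have keyP: "rarr s ''key'' (Pf q) = bp (Pf q)" if "q < N" for q
        using tabs_key[of s "Pf q"] s img that by (auto simp: I_def)
      have iN: "i < N" if "i < mid"
        using * that m by (auto simp: merge_inv_def)
      define left where "left \<longleftrightarrow> i < mid \<and> \<not> ((j < hi \<and> j < N) \<and> bp (Pf j) < bp (Pf i))"
      have code: "left \<longleftrightarrow>
          i < mid \<and> \<not> ((j < hi \<and> j < N) \<and> rarr s ''key'' (Pf j) < rarr s ''key'' (Pf i))"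
        unfolding left_def using keyP iN by auto
      have L: "merge_inv bp N w Pf ((iarr s ''Q'')(m := Pf i)) lo (Suc m) (Suc i) j" if left
        using * that m unfolding left_def by (intro merge_inv_left[OF _ P]) auto
      have R: "merge_inv bp N w Pf ((iarr s ''Q'')(m := Pf j)) lo (Suc m) i (Suc j)" if "\<not> left"
        using * that m unfolding left_def by (intro merge_inv_right[OF _ P]) auto
      show "wp merge_code (\<lambda>s. I (Suc m) (s\<lparr>ivar := (ivar s)(''o'' := Suc (ivar s ''o''))\<rparr>)) s"
      proof (cases left)
        case True
        have "\<exists>lo. mid = lo + w \<and> hi = lo + 2 * w \<and>
            merge_inv bp N w Pf ((iarr s ''Q'')(m := Pf i)) lo (Suc m) (Suc i) j" using L True * by blast
        then show ?thesis using True s m unfolding code I_def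
          by (cases "m < ivar s ''hi''") (auto simp: merge_code_def tabs_defs i_def j_def mid_def hi_def)
      next
        case False
        have "\<exists>lo. mid = lo + w \<and> hi = lo + 2 * w \<and>
            merge_inv bp N w Pf ((iarr s ''Q'')(m := Pf j)) lo (Suc m) i (Suc j)" using R False * by blast
        then show ?thesis using False s m unfolding code I_def
          by (cases "m < ivar s ''hi''") (auto simp: merge_code_def tabs_defs i_def j_def mid_def hi_def)
      qed
    qed
  next
    fix s assume "I N s"
    moreover have "0 < N" using inst by (auto simp: arec_instance_def)
    ultimately obtain lo where "merge_inv bp N w Pf (iarr s ''Q'') lo N (ivar s ''i'') (ivar s ''j'')"
      by (auto simp: I_def)
    from merge_inv_end[OF this] \<open>I N s\<close> img
    show "tabs s \<and> ivar s ''e'' = d \<and> iarr s ''Q'' ` {..<N} = {..<N} \<and> blocks_sorted bp (2 * w) N (iarr s ''Q'')"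
      by (simp add: I_def)
  qed (auto simp: I_def tabs_defs)
qed

lemma copy_triple:
  "triple (\<lambda>s. tabs s \<and> ivar s ''e'' = d \<and> iarr s ''Q'' = Qf) (For ''o'' ''N'' copy_code)
    (\<lambda>s. tabs s \<and> ivar s ''e'' = d \<and> (\<forall>q<N. iarr s ''P'' q = Qf q)) (for_cost N (cost_bound copy_code))"
proof (rule triple_for[where I = "\<lambda>m s. tabs s \<and> ivar s ''e'' = d \<and> iarr s ''Q'' = Qf \<and>
    ivar s ''o'' = m \<and> m \<le> N \<and> (\<forall>q<m. iarr s ''P'' q = Qf q)"], goal_cases)
  case (3 m)
  show ?case by (rule triple_wp) (use 3 in \<open>auto simp: copy_code_def tabs_defs less_Suc_eq\<close>)
qed (auto simp: tabs_defs)

lemma pass_triple: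
  assumes "d < E"
  shows "triple (\<lambda>s. tabs s \<and> ivar s ''e'' = d \<and> iarr s ''P'' ` {..<N} = {..<N} \<and> blocks_sorted bp (2 ^ d) N (iarr s ''P''))
    pass_code
    (\<lambda>s. tabs s \<and> ivar s ''e'' = d \<and> iarr s ''P'' ` {..<N} = {..<N} \<and> blocks_sorted bp (2 ^ Suc d) N (iarr s ''P''))
    (pass_cost n)"
  unfolding triple_def
proof (intro allI impI, elim conjE)
  fix s assume s: "tabs s" "ivar s ''e'' = d" and P: "iarr s ''P'' ` {..<N} = {..<N}"
    "blocks_sorted bp (2 ^ d) N (iarr s ''P'')"
  let ?M = "\<lambda>s'. tabs s' \<and> ivar s' ''e'' = d \<and> iarr s' ''Q'' ` {..<N} = {..<N} \<and>
    blocks_sorted bp (2 * 2 ^ d) N (iarr s' ''Q'')"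
  let ?F = "\<lambda>s'. tabs s' \<and> ivar s' ''e'' = d \<and> iarr s' ''P'' ` {..<N} = {..<N} \<and>
    blocks_sorted bp (2 ^ Suc d) N (iarr s' ''P'')"
  have 1: "triple (\<lambda>s'. s' = s) merge_start_code
      (\<lambda>s'. tabs s' \<and> ivar s' ''e'' = d \<and> iarr s' ''P'' = iarr s ''P'' \<and> ivar s' ''w'' = 2 ^ d \<and> ivar s' ''hi'' = 0)
      (cost_bound merge_start_code)"
    using s \<open>d < E\<close> by (intro triple_wp) (auto simp: merge_start_code_def tabs_defs powers_table_def)
  have 3: "triple ?M (For ''o'' ''N'' copy_code) ?F (for_cost N (cost_bound copy_code))"
    unfolding triple_def
  proof (intro allI impI)
    fix s' assume M: "?M s'"
    then obtain t u where tu: "exec (For ''o'' ''N'' copy_code) s' t u" "t \<le> for_cost N (cost_bound copy_code)"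
      "tabs u" "ivar u ''e'' = d" "\<forall>q<N. iarr u ''P'' q = iarr s' ''Q'' q"
      using tripleD[OF copy_triple, of s' d "iarr s' ''Q''"] by blast
    have "iarr u ''P'' ` {..<N} = iarr s' ''Q'' ` {..<N}" using tu by (intro image_cong) auto
    moreover have "blocks_sorted bp (2 ^ Suc d) N (iarr u ''P'')"
      using M tu(5) by (simp add: blocks_sorted_def)
    ultimately show "\<exists>t u. exec (For ''o'' ''N'' copy_code) s' t u \<and> t \<le> for_cost N (cost_bound copy_code) \<and> ?F u"
      using tu M by metis
  qed
  have "triple (\<lambda>s'. s' = s) pass_code ?F (pass_cost n)"
    unfolding pass_code_def pass_cost_def
    by (rule triple_seq[OF 1 triple_seq[OF merge_triple[OF _ P] 3]]) simp
  then show "\<exists>t s'. exec pass_code s t s' \<and> t \<le> pass_cost n \<and> ?F s'" by (rule tripleD) simp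
qed

definition sorting :: "(nat \<Rightarrow> nat) \<Rightarrow> bool" where
  "sorting P \<longleftrightarrow> P ` {..<N} = {..<N} \<and> (\<forall>q r. q \<le> r \<and> r < N \<longrightarrow> bp (P q) \<le> bp (P r))"

lemma sort_triple:
  "triple prepared (For ''e'' ''E'' pass_code) (\<lambda>s. tabs s \<and> sorting (iarr s ''P''))
    (for_cost E (pass_cost n))"
proof (rule triple_for[where I = "\<lambda>m s. tabs s \<and> ivar s ''e'' = m \<and> m \<le> E \<and>
    iarr s ''P'' ` {..<N} = {..<N} \<and> blocks_sorted bp (2 ^ m) N (iarr s ''P'')"], goal_cases)
  case (1 s)
  have "iarr s ''P'' ` {..<N} = id ` {..<N}" using prepared_tabs[OF 1] by (intro image_cong) auto
  then show ?case using prepared_tabs[OF 1] by (auto simp: blocks_sorted_def tabs_defs)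
next
  case (3 m)
  show ?case by (rule triple_conseq[OF pass_triple[OF 3]]) (use 3 in \<open>auto simp: tabs_defs\<close>)
next
  case (4 s)
  \<comment> \<open>Once \<open>2 ^ E \<ge> N\<close>, a single block covers the whole
    array.\<close>
  have "r div 2 ^ E = 0" if "r < N" for r
    using that le_two_power_log_up[of N] by simp
  then show ?case using 4 by (auto simp: sorting_def blocks_sorted_def)
qed (auto simp: tabs_defs)

end

section \<open>Tabulating the dual functions\<close>

definition gather_code :: com where
  "gather_code = RStore ''b'' (IVar ''q'') (RArr ''key'' (IArr ''P'' (IVar ''q'')))"

definition sweep_init_code :: com where
  "sweep_init_code =
    RSet ''s1'' (RVar ''rq'') ;; RSet ''c1'' (RMul (RVar ''rq'') (RArr ''b'' (IConst 0))) ;;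
    RSet ''s2'' (RVar ''rq'') ;; RSet ''c2'' (RMul (RVar ''rq'') (RArr ''b'' (IConst 0))) ;;
    RSet ''s3'' (RVar ''rk'') ;; RSet ''c3'' (RMul (RVar ''rk'') (RArr ''b'' (IConst 0))) ;;
    RSet ''s4'' (RVar ''rk'') ;; RSet ''c4'' (RMul (RVar ''rk'') (RArr ''b'' (IConst 0)))"

text \<open>Forward differencing: \<open>c\<close> carries the value at the current breakpoint and
  \<open>sl\<close> the slope to its right, so an entry costs constant time.\<close>

definition sweep_step_code :: "name \<Rightarrow> name \<Rightarrow> name \<Rightarrow> name \<Rightarrow> com" where
  "sweep_step_code f c sl w =
    RStore f (IVar ''q'') (RVar c) ;;
    RSet sl (RSub (RVar sl) (RArr w (IArr ''P'' (IVar ''q'')))) ;;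
    RSet c (RAdd (RVar c) (RMul (RVar sl)
      (RSub (RArr ''b'' (IAdd (IVar ''q'') (IConst 1))) (RArr ''b'' (IVar ''q'')))))"

definition sweep_code :: com where
  "sweep_code =
    sweep_step_code ''f1'' ''c1'' ''s1'' ''w1'' ;; sweep_step_code ''f2'' ''c2'' ''s2'' ''w2'' ;;
    sweep_step_code ''f3'' ''c3'' ''s3'' ''w3'' ;; sweep_step_code ''f4'' ''c4'' ''s4'' ''w4''"

definition compress_init_code :: com where
  "compress_init_code = ISet ''m'' (IConst 0)"

text \<open>Duplicates must go: across two equal grid points the objective does not change, and the
  strict comparison of the binary search would stop there although the values still rise further
  on.\<close>

definition compress_code :: com where
  "compress_code =
    Cond (BAnd (ILess (IConst 0) (IVar ''m''))
        (BNot (RLess (RArr ''B'' (ISub (IVar ''m'') (IConst 1))) (RArr ''b'' (IVar ''q'')))))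
      Skip
      (RStore ''B'' (IVar ''m'') (RArr ''b'' (IVar ''q'')) ;;
       RStore ''F1'' (IVar ''m'') (RArr ''f1'' (IVar ''q'')) ;;
       RStore ''F2'' (IVar ''m'') (RArr ''f2'' (IVar ''q'')) ;;
       RStore ''F3'' (IVar ''m'') (RArr ''f3'' (IVar ''q'')) ;;
       RStore ''F4'' (IVar ''m'') (RArr ''f4'' (IVar ''q'')) ;;
       ISet ''m'' (IAdd (IVar ''m'') (IConst 1)))"

definition tables_code :: com where
  "tables_code =
    For ''q'' ''N'' gather_code ;;
    (sweep_init_code ;; For ''q'' ''N'' sweep_code) ;;
    compress_init_code ;; For ''q'' ''N'' compress_code"

definition tables_cost :: "nat \<Rightarrow> nat" where
  "tables_cost n = for_cost (n + n) (cost_bound gather_code) + 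
    ((cost_bound sweep_init_code + for_cost (n + n) (cost_bound sweep_code)) +
     (cost_bound compress_init_code + for_cost (n + n) (cost_bound compress_code)))"

section \<open>Correctness of the tables\<close>

context arec
begin

abbreviation f1 where "f1 \<equiv> hinge N (real (p - k)) (low_weight n x 1) bp"
abbreviation f2 where "f2 \<equiv> hinge N (real (p - k)) (high_weight n x 1) bp"
abbreviation g1 where "g1 \<equiv> hinge N (real k) (low_weight n x 0) bp"
abbreviation g2 where "g2 \<equiv> hinge N (real k) (high_weight n x 0) bp"

lemma N_pos: "0 < N"
  using inst by (auto simp: arec_instance_def)

text \<open>By counting, a map of \<open>{..<N}\<close> onto itself is injective, so the sum may be
  reordered.\<close>

lemma hinge_sorting:
  assumes "sorting P"
  shows "hinge N a w bp t = a * t - (\<Sum>q<N. w (P q) * max 0 (t - bp (P q)))"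
proof -
  have P: "P ` {..<N} = {..<N}" using assms by (simp add: sorting_def)
  then have "inj_on P {..<N}" by (intro eq_card_imp_inj_on) simp_all
  from sum.reindex[OF this, of "\<lambda>e. w e * max 0 (t - bp e)"] P
  show ?thesis by (simp add: hinge_def)
qed

lemma hinge_first:
  assumes P: "sorting P"
  shows "hinge N a w bp (bp (P 0)) = a * bp (P 0)"
proof -
  have "(\<Sum>q<N. w (P q) * max 0 (bp (P 0) - bp (P q))) = 0"
  proof (intro sum.neutral ballI)
    fix q assume "q \<in> {..<N}"
    then have "bp (P 0) \<le> bp (P q)" using P by (simp add: sorting_def)
    then show "w (P q) * max 0 (bp (P 0) - bp (P q)) = 0" by simp
  qed
  then show ?thesis using hinge_sorting[OF P] by simp
qed

text \<open>Between consecutive sorted breakpoints exactly the hinges up to position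
  \<open>m\<close> are active. Ties do no harm, as the gap is then zero.\<close>

lemma hinge_next:
  assumes P: "sorting P" and m: "Suc m < N"
  shows "hinge N a w bp (bp (P (Suc m))) =
    hinge N a w bp (bp (P m)) + (a - (\<Sum>r<Suc m. w (P r))) * (bp (P (Suc m)) - bp (P m))"
proof -
  let ?h = "\<lambda>t q. w (P q) * max 0 (t - bp (P q))"
  have mono: "q \<le> r \<Longrightarrow> r < N \<Longrightarrow> bp (P q) \<le> bp (P r)" for q r using P by (simp add: sorting_def)
  have "?h (bp (P (Suc m))) q - ?h (bp (P m)) q =
      (if q < Suc m then w (P q) * (bp (P (Suc m)) - bp (P m)) else 0)" if "q < N" for q
    using mono[of q m] mono[of m "Suc m"] mono[of "Suc m" q] m that
    by (cases "q < Suc m") (auto simp: max_def algebra_simps)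
  then have "(\<Sum>q<N. ?h (bp (P (Suc m))) q) - (\<Sum>q<N. ?h (bp (P m)) q) =
      (\<Sum>q<N. if q < Suc m then w (P q) * (bp (P (Suc m)) - bp (P m)) else 0)"
    unfolding sum_subtractf[symmetric] by (intro sum.cong) auto
  also have "\<dots> = (\<Sum>q\<in>{q\<in>{..<N}. q < Suc m}. w (P q) * (bp (P (Suc m)) - bp (P m)))"
    by (rule sum.inter_filter[symmetric]) simp
  also have "{q\<in>{..<N}. q < Suc m} = {..<Suc m}" using m by auto
  finally show ?thesis
    unfolding hinge_sorting[OF P] sum_distrib_right[symmetric] by (simp add: algebra_simps)
qed

text \<open>The guard \<open>m < N\<close> is there because the last step reads \<open>b\<close> one
  position past the table; the resulting value of \<open>c\<close> is never stored.\<close>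

definition sweep_inv ::
  "(nat \<Rightarrow> nat) \<Rightarrow> nat \<Rightarrow> real \<Rightarrow> (nat \<Rightarrow> real) \<Rightarrow> (nat \<Rightarrow> real) \<Rightarrow> real \<Rightarrow> real \<Rightarrow> bool"
where
  "sweep_inv P m a w f c sl \<longleftrightarrow> sl = a - (\<Sum>r<m. w (P r)) \<and>
    (m < N \<longrightarrow> c = hinge N a w bp (bp (P m))) \<and> (\<forall>q<m. f q = hinge N a w bp (bp (P q)))"

lemma sweep_inv_0: "sorting P \<Longrightarrow> sweep_inv P 0 a w f (a * bp (P 0)) a"
  by (simp add: sweep_inv_def hinge_first)

lemma sweep_inv_Suc:
  assumes "sorting P" "m < N" "sweep_inv P m a w f c sl" "\<forall>q<N. b q = bp (P q)" "v = w (P m)"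
  shows "sweep_inv P (Suc m) a w (f(m := c)) (c + (sl - v) * (b (Suc m) - b m)) (sl - v)"
  using assms hinge_next[of P m a w] by (auto simp: sweep_inv_def less_Suc_eq algebra_simps)

definition gathered :: "(nat \<Rightarrow> nat) \<Rightarrow> (nat \<Rightarrow> real) \<Rightarrow> bool" where
  "gathered P b \<longleftrightarrow> (\<forall>q<N. b q = bp (P q))"

definition sweep_done ::
  "(nat \<Rightarrow> nat) \<Rightarrow> nat \<Rightarrow> (nat \<Rightarrow> real) \<Rightarrow> (nat \<Rightarrow> real) \<Rightarrow> (nat \<Rightarrow> real) \<Rightarrow> (nat \<Rightarrow> real) \<Rightarrow> bool"
where
  "sweep_done P m F1 F2 F3 F4 \<longleftrightarrow> (\<forall>q<m. F1 q = f1 (bp (P q)) \<and> F2 q = f2 (bp (P q)) \<and>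
    F3 q = g1 (bp (P q)) \<and> F4 q = g2 (bp (P q)))"

definition grid ::
  "real set \<Rightarrow> nat \<Rightarrow> (nat \<Rightarrow> real) \<Rightarrow> (nat \<Rightarrow> real) \<Rightarrow> (nat \<Rightarrow> real) \<Rightarrow> (nat \<Rightarrow> real) \<Rightarrow> (nat \<Rightarrow> real) \<Rightarrow> bool"
where
  "grid S M B F1 F2 F3 F4 \<longleftrightarrow> (\<forall>i j. i < j \<and> j < M \<longrightarrow> B i < B j) \<and> B ` {..<M} = S \<and>
    (\<forall>i<M. F1 i = f1 (B i) \<and> F2 i = f2 (B i) \<and> F3 i = g1 (B i) \<and> F4 i = g2 (B i))"

lemma grid_snoc:
  assumes "grid S M B F1 F2 F3 F4" "0 < M \<Longrightarrow> B (M - 1) < t"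
  shows "grid (insert t S) (Suc M) (B(M := t)) (F1(M := f1 t)) (F2(M := f2 t)) (F3(M := g1 t)) (F4(M := g2 t))"
proof -
  have "(B(M := t)) ` {..<Suc M} = insert t (B ` {..<M})" by (auto simp: lessThan_Suc)
  moreover have "B i < t" if "i < M" for i
  proof (cases "i = M - 1")
    case False
    then have "B i < B (M - 1)" using assms(1) that by (auto simp: grid_def)
    then show ?thesis using assms(2) that by auto
  qed (use assms(2) that in auto)
  ultimately show ?thesis using assms(1) by (auto simp: grid_def less_Suc_eq)
qed

text \<open>The last grid value is an earlier entry of the sorted list, hence at most the new one;
  not being smaller, it equals it.\<close>

lemma grid_skip:
  assumes g: "grid (bp ` P ` {..<q}) M B F1 F2 F3 F4" and "0 < M" "\<not> B (M - 1) < bp (P q)"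
    and P: "sorting P" and "q < N"
  shows "grid (bp ` P ` {..<Suc q}) M B F1 F2 F3 F4"
proof -
  have "B (M - 1) \<in> B ` {..<M}" using \<open>0 < M\<close> by simp
  then have "B (M - 1) \<in> bp ` P ` {..<q}" using g by (simp add: grid_def)
  then obtain r where "r < q" "B (M - 1) = bp (P r)" by auto
  moreover from \<open>r < q\<close> have "bp (P r) \<le> bp (P q)" using P \<open>q < N\<close> by (simp add: sorting_def)
  ultimately have "bp (P q) \<in> bp ` P ` {..<q}" using assms(3) by (metis image_eqI lessThan_iff linorder_not_less order_antisym)
  then have "bp ` P ` {..<Suc q} = bp ` P ` {..<q}" by (simp add: lessThan_Suc insert_absorb)
  then show ?thesis using g by simp
qed

definition grid_state :: "state \<Rightarrow> bool" where
  "grid_state s \<longleftrightarrow> base s \<and> ivar s ''m'' \<le> N \<and> grid (bp ` {..<N}) (ivar s ''m'') (rarr s ''B'')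
    (rarr s ''F1'') (rarr s ''F2'') (rarr s ''F3'') (rarr s ''F4'')"

lemma gather_triple:
  assumes "sorting P"
  shows "triple (\<lambda>s. tabs s \<and> iarr s ''P'' = P) (For ''q'' ''N'' gather_code)
    (\<lambda>s. tabs s \<and> iarr s ''P'' = P \<and> gathered P (rarr s ''b'')) (for_cost N (cost_bound gather_code))"
proof (rule triple_for[where I = "\<lambda>m s. tabs s \<and> iarr s ''P'' = P \<and> ivar s ''q'' = m \<and> m \<le> N \<and>
    (\<forall>q<m. rarr s ''b'' q = bp (P q))"], goal_cases)
  case (3 m)
  have "P m < N" using assms 3 by (auto simp: sorting_def)
  then show ?case using 3 tabs_key
    by (intro triple_wp) (auto simp: gather_code_def tabs_defs less_Suc_eq weight_tables_def)
qed (auto simp: tabs_defs gathered_def)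

lemma sweep_triple:
  assumes P: "sorting P"
  shows "triple (\<lambda>s. tabs s \<and> iarr s ''P'' = P \<and> gathered P (rarr s ''b''))
    (sweep_init_code ;; For ''q'' ''N'' sweep_code)
    (\<lambda>s. base s \<and> gathered P (rarr s ''b'') \<and>
      sweep_done P N (rarr s ''f1'') (rarr s ''f2'') (rarr s ''f3'') (rarr s ''f4''))
    (cost_bound sweep_init_code + for_cost N (cost_bound sweep_code))"
proof -
  let ?pre = "\<lambda>s. tabs s \<and> iarr s ''P'' = P \<and> gathered P (rarr s ''b'')"
  let ?I = "\<lambda>m s. ?pre s \<and> m \<le> N \<and>
    sweep_inv P m (real (p - k)) (low_weight n x 1) (rarr s ''f1'') (rvar s ''c1'') (rvar s ''s1'') \<and>
    sweep_inv P m (real (p - k)) (high_weight n x 1) (rarr s ''f2'') (rvar s ''c2'') (rvar s ''s2'') \<and>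
    sweep_inv P m (real k) (low_weight n x 0) (rarr s ''f3'') (rvar s ''c3'') (rvar s ''s3'') \<and>
    sweep_inv P m (real k) (high_weight n x 0) (rarr s ''f4'') (rvar s ''c4'') (rvar s ''s4'')"
  let ?J = "\<lambda>m s. ivar s ''q'' = m \<and> ?I m s"
  have init: "triple ?pre sweep_init_code (?I 0) (cost_bound sweep_init_code)"
  proof (rule triple_wp)
    fix s assume *: "?pre s"
    then have "rarr s ''b'' 0 = bp (P 0)" using N_pos by (simp add: gathered_def)
    then show "wp sweep_init_code (?I 0) s"
      using * sweep_inv_0[OF P] by (simp add: sweep_init_code_def tabs_defs)
  qed
  have loop: "triple (?I 0) (For ''q'' ''N'' sweep_code)
    (\<lambda>s. base s \<and> gathered P (rarr s ''b'') \<and>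
      sweep_done P N (rarr s ''f1'') (rarr s ''f2'') (rarr s ''f3'') (rarr s ''f4''))
    (for_cost N (cost_bound sweep_code))"
  proof (rule triple_for[where I = ?J], goal_cases)
    case (3 m)
    show ?case
    proof (rule triple_wp)
      fix s assume *: "?J m s"
      have "P m < N" using P 3 by (auto simp: sorting_def)
      then have w: "rarr s ''w1'' (P m) = low_weight n x 1 (P m)" "rarr s ''w2'' (P m) = high_weight n x 1 (P m)"
        "rarr s ''w3'' (P m) = low_weight n x 0 (P m)" "rarr s ''w4'' (P m) = high_weight n x 0 (P m)"
        using * by (auto simp: tabs_def weight_tables_def)
      have b: "\<forall>q<N. rarr s ''b'' q = bp (P q)" using * by (simp add: gathered_def)
      show "wp sweep_code (\<lambda>s. ?J (Suc m) (s\<lparr>ivar := (ivar s)(''q'' := Suc (ivar s ''q''))\<rparr>)) s"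
        using * 3 w sweep_inv_Suc[OF P 3 _ b]
        by (simp add: sweep_code_def sweep_step_code_def tabs_defs)
    qed
  qed (auto simp: tabs_defs sweep_done_def sweep_inv_def)
  show ?thesis using triple_seq[OF init loop] .
qed

lemma compress_triple:
  assumes P: "sorting P"
  shows "triple (\<lambda>s. base s \<and> gathered P (rarr s ''b'') \<and>
      sweep_done P N (rarr s ''f1'') (rarr s ''f2'') (rarr s ''f3'') (rarr s ''f4''))
    (compress_init_code ;; For ''q'' ''N'' compress_code) grid_state
    (cost_bound compress_init_code + for_cost N (cost_bound compress_code))"
proof -
  let ?pre = "\<lambda>s. base s \<and> gathered P (rarr s ''b'') \<and>
      sweep_done P N (rarr s ''f1'') (rarr s ''f2'') (rarr s ''f3'') (rarr s ''f4'')"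
  let ?G = "\<lambda>m s. grid (bp ` P ` {..<m}) (ivar s ''m'') (rarr s ''B'')
    (rarr s ''F1'') (rarr s ''F2'') (rarr s ''F3'') (rarr s ''F4'')"
  let ?I = "\<lambda>m s. ?pre s \<and> m \<le> N \<and> ivar s ''m'' \<le> m \<and> ?G m s"
  let ?J = "\<lambda>m s. ivar s ''q'' = m \<and> ?I m s"
  have init: "triple ?pre compress_init_code (?I 0) (cost_bound compress_init_code)"
    by (rule triple_wp) (simp add: compress_init_code_def grid_def base_def arec_input_def)
  have loop: "triple (?I 0) (For ''q'' ''N'' compress_code) grid_state (for_cost N (cost_bound compress_code))"
  proof (rule triple_for[where I = ?J], goal_cases)
    case (3 m)
    show ?case
    proof (rule triple_wp)
      fix s assume *: "?J m s"
      have b: "rarr s ''b'' m = bp (P m)" using * 3 by (simp add: gathered_def)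
      have f: "rarr s ''f1'' m = f1 (bp (P m))" "rarr s ''f2'' m = f2 (bp (P m))"
        "rarr s ''f3'' m = g1 (bp (P m))" "rarr s ''f4'' m = g2 (bp (P m))"
        using * 3 by (auto simp: sweep_done_def)
      have G: "?G m s" using * by simp
      show "wp compress_code (\<lambda>s. ?J (Suc m) (s\<lparr>ivar := (ivar s)(''q'' := Suc (ivar s ''q''))\<rparr>)) s"
      proof (cases "0 < ivar s ''m'' \<and> \<not> rarr s ''B'' (ivar s ''m'' - 1) < bp (P m)")
        case True
        have "?G (Suc m) s" by (rule grid_skip[OF G _ _ P]) (use True 3 in auto)
        then show ?thesis using * 3 True b by (simp add: compress_code_def base_def arec_input_def)
      next
        case False
        then show ?thesis using * 3 b f grid_snoc[OF G, of "bp (P m)"]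
          by (auto simp: compress_code_def base_def arec_input_def lessThan_Suc)
      qed
    qed
  next
    case (4 s)
    then show ?case using P by (simp add: grid_state_def sorting_def)
  qed (auto simp: base_def arec_input_def)
  show ?thesis using triple_seq[OF init loop] .
qed

lemma tables_triple:
  "triple (\<lambda>s. tabs s \<and> sorting (iarr s ''P'')) tables_code grid_state (tables_cost n)"
proof -
  have "triple (\<lambda>s. tabs s \<and> iarr s ''P'' = P) tables_code grid_state (tables_cost n)" if "sorting P" for P
    unfolding tables_code_def tables_cost_def
    by (rule triple_seq[OF gather_triple[OF that] triple_seq[OF sweep_triple[OF that] compress_triple[OF that]]])
  then show ?thesis unfolding triple_def by blast
qed

end

section \<open>Searching the grid\<close>

definition value_code :: "name \<Rightarrow> name \<Rightarrow> name \<Rightarrow> com" where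
  "value_code v i j =
    RSet v (RAdd (RAdd (RArr ''F1'' (IVar i)) (RArr ''F3'' (IVar j))) (RVar ''Gamma'')) ;;
    RSet ''tmp'' (RAdd (RArr ''F2'' (IVar i)) (RArr ''F4'' (IVar j))) ;;
    Cond (RLess (RVar ''tmp'') (RVar v)) (RSet v (RVar ''tmp'')) Skip"

text \<open>Values inside a segment are interpolated from its endpoints, so no hinge sum is
  evaluated again.\<close>

definition try_code :: com where
  "try_code =
    RSet ''va'' (RAdd (RVar ''A0'') (RMul (RVar ''th'') (RSub (RVar ''A1'') (RVar ''A0'')))) ;;
    RSet ''vb'' (RAdd (RVar ''B0'') (RMul (RVar ''th'') (RSub (RVar ''B1'') (RVar ''B0'')))) ;;
    Cond (RLess (RVar ''vb'') (RVar ''va'')) (RSet ''va'' (RVar ''vb'')) Skip ;;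
    Cond (RLess (RVar ''best'') (RVar ''va''))
      (RSet ''best'' (RVar ''va'') ;;
       RSet ''bg'' (RAdd (RVar ''g0'') (RMul (RVar ''th'') (RSub (RVar ''g1'') (RVar ''g0'')))) ;;
       RSet ''ba'' (RAdd (RVar ''a0'') (RMul (RVar ''th'') (RSub (RVar ''a1'') (RVar ''a0'')))))
      Skip"

definition load_code :: "name \<Rightarrow> name \<Rightarrow> name \<Rightarrow> name \<Rightarrow> com" where
  "load_code i0 j0 i1 j1 =
    RSet ''A0'' (RAdd (RAdd (RArr ''F1'' (IVar i0)) (RArr ''F3'' (IVar j0))) (RVar ''Gamma'')) ;;
    RSet ''B0'' (RAdd (RArr ''F2'' (IVar i0)) (RArr ''F4'' (IVar j0))) ;;
    RSet ''g0'' (RArr ''B'' (IVar i0)) ;;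
    RSet ''a0'' (RArr ''B'' (IVar j0)) ;;
    RSet ''A1'' (RAdd (RAdd (RArr ''F1'' (IVar i1)) (RArr ''F3'' (IVar j1))) (RVar ''Gamma'')) ;;
    RSet ''B1'' (RAdd (RArr ''F2'' (IVar i1)) (RArr ''F4'' (IVar j1))) ;;
    RSet ''g1'' (RArr ''B'' (IVar i1)) ;;
    RSet ''a1'' (RArr ''B'' (IVar j1)) ;;
    RSet ''th'' (RConst 0)"

text \<open>A crossing outside the open unit interval is replaced by the start of the segment. This
  includes a constant difference, where division by zero yields 0.\<close>

definition crossing_code :: com where
  "crossing_code = RSet ''th'' (RDiv (RSub (RVar ''B0'') (RVar ''A0''))
    (RSub (RSub (RVar ''B0'') (RVar ''A0'')) (RSub (RVar ''B1'') (RVar ''A1'')))) ;;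
    Cond (BNot (BAnd (RLess (RConst 0) (RVar ''th'')) (RLess (RVar ''th'') (RConst 1))))
      (RSet ''th'' (RConst 0)) Skip"

definition segment_code :: "name \<Rightarrow> name \<Rightarrow> name \<Rightarrow> name \<Rightarrow> com" where
  "segment_code i0 j0 i1 j1 =
    load_code i0 j0 i1 j1 ;; try_code ;; RSet ''th'' (RConst 1) ;; try_code ;; crossing_code ;; try_code"

text \<open>Costs do not depend on names, so empty names stand for any arguments.\<close>

definition segment_cost :: nat where
  "segment_cost = cost_bound (segment_code [] [] [] [])"

definition coord :: "bool \<Rightarrow> name \<Rightarrow> name" where
  "coord u v = (if u then v else ''fix'')"

text \<open>The flags tell whether \<open>g\<close> (\<open>u\<close>) and \<open>a\<close>
  (\<open>v\<close>) run along the line; both do on the diagonal. The bounds encode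
  \<open>a \<le> g\<close>: a fixed \<open>g\<close> limits the range from above, a fixed
  \<open>a\<close> from below.\<close>

definition line_init_code :: "bool \<Rightarrow> bool \<Rightarrow> com" where
  "line_init_code u v =
    ISet ''pos'' (if v then IConst 0 else IVar ''fix'') ;;
    ISet ''lo'' (IVar ''pos'') ;;
    ISet ''hi'' (if u then ISub (IVar ''m'') (IConst 1) else IVar ''fix'')"

definition search_code :: "bool \<Rightarrow> bool \<Rightarrow> com" where
  "search_code u v =
    ISet ''r1'' (IAdd (IVar ''pos'') (IArr ''pw'' (ISub (ISub (IVar ''E'') (IConst 1)) (IVar ''e'')))) ;;
    ISet ''r0'' (ISub (IVar ''r1'') (IConst 1)) ;;
    Cond (ILess (IVar ''hi'') (IVar ''r1'')) Skip
      (value_code ''v0'' (coord u ''r0'') (coord v ''r0'') ;;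
       value_code ''v1'' (coord u ''r1'') (coord v ''r1'') ;;
       Cond (RLess (RVar ''v0'') (RVar ''v1'')) (ISet ''pos'' (IVar ''r1'')) Skip)"

definition neighbours_code :: com where
  "neighbours_code =
    Cond (ILess (IVar ''lo'') (IVar ''pos'')) (ISet ''r0'' (ISub (IVar ''pos'') (IConst 1)))
      (ISet ''r0'' (IVar ''pos'')) ;;
    Cond (ILess (IVar ''pos'') (IVar ''hi'')) (ISet ''r1'' (IAdd (IVar ''pos'') (IConst 1)))
      (ISet ''r1'' (IVar ''pos''))"

definition line_code :: "bool \<Rightarrow> bool \<Rightarrow> com" where
  "line_code u v =
    (line_init_code u v ;; For ''e'' ''E'' (search_code u v)) ;; neighbours_code ;;
    segment_code (coord u ''r0'') (coord v ''r0'') (coord u ''pos'') (coord v ''pos'') ;;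
    segment_code (coord u ''pos'') (coord v ''pos'') (coord u ''r1'') (coord v ''r1'')"

text \<open>Freezes the grid computed in memory as mathematical constants, so that lines and
  segments can be described without a state.\<close>

locale arec_grid = arec +
  fixes M :: nat and B :: "nat \<Rightarrow> real"
  assumes B_less: "\<And>i j. i < j \<Longrightarrow> j < M \<Longrightarrow> B i < B j"
    and B_image: "B ` {..<M} = bp ` {..<N}"
    and M_le: "M \<le> N"
begin

lemma M_pos: "0 < M"
  using B_image N_pos by (cases "M = 0") auto

lemma B_le: "i \<le> j \<Longrightarrow> j < M \<Longrightarrow> B i \<le> B j"
  using B_less[of i j] by (cases "i = j") auto

definition valA where "valA g a = f1 g + g1 a + \<Gamma>"
definition valB where "valB g a = f2 g + g2 a"
definition val where "val g a = min (valA g a) (valB g a)"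

definition grid_values ::
  "(nat \<Rightarrow> real) \<Rightarrow> (nat \<Rightarrow> real) \<Rightarrow> (nat \<Rightarrow> real) \<Rightarrow> (nat \<Rightarrow> real) \<Rightarrow> bool"
where
  "grid_values F1 F2 F3 F4 \<longleftrightarrow> (\<forall>i<M. F1 i = f1 (B i) \<and> F2 i = f2 (B i) \<and> F3 i = g1 (B i) \<and> F4 i = g2 (B i))"

definition search_state :: "state \<Rightarrow> bool" where
  "search_state s \<longleftrightarrow> base s \<and> ivar s ''m'' = M \<and> rarr s ''B'' = B \<and>
    grid_values (rarr s ''F1'') (rarr s ''F2'') (rarr s ''F3'') (rarr s ''F4'')"

lemmas search_defs = search_state_def base_def arec_input_def

text \<open>\<open>C\<close> is a ghost set of points already accounted for; it may contain whole
  segments and lines although only finitely many points are evaluated.\<close>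

definition dominates :: "(real \<times> real) set \<Rightarrow> real \<Rightarrow> real \<Rightarrow> real \<Rightarrow> bool" where
  "dominates C v g a \<longleftrightarrow> v = val g a \<and> a \<le> g \<and> (\<forall>q\<in>C. val (fst q) (snd q) \<le> v)"

definition best_of :: "(real \<times> real) set \<Rightarrow> state \<Rightarrow> bool" where
  "best_of C s \<longleftrightarrow> dominates C (rvar s ''best'') (rvar s ''bg'') (rvar s ''ba'')"

definition segment :: "real \<Rightarrow> real \<Rightarrow> real \<Rightarrow> real \<Rightarrow> bool" where
  "segment g0 a0 g' a' \<longleftrightarrow> (\<forall>\<theta>. 0 \<le> \<theta> \<and> \<theta> \<le> 1 \<longrightarrow>
    a0 + \<theta> * (a' - a0) \<le> g0 + \<theta> * (g' - g0) \<and>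
    valA (g0 + \<theta> * (g' - g0)) (a0 + \<theta> * (a' - a0)) = valA g0 a0 + \<theta> * (valA g' a' - valA g0 a0) \<and>
    valB (g0 + \<theta> * (g' - g0)) (a0 + \<theta> * (a' - a0)) = valB g0 a0 + \<theta> * (valB g' a' - valB g0 a0))"

definition point :: "real \<Rightarrow> real \<Rightarrow> real \<Rightarrow> real \<Rightarrow> real \<Rightarrow> real \<times> real" where
  "point g0 a0 g' a' \<theta> = (g0 + \<theta> * (g' - g0), a0 + \<theta> * (a' - a0))"

definition loaded :: "real \<Rightarrow> real \<Rightarrow> real \<Rightarrow> real \<Rightarrow> state \<Rightarrow> bool" where
  "loaded g0 a0 g' a' s \<longleftrightarrow>
    rvar s ''g0'' = g0 \<and> rvar s ''a0'' = a0 \<and> rvar s ''g1'' = g' \<and> rvar s ''a1'' = a' \<and>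
    rvar s ''A0'' = valA g0 a0 \<and> rvar s ''B0'' = valB g0 a0 \<and>
    rvar s ''A1'' = valA g' a' \<and> rvar s ''B1'' = valB g' a'"

lemma dominates_insert:
  assumes "dominates C v g a" "a' \<le> g'"
  shows "val g' a' \<le> v \<Longrightarrow> dominates (insert (g', a') C) v g a"
    and "v < val g' a' \<Longrightarrow> dominates (insert (g', a') C) (val g' a') g' a'"
  using assms by (auto simp: dominates_def)

lemma try_triple:
  assumes seg: "segment g0 a0 g' a'" and \<theta>: "0 \<le> \<theta>" "\<theta> \<le> 1"
  shows "triple (\<lambda>s. search_state s \<and> ivar s = iv \<and> loaded g0 a0 g' a' s \<and> rvar s ''th'' = \<theta> \<and> best_of C s)
    try_code
    (\<lambda>s. search_state s \<and> ivar s = iv \<and> loaded g0 a0 g' a' s \<and> best_of (insert (point g0 a0 g' a' \<theta>) C) s)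
    (cost_bound try_code)"
proof (rule triple_wp)
  fix s assume s: "search_state s \<and> ivar s = iv \<and> loaded g0 a0 g' a' s \<and> rvar s ''th'' = \<theta> \<and> best_of C s"
  define gp ap where "gp = g0 + \<theta> * (g' - g0)" and "ap = a0 + \<theta> * (a' - a0)"
  have p: "ap \<le> gp" "valA g0 a0 + \<theta> * (valA g' a' - valA g0 a0) = valA gp ap"
    "valB g0 a0 + \<theta> * (valB g' a' - valB g0 a0) = valB gp ap"
    using seg \<theta> unfolding segment_def gp_def ap_def by auto
  have d: "dominates C (rvar s ''best'') (rvar s ''bg'') (rvar s ''ba'')" using s by (simp add: best_of_def)
  have pt: "point g0 a0 g' a' \<theta> = (gp, ap)" by (simp add: point_def gp_def ap_def)
  show "wp try_code (\<lambda>s. search_state s \<and> ivar s = iv \<and> loaded g0 a0 g' a' s \<and>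
      best_of (insert (point g0 a0 g' a' \<theta>) C) s) s"
    unfolding pt using s p gp_def[symmetric] ap_def[symmetric] dominates_insert[OF d p(1)]
    by (cases "valB gp ap < valA gp ap"; cases "rvar s ''best'' < val gp ap")
      (clarsimp simp: try_code_def loaded_def search_defs best_of_def val_def)+
qed

lemma load_triple:
  assumes "iv i0 < M" "iv j0 < M" "iv i1 < M" "iv j1 < M"
  shows "triple (\<lambda>s. search_state s \<and> ivar s = iv \<and> best_of C s) (load_code i0 j0 i1 j1)
    (\<lambda>s. search_state s \<and> ivar s = iv \<and>
      loaded (B (iv i0)) (B (iv j0)) (B (iv i1)) (B (iv j1)) s \<and> rvar s ''th'' = 0 \<and> best_of C s)
    (cost_bound (load_code i0 j0 i1 j1))"
proof (rule triple_wp)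
  fix s assume *: "search_state s \<and> ivar s = iv \<and> best_of C s"
  then have "rarr s ''F1'' i = f1 (B i)" "rarr s ''F2'' i = f2 (B i)" "rarr s ''F3'' i = g1 (B i)"
    "rarr s ''F4'' i = g2 (B i)" if "i < M" for i
    using that by (auto simp: search_state_def grid_values_def)
  with * assms show "wp (load_code i0 j0 i1 j1) (\<lambda>s. search_state s \<and> ivar s = iv \<and>
      loaded (B (iv i0)) (B (iv j0)) (B (iv i1)) (B (iv j1)) s \<and> rvar s ''th'' = 0 \<and> best_of C s) s"
    by (clarsimp simp: load_code_def search_defs loaded_def best_of_def valA_def valB_def)
qed

text \<open>By \<open>min_affine_le\<close>, the two endpoints and the crossing decide the maximum,
  so three trials account for the entire segment.\<close>

lemma segment_triple:
  assumes "iv i0 < M" "iv j0 < M" "iv i1 < M" "iv j1 < M"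
    and seg: "segment (B (iv i0)) (B (iv j0)) (B (iv i1)) (B (iv j1))"
  shows "triple (\<lambda>s. search_state s \<and> ivar s = iv \<and> best_of C s) (segment_code i0 j0 i1 j1)
    (\<lambda>s. search_state s \<and> ivar s = iv \<and>
      best_of (point (B (iv i0)) (B (iv j0)) (B (iv i1)) (B (iv j1)) ` {0..1} \<union> C) s) segment_cost"
proof -
  let ?p = "point (B (iv i0)) (B (iv j0)) (B (iv i1)) (B (iv j1))"
  let ?L = "loaded (B (iv i0)) (B (iv j0)) (B (iv i1)) (B (iv j1))"
  let ?A0 = "valA (B (iv i0)) (B (iv j0))" and ?A1 = "valA (B (iv i1)) (B (iv j1))"
  let ?B0 = "valB (B (iv i0)) (B (iv j0))" and ?B1 = "valB (B (iv i1)) (B (iv j1))"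
  let ?r = "(?B0 - ?A0) / ((?B0 - ?A0) - (?B1 - ?A1))"
  define \<theta> where "\<theta> = (if 0 < ?r \<and> ?r < 1 then ?r else 0)"
  have \<theta>: "0 \<le> \<theta>" "\<theta> \<le> 1" by (auto simp: \<theta>_def)
  have one: "triple (\<lambda>s. search_state s \<and> ivar s = iv \<and> ?L s \<and> best_of C' s) (RSet ''th'' (RConst 1))
      (\<lambda>s. search_state s \<and> ivar s = iv \<and> ?L s \<and> rvar s ''th'' = 1 \<and> best_of C' s)
      (cost_bound (RSet ''th'' (RConst 1)))" for C'
    by (rule triple_wp) (clarsimp simp: search_defs loaded_def best_of_def)
  have cross: "triple (\<lambda>s. search_state s \<and> ivar s = iv \<and> ?L s \<and> best_of C' s) crossing_code
      (\<lambda>s. search_state s \<and> ivar s = iv \<and> ?L s \<and> rvar s ''th'' = \<theta> \<and> best_of C' s)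
      (cost_bound crossing_code)" for C'
    by (rule triple_wp) (clarsimp simp: crossing_code_def search_defs loaded_def best_of_def \<theta>_def)
  have val_p: "val (fst (?p \<tau>)) (snd (?p \<tau>)) = min (?A0 + \<tau> * (?A1 - ?A0)) (?B0 + \<tau> * (?B1 - ?B0))"
    if "0 \<le> \<tau>" "\<tau> \<le> 1" for \<tau>
    using seg that by (simp add: segment_def point_def val_def)
  have all: "best_of (?p ` {0..1} \<union> C) s"
    if "best_of (insert (?p \<theta>) (insert (?p 1) (insert (?p 0) C))) s" for s
  proof -
    let ?K = "rvar s ''best''"
    have K: "val (fst (?p \<tau>)) (snd (?p \<tau>)) \<le> ?K" if "\<tau> \<in> {0, 1, \<theta>}" for \<tau>
      using \<open>best_of (insert _ _) s\<close> that unfolding best_of_def dominates_def by auto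
    have "val (fst (?p \<tau>)) (snd (?p \<tau>)) \<le> ?K" if "\<tau> \<in> {0..1}" for \<tau>
    proof -
      have "min (?A0 + \<tau> * (?A1 - ?A0)) (?B0 + \<tau> * (?B1 - ?B0)) \<le> ?K"
      proof (rule min_affine_le)
        show "min ?A0 ?B0 \<le> ?K" using K[of 0] val_p[of 0] by simp
        show "min ?A1 ?B1 \<le> ?K" using K[of 1] val_p[of 1] by simp
        assume "0 < ?r" "?r < 1"
        then have "\<theta> = ?r" by (simp add: \<theta>_def)
        then show "min (?A0 + ?r * (?A1 - ?A0)) (?B0 + ?r * (?B1 - ?B0)) \<le> ?K"
          using K[of \<theta>] val_p[OF \<theta>] by simp
      qed (use that in auto)
      then show ?thesis using val_p[of \<tau>] that by simp
    qed
    then show ?thesis using that unfolding best_of_def dominates_def by auto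
  qed
  have "triple (\<lambda>s. search_state s \<and> ivar s = iv \<and> best_of C s) (segment_code i0 j0 i1 j1)
    (\<lambda>s. search_state s \<and> ivar s = iv \<and> ?L s \<and>
      best_of (insert (?p \<theta>) (insert (?p 1) (insert (?p 0) C))) s)
    (cost_bound (load_code i0 j0 i1 j1) + (cost_bound try_code + (cost_bound (RSet ''th'' (RConst 1)) +
      (cost_bound try_code + (cost_bound crossing_code + cost_bound try_code)))))"
    unfolding segment_code_def
    by (rule triple_seq[OF load_triple[OF assms(1-4)] triple_seq[OF try_triple[OF seg]
          triple_seq[OF one triple_seq[OF try_triple[OF seg]
              triple_seq[OF cross try_triple[OF seg \<theta>]]]]]]) simp_all
  then show ?thesis
    by (rule triple_conseq) (use all in \<open>auto simp: segment_cost_def segment_code_def load_code_def\<close>)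
qed

end

section \<open>Restricting the objective to a line\<close>

context arec_grid
begin

text \<open>All breakpoints are grid points, so none lies strictly between neighbours. The case
  \<open>q' = q\<close> serves the ends of a line.\<close>

lemma affine_cell:
  assumes "q' = q \<or> q' = Suc q" "q' < M"
  shows "affine_on {B q..B q'} (hinge N a w bp)"
proof (cases "q' = q")
  case True
  then show ?thesis unfolding affine_on_def by (intro exI[of _ "hinge N a w bp (B q)"] exI[of _ 0]) auto
next
  case False
  then have q: "q' = Suc q" using assms by simp
  show ?thesis
  proof (rule affine_on_hinge)
    fix e assume "e < N"
    then have "bp e \<in> B ` {..<M}" unfolding B_image by simp
    then obtain i where i: "i < M" "bp e = B i" by auto
    show "bp e \<le> B q \<or> B q' \<le> bp e"
      using B_le[of i q] B_le[of "Suc q" i] i assms(2) q by (cases "i \<le> q") auto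
  qed
qed

lemma concave_parts: "concave_on UNIV f1" "concave_on UNIV f2" "concave_on UNIV g1" "concave_on UNIV g2"
  by (rule concave_on_hinge; simp add: low_weight_def high_weight_def)+

definition on_line :: "bool \<Rightarrow> nat \<Rightarrow> real \<Rightarrow> real" where
  "on_line u fx t = (if u then t else B fx)"

lemma concave_on_line: "concave_on UNIV f \<Longrightarrow> concave_on UNIV (\<lambda>t. f (on_line u fx t))"
  by (cases u) (simp_all add: on_line_def concave_on_const)

lemma affine_on_line: "affine_on S f \<Longrightarrow> affine_on S (\<lambda>t. f (on_line u fx t))"
  by (cases u) (simp_all add: on_line_def affine_on_const)

definition line_val :: "bool \<Rightarrow> bool \<Rightarrow> nat \<Rightarrow> real \<Rightarrow> real" where
  "line_val u v fx t = val (on_line u fx t) (on_line v fx t)"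

lemma concave_line_val: "concave_on UNIV (line_val u v fx)"
  unfolding line_val_def val_def valA_def valB_def
  by (rule concave_on_min[OF
        concave_on_add[OF concave_on_add[OF concave_on_line concave_on_line]
          concave_on_const[THEN iffD2, OF convex_UNIV]]
        concave_on_add[OF concave_on_line concave_on_line]]; rule concave_parts)

definition low :: "bool \<Rightarrow> nat \<Rightarrow> nat" where
  "low v fx = (if v then 0 else fx)"

definition high :: "bool \<Rightarrow> nat \<Rightarrow> nat" where
  "high u fx = (if u then M - 1 else fx)"

text \<open>The range from \<open>low\<close> to \<open>high\<close> keeps \<open>a \<le> g\<close>,
  and within a cell every part of the objective is affine.\<close>

lemma segment_line:
  assumes "u \<or> v" "fx < M" and q: "q' = q \<or> q' = Suc q" "low v fx \<le> q" "q' \<le> high u fx"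
  shows "segment (on_line u fx (B q)) (on_line v fx (B q)) (on_line u fx (B q')) (on_line v fx (B q'))"
    and "(\<lambda>t. (on_line u fx t, on_line v fx t)) ` {B q..B q'} \<subseteq>
      point (on_line u fx (B q)) (on_line v fx (B q)) (on_line u fx (B q')) (on_line v fx (B q')) ` {0..1}"
proof -
  have q'M: "q' < M" using q M_pos \<open>fx < M\<close> by (auto simp: high_def split: if_splits)
  have le: "B q \<le> B q'" using q q'M by (intro B_le) auto
  have line: "on_line u fx (B q + \<theta> * (B q' - B q)) =
      on_line u fx (B q) + \<theta> * (on_line u fx (B q') - on_line u fx (B q))" for u \<theta>
    by (simp add: on_line_def)
  have A: "affine_on {B q..B q'} (\<lambda>t. valA (on_line u fx t) (on_line v fx t))"
    unfolding valA_def by (intro affine_on_add affine_on_const affine_on_line[OF affine_cell[OF q(1) q'M]])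
  have B: "affine_on {B q..B q'} (\<lambda>t. valB (on_line u fx t) (on_line v fx t))"
    unfolding valB_def by (intro affine_on_add affine_on_line[OF affine_cell[OF q(1) q'M]])
  have dom: "on_line v fx t \<le> on_line u fx t" if "B q \<le> t" "t \<le> B q'" for t
  proof -
    have "B fx \<le> t" if "\<not> v"
      using B_le[of fx q] q q'M \<open>B q \<le> t\<close> that by (auto simp: low_def)
    moreover have "t \<le> B fx" if "\<not> u"
      using B_le[of q' fx] q \<open>fx < M\<close> \<open>t \<le> B q'\<close> that by (auto simp: high_def)
    ultimately show ?thesis using \<open>u \<or> v\<close> by (auto simp: on_line_def)
  qed
  show "segment (on_line u fx (B q)) (on_line v fx (B q)) (on_line u fx (B q')) (on_line v fx (B q'))"
    unfolding segment_def
  proof (intro allI impI, elim conjE)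
    fix \<theta> :: real assume \<theta>: "0 \<le> \<theta>" "\<theta> \<le> 1"
    have "\<theta> * (B q' - B q) \<le> 1 * (B q' - B q)" using \<theta> le by (intro mult_right_mono) auto
    then have "B q \<le> B q + \<theta> * (B q' - B q)" "B q + \<theta> * (B q' - B q) \<le> B q'" using \<theta> le by auto
    from dom[OF this] affine_on_segment[OF A le \<theta>] affine_on_segment[OF B le \<theta>]
    show "on_line v fx (B q) + \<theta> * (on_line v fx (B q') - on_line v fx (B q)) \<le>
        on_line u fx (B q) + \<theta> * (on_line u fx (B q') - on_line u fx (B q)) \<and>
      valA (on_line u fx (B q) + \<theta> * (on_line u fx (B q') - on_line u fx (B q)))
        (on_line v fx (B q) + \<theta> * (on_line v fx (B q') - on_line v fx (B q))) =
      valA (on_line u fx (B q)) (on_line v fx (B q)) +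
        \<theta> * (valA (on_line u fx (B q')) (on_line v fx (B q')) - valA (on_line u fx (B q)) (on_line v fx (B q))) \<and>
      valB (on_line u fx (B q) + \<theta> * (on_line u fx (B q') - on_line u fx (B q)))
        (on_line v fx (B q) + \<theta> * (on_line v fx (B q') - on_line v fx (B q))) =
      valB (on_line u fx (B q)) (on_line v fx (B q)) +
        \<theta> * (valB (on_line u fx (B q')) (on_line v fx (B q')) - valB (on_line u fx (B q)) (on_line v fx (B q)))"
      unfolding line by simp
  qed
  show "(\<lambda>t. (on_line u fx t, on_line v fx t)) ` {B q..B q'} \<subseteq>
      point (on_line u fx (B q)) (on_line v fx (B q)) (on_line u fx (B q')) (on_line v fx (B q')) ` {0..1}"
  proof (rule image_subsetI)
    fix t assume t: "t \<in> {B q..B q'}"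
    \<comment> \<open>A degenerate segment has only one point, which parameter 0 reaches.\<close>
    define \<theta> where "\<theta> = (if B q = B q' then 0 else (t - B q) / (B q' - B q))"
    have "t = B q + \<theta> * (B q' - B q)" using t le by (auto simp: \<theta>_def)
    moreover have "\<theta> \<in> {0..1}" using t le by (auto simp: \<theta>_def divide_simps)
    ultimately show "(on_line u fx t, on_line v fx t) \<in>
        point (on_line u fx (B q)) (on_line v fx (B q)) (on_line u fx (B q')) (on_line v fx (B q')) ` {0..1}"
      by (intro image_eqI[of _ _ \<theta>]) (simp_all add: point_def line)
  qed
qed

text \<open>
  The index arithmetic of the machine has no halving, so the binary search moves right by powers of
  two from a table, as long as the values increase in the last step.
\<close>

definition climb :: "bool \<Rightarrow> bool \<Rightarrow> nat \<Rightarrow> nat \<Rightarrow> nat \<Rightarrow> bool" where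
  "climb u v fx w pos \<longleftrightarrow> low v fx \<le> pos \<and> pos \<le> high u fx \<and>
    (low v fx < pos \<longrightarrow> line_val u v fx (B (pos - 1)) < line_val u v fx (B pos)) \<and>
    (pos + w \<le> high u fx \<longrightarrow> line_val u v fx (B (pos + w)) \<le> line_val u v fx (B (pos + w - 1)))"

text \<open>The right-hand certificate at distance \<open>2 * w\<close> passes to distance
  \<open>w\<close> in each outcome: a probe outside the range makes it void, a probe without
  increase is itself the new certificate, and after a move the old one lies \<open>w\<close>
  ahead.\<close>

lemma climb_halve:
  assumes "climb u v fx (2 * w) pos"
  shows "high u fx < pos + w \<Longrightarrow> climb u v fx w pos"
    and "pos + w \<le> high u fx \<Longrightarrow>
      \<not> line_val u v fx (B (pos + w - 1)) < line_val u v fx (B (pos + w)) \<Longrightarrow> climb u v fx w pos"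
    and "pos + w \<le> high u fx \<Longrightarrow>
      line_val u v fx (B (pos + w - 1)) < line_val u v fx (B (pos + w)) \<Longrightarrow> climb u v fx w (pos + w)"
  using assms by (auto simp: climb_def mult_2 add.assoc)

lemma line_val_coord:
  "iv ''fix'' = fx \<Longrightarrow> val (B (iv (coord u r))) (B (iv (coord v r))) = line_val u v fx (B (iv r))"
  by (simp add: line_val_def on_line_def coord_def)

text \<open>Treats the evaluation as one assignment, so that its branch does not multiply the cases
  of later proofs.\<close>

lemma wp_value:
  assumes "grid_values (rarr s ''F1'') (rarr s ''F2'') (rarr s ''F3'') (rarr s ''F4'')"
    "rvar s ''Gamma'' = \<Gamma>" "ivar s i < M" "ivar s j < M" "r \<noteq> ''tmp''"
  shows "wp (value_code r i j) Q s \<longleftrightarrow>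
    Q (s\<lparr>rvar := (rvar s)(''tmp'' := valB (B (ivar s i)) (B (ivar s j)),
      r := val (B (ivar s i)) (B (ivar s j)))\<rparr>)"
  using assms
  by (auto simp: value_code_def grid_values_def val_def valA_def valB_def min_def fun_upd_twist)

end

section \<open>Searching all lines\<close>

definition line_cost :: "bool \<Rightarrow> bool \<Rightarrow> nat \<Rightarrow> nat" where
  "line_cost u v e = (cost_bound (line_init_code u v) + for_cost e (cost_bound (search_code u v))) +
    (cost_bound neighbours_code + (segment_cost + segment_cost))"

definition main_init_code :: com where
  "main_init_code =
    ISet ''fix'' (IConst 0) ;;
    RSet ''bg'' (RArr ''B'' (IConst 0)) ;; RSet ''ba'' (RArr ''B'' (IConst 0)) ;;
    value_code ''best'' ''fix'' ''fix''"

text \<open>The diagonal does not depend on \<open>fix\<close>; searching it in every iteration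
  keeps the loop uniform and changes only the constant.\<close>

definition main_code :: com where
  "main_code = main_init_code ;;
    For ''fix'' ''m'' (line_code False True ;; line_code True False ;; line_code True True)"

definition main_cost :: "nat \<Rightarrow> nat" where
  "main_cost n = cost_bound main_init_code + for_cost (n + n)
    (line_cost False True (log_up (n + n)) +
      (line_cost True False (log_up (n + n)) + line_cost True True (log_up (n + n))))"

text \<open>Turns run-time contents into a fixed parameter; here it freezes the index variables
  before the segments are processed.\<close>

lemma triple_pre:
  assumes "\<And>z. G z \<Longrightarrow> triple (\<lambda>s. P s \<and> f s = z) c Q T"
  shows "triple (\<lambda>s. P s \<and> G (f s)) c Q T"
  using assms unfolding triple_def by blast

context arec_grid
begin

definition line_points :: "bool \<Rightarrow> bool \<Rightarrow> nat \<Rightarrow> (real \<times> real) set" where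
  "line_points u v fx = (\<lambda>t. (on_line u fx t, on_line v fx t)) ` {B (low v fx)..B (high u fx)}"

lemma low_le_high: "u \<or> v \<Longrightarrow> fx < M \<Longrightarrow> low v fx \<le> high u fx"
  by (auto simp: low_def high_def)

lemma high_less: "fx < M \<Longrightarrow> high u fx < M"
  by (auto simp: high_def)

lemma search_triple:
  assumes uv: "u \<or> v" and fx: "fx < M"
  shows "triple (\<lambda>s. search_state s \<and> ivar s ''fix'' = fx \<and> best_of C s)
    (line_init_code u v ;; For ''e'' ''E'' (search_code u v))
    (\<lambda>s. search_state s \<and> ivar s ''fix'' = fx \<and> best_of C s \<and> ivar s ''lo'' = low v fx \<and>
      ivar s ''hi'' = high u fx \<and> climb u v fx 1 (ivar s ''pos''))
    (cost_bound (line_init_code u v) + for_cost E (cost_bound (search_code u v)))"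
proof -
  let ?P = "\<lambda>s. search_state s \<and> ivar s ''fix'' = fx \<and> best_of C s \<and> ivar s ''lo'' = low v fx \<and>
      ivar s ''hi'' = high u fx"
  let ?I = "\<lambda>m s. ?P s \<and> ivar s ''e'' = m \<and> m \<le> E \<and> climb u v fx (2 ^ (E - m)) (ivar s ''pos'')"
  \<comment> \<open>A jump of \<open>2 ^ E \<ge> N \<ge> M\<close> leaves the grid, so nothing needs
    to be compared at the start.\<close>
  have "climb u v fx (2 ^ E) (low v fx)"
    using low_le_high[OF uv fx] high_less[OF fx, of u] M_le le_two_power_log_up[of N]
    by (auto simp: climb_def)
  then have init: "triple (\<lambda>s. search_state s \<and> ivar s ''fix'' = fx \<and> best_of C s) (line_init_code u v)
      (\<lambda>s. ?P s \<and> climb u v fx (2 ^ E) (ivar s ''pos'')) (cost_bound (line_init_code u v))"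
    by (intro triple_wp)
      (auto simp: line_init_code_def search_defs best_of_def low_def high_def)
  have loop: "triple (\<lambda>s. ?P s \<and> climb u v fx (2 ^ E) (ivar s ''pos'')) (For ''e'' ''E'' (search_code u v))
      (\<lambda>s. search_state s \<and> ivar s ''fix'' = fx \<and> best_of C s \<and> ivar s ''lo'' = low v fx \<and>
        ivar s ''hi'' = high u fx \<and> climb u v fx 1 (ivar s ''pos'')) (for_cost E (cost_bound (search_code u v)))"
  proof (rule triple_for[where I = ?I], goal_cases)
    case (3 m)
    show ?case
    proof (rule triple_wp)
      fix s assume s: "?I m s"
      define w :: nat where "w = 2 ^ (E - Suc m)"
      have "E - m = Suc (E - Suc m)" using 3 by simp
      then have w: "2 ^ (E - m) = 2 * w" by (simp add: w_def)
      have pw: "iarr s ''pw'' (E - Suc m) = w" "ivar s ''E'' = E"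
        using s by (auto simp: search_defs powers_table_def w_def)
      have "0 < w" by (simp add: w_def)
      define pos where "pos = ivar s ''pos''"
      have cl: "climb u v fx (2 * w) pos" using s w by (simp add: pos_def)
      have hi: "high u fx < M" using high_less[OF fx] .
      have gv: "grid_values (rarr s ''F1'') (rarr s ''F2'') (rarr s ''F3'') (rarr s ''F4'')" "rvar s ''Gamma'' = \<Gamma>"
        using s by (auto simp: search_defs)
      show "wp (search_code u v) (\<lambda>s. ?I (Suc m) (s\<lparr>ivar := (ivar s)(''e'' := Suc (ivar s ''e''))\<rparr>)) s"
      proof (cases "high u fx < pos + w")
        case True
        then show ?thesis using s pw 3 climb_halve(1)[OF cl True]
          by (auto simp: search_code_def search_defs best_of_def pos_def w_def)
      next
        case False
        define iv where "iv = (ivar s)(''r1'' := pos + w, ''r0'' := pos + w - 1)"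
        have iv: "iv (coord u ''r0'') < M" "iv (coord v ''r0'') < M" "iv (coord u ''r1'') < M" "iv (coord v ''r1'') < M"
          using False hi s fx by (auto simp: iv_def coord_def)
        have v0: "val (B (iv (coord u ''r0''))) (B (iv (coord v ''r0''))) = line_val u v fx (B (pos + w - 1))"
          using line_val_coord[of iv fx u "''r0''" v] s by (simp add: iv_def)
        have v1: "val (B (iv (coord u ''r1''))) (B (iv (coord v ''r1''))) = line_val u v fx (B (pos + w))"
          using line_val_coord[of iv fx u "''r1''" v] s by (simp add: iv_def)
        have st: "wp (search_code u v) Q s \<longleftrightarrow>
            wp (value_code ''v0'' (coord u ''r0'') (coord v ''r0'') ;;
              value_code ''v1'' (coord u ''r1'') (coord v ''r1'') ;;
              Cond (RLess (RVar ''v0'') (RVar ''v1'')) (ISet ''pos'' (IVar ''r1'')) Skip) Q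
            (s\<lparr>ivar := iv\<rparr>)" for Q
          using s pw False by (simp add: search_code_def iv_def pos_def w_def)
        have ivs: "iv ''r1'' = pos + w" "iv ''n'' = ivar s ''n''" "iv ''p'' = ivar s ''p''" "iv ''k'' = ivar s ''k''"
          "iv ''N'' = ivar s ''N''" "iv ''E'' = ivar s ''E''" "iv ''m'' = ivar s ''m''" "iv ''lo'' = ivar s ''lo''"
          "iv ''hi'' = ivar s ''hi''" "iv ''fix'' = ivar s ''fix''" "iv ''e'' = ivar s ''e''" "iv ''pos'' = pos"
          by (simp_all add: iv_def pos_def)
        have le: "pos + w \<le> high u fx" using False by simp
        show ?thesis
        proof (cases "line_val u v fx (B (pos + w - 1)) < line_val u v fx (B (pos + w))")
          case True
          with climb_halve(3)[OF cl le] show ?thesis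
            unfolding st w_def[symmetric] using gv iv s 3 v0 v1
            by (simp add: wp_value search_defs best_of_def ivs)
        next
          case False
          with climb_halve(2)[OF cl le] show ?thesis
            unfolding st w_def[symmetric] using gv iv s 3 v0 v1
            by (simp add: wp_value search_defs best_of_def ivs)
        qed
      qed
    qed
  qed (auto simp: search_defs best_of_def)
  show ?thesis using triple_seq[OF init loop] .
qed

text \<open>With step width 1, \<open>climb\<close> says that neither neighbour beats
  \<open>pos\<close>; \<open>concave_grid_max\<close> then extends the bound from the two segments
  to the whole line.\<close>

lemma segments_triple:
  assumes uv: "u \<or> v" and fx: "fx < M" and cl: "climb u v fx 1 pos"
    and iv: "iv ''fix'' = fx" "iv ''pos'' = pos" "iv ''r0'' = (if low v fx < pos then pos - 1 else pos)"
      "iv ''r1'' = (if pos < high u fx then pos + 1 else pos)"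
  shows "triple (\<lambda>s. (search_state s \<and> best_of C s) \<and> ivar s = iv)
    (segment_code (coord u ''r0'') (coord v ''r0'') (coord u ''pos'') (coord v ''pos'') ;;
      segment_code (coord u ''pos'') (coord v ''pos'') (coord u ''r1'') (coord v ''r1''))
    (\<lambda>s. search_state s \<and> ivar s ''fix'' = fx \<and> best_of (line_points u v fx \<union> C) s)
    (segment_cost + segment_cost)"
proof -
  let ?s = "\<lambda>q q'. point (on_line u fx (B q)) (on_line v fx (B q)) (on_line u fx (B q')) (on_line v fx (B q'))"
  have hi: "high u fx < M" using high_less[OF fx] .
  have pos: "low v fx \<le> pos" "pos \<le> high u fx" using cl by (auto simp: climb_def)
  have coord: "B (iv (coord w r)) = on_line w fx (B (iv r))" for w r
    using iv by (simp add: coord_def on_line_def)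
  have less: "iv (coord w r) < M" if "iv r < M" for w r using that iv fx by (simp add: coord_def)
  have q0: "iv ''pos'' = iv ''r0'' \<or> iv ''pos'' = Suc (iv ''r0'')" "low v fx \<le> iv ''r0''" "iv ''pos'' \<le> high u fx"
    using iv pos by auto
  have q1: "iv ''r1'' = iv ''pos'' \<or> iv ''r1'' = Suc (iv ''pos'')" "low v fx \<le> iv ''pos''" "iv ''r1'' \<le> high u fx"
    using iv pos by auto
  have lt: "iv ''pos'' < M" "iv ''r0'' < M" "iv ''r1'' < M" using q0 q1 hi by auto
  let ?S = "?s (iv ''pos'') (iv ''r1'') ` {0..1} \<union> (?s (iv ''r0'') (iv ''pos'') ` {0..1} \<union> C)"
  have main: "triple (\<lambda>s. search_state s \<and> ivar s = iv \<and> best_of C s)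
    (segment_code (coord u ''r0'') (coord v ''r0'') (coord u ''pos'') (coord v ''pos'') ;;
      segment_code (coord u ''pos'') (coord v ''pos'') (coord u ''r1'') (coord v ''r1''))
    (\<lambda>s. search_state s \<and> ivar s = iv \<and> best_of ?S s)
    (segment_cost + segment_cost)"
    using triple_seq[OF segment_triple[of iv "coord u ''r0''" "coord v ''r0''" "coord u ''pos''" "coord v ''pos''" C]
        segment_triple[of iv "coord u ''pos''" "coord v ''pos''" "coord u ''r1''" "coord v ''r1''"]]
      segment_line(1)[OF uv fx q0] segment_line(1)[OF uv fx q1] lt
    unfolding coord by (simp add: less)
  have all: "best_of (line_points u v fx \<union> C) s" if best: "best_of ?S s" for s
  proof -
    let ?K = "rvar s ''best''"
    have K: "val (fst q) (snd q) \<le> ?K" if "q \<in> ?S" for q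
      using best that unfolding best_of_def dominates_def by blast
    have "line_val u v fx t \<le> ?K" if "t \<in> {B (low v fx)..B (high u fx)}" for t
    proof (rule concave_grid_max[OF concave_line_val _ pos])
      show "B i < B j" if "i < j" "j \<le> high u fx" for i j using B_less that hi by auto
      show "line_val u v fx t \<le> ?K" if t: "t \<in> {B (if low v fx < pos then pos - 1 else pos)..B pos}" for t
      proof -
        have "t \<in> {B (iv ''r0'')..B (iv ''pos'')}" using t iv by simp
        then have "(on_line u fx t, on_line v fx t) \<in> ?S" using segment_line(2)[OF uv fx q0] by blast
        from K[OF this] show ?thesis by (simp add: line_val_def)
      qed
      show "line_val u v fx t \<le> ?K" if t: "t \<in> {B pos..B (if pos < high u fx then pos + 1 else pos)}" for t
      proof -
        have "t \<in> {B (iv ''pos'')..B (iv ''r1'')}" using t iv by simp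
        then have "(on_line u fx t, on_line v fx t) \<in> ?S" using segment_line(2)[OF uv fx q1] by blast
        from K[OF this] show ?thesis by (simp add: line_val_def)
      qed
    qed (use cl that in \<open>auto simp: climb_def\<close>)
    then have "val (fst q) (snd q) \<le> ?K" if "q \<in> line_points u v fx" for q
      using that by (auto simp: line_points_def line_val_def)
    then show ?thesis using best unfolding best_of_def dominates_def by blast
  qed
  show ?thesis by (rule triple_conseq[OF main]) (use iv all in auto)
qed

lemma line_triple:
  assumes uv: "u \<or> v" and fx: "fx < M"
  shows "triple (\<lambda>s. search_state s \<and> ivar s ''fix'' = fx \<and> best_of C s) (line_code u v)
    (\<lambda>s. search_state s \<and> ivar s ''fix'' = fx \<and> best_of (line_points u v fx \<union> C) s) (line_cost u v E)"
proof -
  define G where "G iv \<longleftrightarrow> (\<exists>pos. climb u v fx 1 pos \<and> iv ''fix'' = fx \<and> iv ''pos'' = pos \<and>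
    iv ''r0'' = (if low v fx < pos then pos - 1 else pos) \<and>
    iv ''r1'' = (if pos < high u fx then pos + 1 else pos))" for iv
  have 1: "triple (\<lambda>s. search_state s \<and> ivar s ''fix'' = fx \<and> best_of C s \<and> ivar s ''lo'' = low v fx \<and>
      ivar s ''hi'' = high u fx \<and> climb u v fx 1 (ivar s ''pos'')) neighbours_code
      (\<lambda>s. (search_state s \<and> best_of C s) \<and> G (ivar s)) (cost_bound neighbours_code)"
    by (rule triple_wp) (auto simp: neighbours_code_def search_defs best_of_def G_def)
  have 2: "triple (\<lambda>s. (search_state s \<and> best_of C s) \<and> G (ivar s))
    (segment_code (coord u ''r0'') (coord v ''r0'') (coord u ''pos'') (coord v ''pos'') ;;
      segment_code (coord u ''pos'') (coord v ''pos'') (coord u ''r1'') (coord v ''r1''))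
    (\<lambda>s. search_state s \<and> ivar s ''fix'' = fx \<and> best_of (line_points u v fx \<union> C) s)
    (segment_cost + segment_cost)"
  proof (rule triple_pre[where f = ivar and G = G])
    fix iv assume "G iv"
    then obtain pos where pos: "climb u v fx 1 pos" "iv ''fix'' = fx" "iv ''pos'' = pos"
      "iv ''r0'' = (if low v fx < pos then pos - 1 else pos)"
      "iv ''r1'' = (if pos < high u fx then pos + 1 else pos)"
      unfolding G_def by blast
    show "triple (\<lambda>s. (search_state s \<and> best_of C s) \<and> ivar s = iv)
      (segment_code (coord u ''r0'') (coord v ''r0'') (coord u ''pos'') (coord v ''pos'') ;;
        segment_code (coord u ''pos'') (coord v ''pos'') (coord u ''r1'') (coord v ''r1''))
      (\<lambda>s. search_state s \<and> ivar s ''fix'' = fx \<and> best_of (line_points u v fx \<union> C) s)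
      (segment_cost + segment_cost)"
      by (rule segments_triple[OF uv fx pos])
  qed
  show ?thesis
    unfolding line_code_def line_cost_def
    by (rule triple_seq[OF search_triple[OF uv fx] triple_seq[OF 1 2]])
qed

lemma main_triple:
  "triple search_state main_code (\<lambda>s. search_state s \<and>
      best_of (\<Union>fx<M. line_points False True fx \<union> line_points True False fx \<union> line_points True True fx) s)
    (main_cost n)"
proof -
  let ?L = "\<lambda>fx. line_points False True fx \<union> line_points True False fx \<union> line_points True True fx"
  let ?I = "\<lambda>m s. search_state s \<and> ivar s ''fix'' = m \<and> m \<le> M \<and> best_of (\<Union>fx<m. ?L fx) s"
  let ?body = "line_code False True ;; line_code True False ;; line_code True True"
  let ?cost = "line_cost False True E + (line_cost True False E + line_cost True True E)"
  have 1: "triple search_state main_init_code (\<lambda>s. search_state s \<and> best_of {} s) (cost_bound main_init_code)"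
  proof (rule triple_wp)
    fix s assume s: "search_state s"
    then have gv: "grid_values (rarr s ''F1'') (rarr s ''F2'') (rarr s ''F3'') (rarr s ''F4'')" "rvar s ''Gamma'' = \<Gamma>"
      by (auto simp: search_defs)
    show "wp main_init_code (\<lambda>s. search_state s \<and> best_of {} s) s"
      using s gv M_pos by (simp add: main_init_code_def wp_value search_defs best_of_def dominates_def)
  qed
  have 2: "triple (\<lambda>s. search_state s \<and> best_of {} s) (For ''fix'' ''m'' ?body)
      (\<lambda>s. search_state s \<and> best_of (\<Union>fx<M. ?L fx) s) (for_cost M ?cost)"
  proof (rule triple_for[where I = ?I], goal_cases)
    case (3 m)
    have "triple (?I m) ?body (\<lambda>s. search_state s \<and> ivar s ''fix'' = m \<and>
        best_of (line_points True True m \<union> (line_points True False m \<union>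
          (line_points False True m \<union> (\<Union>fx<m. ?L fx)))) s) ?cost"
      by (rule triple_conseq[OF triple_seq[OF line_triple triple_seq[OF line_triple line_triple]]])
        (use 3 in auto)
    then show ?case
    proof (rule triple_conseq)
      fix s assume s: "search_state s \<and> ivar s ''fix'' = m \<and>
        best_of (line_points True True m \<union> (line_points True False m \<union>
          (line_points False True m \<union> (\<Union>fx<m. ?L fx)))) s"
      have "(\<Union>fx<Suc m. ?L fx) = line_points True True m \<union> (line_points True False m \<union>
          (line_points False True m \<union> (\<Union>fx<m. ?L fx)))"
        by (auto simp: lessThan_Suc)
      then show "?I (Suc m) (s\<lparr>ivar := (ivar s)(''fix'' := Suc (ivar s ''fix''))\<rparr>)"
        using s 3 by (simp add: search_defs best_of_def)
    qed auto
  qed (auto simp: search_defs best_of_def)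
  show ?thesis
    unfolding main_code_def
    by (rule triple_conseq[OF triple_seq[OF 1 2]])
      (auto simp: main_cost_def intro!: for_cost_mono M_le)
qed

text \<open>\<open>move_to_line\<close> carries any feasible point in the cost range to one of the
  searched lines without loss, and its three alternatives are the three kinds of lines.\<close>

lemma lines_cover:
  assumes best: "best_of (\<Union>fx<M. line_points False True fx \<union> line_points True False fx \<union> line_points True True fx) s"
    and ga: "B 0 \<le> a" "a \<le> g" "g \<le> B (M - 1)"
  shows "val g a \<le> rvar s ''best''"
proof -
  have M: "{..M - 1} = {..<M}" using M_pos by auto
  have aff: "affine_on {B i..B (Suc i)} f1 \<and> affine_on {B i..B (Suc i)} f2 \<and>
      affine_on {B i..B (Suc i)} g1 \<and> affine_on {B i..B (Suc i)} g2" if "i < M - 1" for i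
    using that by (simp add: affine_cell)
  have mono: "B i \<le> B j" if "i \<le> j" "j \<le> M - 1" for i j using B_le[of i j] that M_pos by auto
  obtain g' a' where ga': "B 0 \<le> a'" "a' \<le> g'" "g' \<le> B (M - 1)"
    "g' \<in> B ` {..<M} \<or> a' \<in> B ` {..<M} \<or> g' = a'" "val g a \<le> val g' a'"
  proof (rule move_to_line[OF aff mono ga, of \<Gamma>])
    fix g' a'
    assume "B 0 \<le> a'" "a' \<le> g'" "g' \<le> B (M - 1)" "g' \<in> B ` {..M - 1} \<or> a' \<in> B ` {..M - 1} \<or> g' = a'"
      "min (f1 g + g1 a + \<Gamma>) (f2 g + g2 a) \<le> min (f1 g' + g1 a' + \<Gamma>) (f2 g' + g2 a')"
    then show thesis unfolding M by (intro that[of a' g']) (simp_all only: val_def valA_def valB_def)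
  qed
  from ga'(4) have "\<exists>fx<M. (g', a') \<in> line_points False True fx \<union> line_points True False fx \<union> line_points True True fx"
  proof (elim disjE imageE)
    fix i assume "g' = B i" "i \<in> {..<M}"
    then have "(g', a') \<in> line_points False True i"
      using ga' unfolding line_points_def by (intro image_eqI[of _ _ a']) (auto simp: on_line_def low_def high_def)
    then show ?thesis using \<open>i \<in> {..<M}\<close> by blast
  next
    fix i assume "a' = B i" "i \<in> {..<M}"
    then have "(g', a') \<in> line_points True False i"
      using ga' unfolding line_points_def by (intro image_eqI[of _ _ g']) (auto simp: on_line_def low_def high_def)
    then show ?thesis using \<open>i \<in> {..<M}\<close> by blast
  next
    assume "g' = a'"
    then have "(g', a') \<in> line_points True True 0"
      using ga' unfolding line_points_def by (intro image_eqI[of _ _ g']) (auto simp: on_line_def low_def high_def)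
    then show ?thesis using M_pos by blast
  qed
  then have "(g', a') \<in> (\<Union>fx<M. line_points False True fx \<union> line_points True False fx \<union> line_points True True fx)"
    by blast
  from bspec[OF _ this, of "\<lambda>q. val (fst q) (snd q) \<le> rvar s ''best''"]
  have "val g' a' \<le> rvar s ''best''" using best unfolding best_of_def dominates_def fst_conv snd_conv by blast
  then show ?thesis using ga'(5) by simp
qed

end

section \<open>Distributing the budget\<close>

definition final_init_code :: com where
  "final_init_code = RSet ''rem'' (RVar ''Gamma'') ;; RSet ''opt'' (RVar ''best'')"

definition final_code :: com where
  "final_code =
    Cond (ILess (IConst 0) (IArr ''x'' (IAdd (IVar ''i'') (IConst 1))))
      (RSet ''t'' (RVar ''bg'')) (RSet ''t'' (RVar ''ba'')) ;;
    RSet ''t'' (RSub (RVar ''t'') (RArr ''cl'' (IAdd (IVar ''i'') (IConst 1)))) ;;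
    Cond (RLess (RVar ''t'') (RConst 0)) (RSet ''t'' (RConst 0)) Skip ;;
    RSet ''d'' (RSub (RArr ''cu'' (IAdd (IVar ''i'') (IConst 1))) (RArr ''cl'' (IAdd (IVar ''i'') (IConst 1)))) ;;
    Cond (RLess (RVar ''d'') (RVar ''t'')) (RSet ''t'' (RVar ''d'')) Skip ;;
    Cond (RLess (RVar ''rem'') (RVar ''t'')) (RSet ''t'' (RVar ''rem'')) Skip ;;
    RStore ''c'' (IAdd (IVar ''i'') (IConst 1)) (RAdd (RArr ''cl'' (IAdd (IVar ''i'') (IConst 1))) (RVar ''t'')) ;;
    RSet ''rem'' (RSub (RVar ''rem'') (RVar ''t''))"

context arec
begin

definition cap :: "real \<Rightarrow> real \<Rightarrow> nat \<Rightarrow> real" where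
  "cap g a i = min (cu i - cl i) (max 0 ((if x i = 1 then g else a) - cl i))"

text \<open>The last clause maintains the alternative required by \<open>arec_solutionI\<close>: the
  budget is used up or all caps are met.\<close>

definition greedy :: "real \<Rightarrow> real \<Rightarrow> nat \<Rightarrow> (nat \<Rightarrow> real) \<Rightarrow> real \<Rightarrow> bool" where
  "greedy g a m c r \<longleftrightarrow> 0 \<le> r \<and> (\<forall>i\<in>{1..m}. 0 \<le> c i - cl i \<and> c i - cl i \<le> cap g a i) \<and>
    (\<Sum>i\<in>{1..m}. c i - cl i) + r = \<Gamma> \<and> (r = 0 \<or> (\<forall>i\<in>{1..m}. c i - cl i = cap g a i))"

lemma greedy_Suc:
  assumes "greedy g a m c r" "m < n" "t = min (cap g a (Suc m)) r"
  shows "greedy g a (Suc m) (c(Suc m := cl (Suc m) + t)) (r - t)"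
proof -
  have "0 \<le> cap g a (Suc m)" using inst \<open>m < n\<close> by (auto simp: cap_def arec_instance_def)
  moreover have "(\<Sum>i\<in>{1..m}. (c(Suc m := cl (Suc m) + t)) i - cl i) = (\<Sum>i\<in>{1..m}. c i - cl i)"
    by (intro sum.cong) auto
  moreover have "{1..Suc m} = insert (Suc m) {1..m}" by auto
  ultimately show ?thesis
    using assms unfolding greedy_def by (cases "cap g a (Suc m) \<le> r") (auto simp: min_def)
qed

lemma final_triple:
  "triple (\<lambda>s. base s \<and> rvar s ''bg'' = g \<and> rvar s ''ba'' = a \<and> rvar s ''best'' = v)
    (final_init_code ;; For ''i'' ''n'' final_code)
    (\<lambda>s. rvar s ''opt'' = v \<and> (\<exists>r. greedy g a n (rarr s ''c'') r))
    (cost_bound final_init_code + for_cost n (cost_bound final_code))"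
proof -
  let ?P = "\<lambda>m s. base s \<and> rvar s ''bg'' = g \<and> rvar s ''ba'' = a \<and> rvar s ''opt'' = v \<and> m \<le> n \<and>
    greedy g a m (rarr s ''c'') (rvar s ''rem'')"
  have "0 \<le> \<Gamma>" using inst by (simp add: arec_instance_def)
  then have 1: "triple (\<lambda>s. base s \<and> rvar s ''bg'' = g \<and> rvar s ''ba'' = a \<and> rvar s ''best'' = v)
      final_init_code (?P 0) (cost_bound final_init_code)"
    by (intro triple_wp) (simp add: final_init_code_def base_def arec_input_def greedy_def)
  have 2: "triple (?P 0) (For ''i'' ''n'' final_code)
      (\<lambda>s. rvar s ''opt'' = v \<and> (\<exists>r. greedy g a n (rarr s ''c'') r)) (for_cost n (cost_bound final_code))"
  proof (rule triple_for[where I = "\<lambda>m s. ivar s ''i'' = m \<and> ?P m s"], goal_cases)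
    case (3 m)
    show ?case
    proof (rule triple_wp)
      fix s assume s: "ivar s ''i'' = m \<and> ?P m s"
      define t where "t = min (cap g a (Suc m)) (rvar s ''rem'')"
      have x: "iarr s ''x'' (Suc m) = x (Suc m)" "x (Suc m) = 0 \<or> x (Suc m) = 1"
        "rarr s ''cl'' (Suc m) = cl (Suc m)" "rarr s ''cu'' (Suc m) = cu (Suc m)"
        using s 3 inst selections_values[of x n p "Suc m"]
        by (auto simp: base_def arec_input_def arec_instance_def)
      have G: "greedy g a (Suc m) ((rarr s ''c'')(Suc m := cl (Suc m) + t)) (rvar s ''rem'' - t)"
        using greedy_Suc[OF _ 3, of g a] s t_def by simp
      \<comment> \<open>\<open>y\<close>, \<open>y1\<close> and \<open>y2\<close> are the successive
        contents of the program variable \<open>t\<close> before it is limited by the remaining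
        budget.\<close>
      define y where "y = (if x (Suc m) = 1 then g else a) - cl (Suc m)"
      define y1 where "y1 = (if y < 0 then 0 else y)"
      define d where "d = cu (Suc m) - cl (Suc m)"
      define y2 where "y2 = (if d < y1 then d else y1)"
      have t: "t = (if rvar s ''rem'' < y2 then rvar s ''rem'' else y2)"
        by (auto simp: t_def cap_def y2_def y1_def y_def d_def min_def max_def)
      have d: "cu (Suc m) - cl (Suc m) = d" by (simp add: d_def)
      show "wp final_code (\<lambda>s. ivar (s\<lparr>ivar := (ivar s)(''i'' := Suc (ivar s ''i''))\<rparr>) ''i'' = Suc m \<and>
          ?P (Suc m) (s\<lparr>ivar := (ivar s)(''i'' := Suc (ivar s ''i''))\<rparr>)) s"
      proof (cases "x (Suc m) = 1")
        case True
        then have "g - cl (Suc m) = y" by (simp add: y_def)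
        with True show ?thesis using s 3 x(1,3,4) G d
          by (cases "y < 0"; cases "d < y1"; cases "rvar s ''rem'' < y2")
            (simp_all add: final_code_def base_def arec_input_def t y1_def y2_def)
      next
        case False
        then have "a - cl (Suc m) = y" "x (Suc m) = 0" using x(2) by (simp_all add: y_def)
        then show ?thesis using s 3 x(1,3,4) G d
          by (cases "y < 0"; cases "d < y1"; cases "rvar s ''rem'' < y2")
            (simp_all add: final_code_def base_def arec_input_def t y1_def y2_def)
      qed
    qed
  qed (auto simp: base_def arec_input_def)
  show ?thesis using triple_seq[OF 1 2] .
qed

end

context arec_grid
begin

text \<open>\<open>B 0\<close> and \<open>B (M - 1)\<close> are the extreme item costs, so
  maximality over the grid range is the maximality that \<open>arec_solutionI\<close> asks
  for.\<close>

lemma greedy_solution: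
  assumes g: "greedy g a n c r" and "a \<le> g"
    and opt: "\<And>g' a'. B 0 \<le> a' \<Longrightarrow> a' \<le> g' \<Longrightarrow> g' \<le> B (M - 1) \<Longrightarrow> val g' a' \<le> val g a"
  shows "arec_solution n p k x cl cu \<Gamma> (restrict c {1..n}) (val g a)"
proof -
  have x: "x \<in> selections n p" using inst by (simp add: arec_instance_def)
  have val: "robust_value n p k x cl cu \<Gamma> = val"
    by (intro ext) (simp add: robust_value_def val_def valA_def valB_def
        dual_value_low[OF x, of k cl _ _ cu] dual_value_high[OF x, of k cu _ _ cl])
  have bounds: "B 0 \<le> bp e \<and> bp e \<le> B (M - 1)" if "e < N" for e
  proof -
    have "bp e \<in> B ` {..<M}" unfolding B_image using that by simp
    then obtain i where "i < M" "bp e = B i" by auto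
    then show ?thesis using B_le[of 0 i] B_le[of i "M - 1"] M_pos by simp
  qed
  have "arec_solution n p k x cl cu \<Gamma> (\<lambda>i\<in>{1..n}. cl i + (c i - cl i)) (robust_value n p k x cl cu \<Gamma> g a)"
  proof (rule arec_solutionI[OF inst _ \<open>a \<le> g\<close>])
    fix i assume i: "i \<in> {1..n}"
    then obtain e where "i = Suc e" by (cases i) auto
    then show "B 0 \<le> cl i \<and> cu i \<le> B (M - 1)"
      using i bounds[of e] bounds[of "n + e"] by (simp add: breakpoint_def)
  next
    show "robust_value n p k x cl cu \<Gamma> g' a' \<le> robust_value n p k x cl cu \<Gamma> g a"
      if "B 0 \<le> a'" "a' \<le> g'" "g' \<le> B (M - 1)" for g' a'
      unfolding val using opt that .
  qed (use g in \<open>auto simp: greedy_def cap_def\<close>)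
  then show ?thesis by (simp add: val restrict_def)
qed

end

section \<open>Assembling the program\<close>

definition arec_code :: com where
  "arec_code = prepare_code ;; For ''e'' ''E'' pass_code ;; tables_code ;; main_code ;;
    final_init_code ;; For ''i'' ''n'' final_code"

definition prepare_cost :: "nat \<Rightarrow> nat" where
  "prepare_cost n = (cost_bound powers_code + (n + n + 1) *
      (1 + bcost (ILess (IArr ''pw'' (IVar ''E'')) (IVar ''N'')) + cost_bound doubling_code)) +
    (cost_bound counters_code + for_cost n (cost_bound items_code))"

definition arec_cost :: "nat \<Rightarrow> nat" where
  "arec_cost n = prepare_cost n + (for_cost (log_up (n + n)) (pass_cost n) + (tables_cost n + (main_cost n +
    (cost_bound final_init_code + for_cost n (cost_bound final_code)))))"

context arec
begin

lemma finish_triple: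
  "triple grid_state (main_code ;; final_init_code ;; For ''i'' ''n'' final_code)
    (arec_output n p k x cl cu \<Gamma>)
    (main_cost n + (cost_bound final_init_code + for_cost n (cost_bound final_code)))"
  unfolding triple_def
proof (intro allI impI)
  fix s assume s: "grid_state s"
  define M where "M = ivar s ''m''"
  define B where "B = rarr s ''B''"
  interpret arec_grid n p k x cl cu \<Gamma> M B
    using s by unfold_locales (auto simp: grid_state_def grid_def M_def B_def)
  have "search_state s"
    using s unfolding search_state_def grid_values_def grid_state_def grid_def M_def[symmetric] B_def[symmetric]
    by simp
  then obtain t1 s1 where 1: "exec main_code s t1 s1" "t1 \<le> main_cost n" "search_state s1"
    "best_of (\<Union>fx<M. line_points False True fx \<union> line_points True False fx \<union> line_points True True fx) s1"
    using tripleD[OF main_triple] by blast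
  define g a where "g = rvar s1 ''bg''" and "a = rvar s1 ''ba''"
  have best: "rvar s1 ''best'' = val g a" "a \<le> g"
    using 1(4) by (auto simp: best_of_def dominates_def g_def a_def)
  have "base s1" using 1 by (simp add: search_state_def)
  then obtain t2 s2 r where 2: "exec (final_init_code ;; For ''i'' ''n'' final_code) s1 t2 s2"
    "t2 \<le> cost_bound final_init_code + for_cost n (cost_bound final_code)"
    "rvar s2 ''opt'' = val g a" "greedy g a n (rarr s2 ''c'') r"
    using tripleD[OF final_triple[of g a "val g a"], of s1] best by (auto simp: g_def a_def)
  have "arec_output n p k x cl cu \<Gamma> s2"
    unfolding arec_output_def 2(3)
    by (rule greedy_solution[OF 2(4) best(2)]) (use lines_cover[OF 1(4)] best(1) in auto)
  moreover have "exec (main_code ;; final_init_code ;; For ''i'' ''n'' final_code) s (t1 + t2) s2"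
    using 1(1) 2(1) by (rule exec.Seq)
  moreover have "t1 + t2 \<le> main_cost n + (cost_bound final_init_code + for_cost n (cost_bound final_code))"
    using 1(2) 2(2) by simp
  ultimately show "\<exists>t s'. exec (main_code ;; final_init_code ;; For ''i'' ''n'' final_code) s t s' \<and>
      t \<le> main_cost n + (cost_bound final_init_code + for_cost n (cost_bound final_code)) \<and>
      arec_output n p k x cl cu \<Gamma> s'"
    by blast
qed

lemma arec_triple: "triple input arec_code (arec_output n p k x cl cu \<Gamma>) (arec_cost n)"
  unfolding arec_code_def arec_cost_def prepare_code_def prepare_cost_def
  by (rule triple_seq[OF triple_seq[OF powers_triple items_triple]
        triple_seq[OF sort_triple triple_seq[OF tables_triple finish_triple]]])

end

section \<open>The running time\<close>

lemma bigo_const: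
  fixes F :: "nat \<Rightarrow> real"
  assumes "(\<lambda>_. 1) \<in> O(F)"
  shows "(\<lambda>_. c) \<in> O(F)"
  using landau_o.big_trans[OF _ assms, of "\<lambda>_. c"] by simp

text \<open>Both bounds must dominate constants, since even an empty loop and a trivial body have a
  cost.\<close>

lemma for_cost_bigo:
  fixes F G :: "nat \<Rightarrow> real"
  assumes b: "(\<lambda>n. real (b n)) \<in> O(F)" and t: "(\<lambda>n. real (t n)) \<in> O(G)"
    and one: "(\<lambda>_. 1) \<in> O(F)" "(\<lambda>_. 1) \<in> O(G)"
  shows "(\<lambda>n. real (for_cost (b n) (t n))) \<in> O(\<lambda>n. F n * G n)"
proof -
  have "(\<lambda>_. 1) \<in> O(\<lambda>n. F n * G n)" using landau_o.big.mult[OF one] by simp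
  then have two: "(\<lambda>_. 2) \<in> O(\<lambda>n. F n * G n)" by (rule bigo_const)
  have b1: "(\<lambda>n. real (b n) + 1) \<in> O(F)" using b one(1) by (rule sum_in_bigo(1))
  have t8: "(\<lambda>n. real (t n) + 8) \<in> O(G)" using t bigo_const[OF one(2), of 8] by (rule sum_in_bigo(1))
  have "(\<lambda>n. 2 + (real (b n) + 1) * (real (t n) + 8)) \<in> O(\<lambda>n. F n * G n)"
    by (rule sum_in_bigo(1)[OF two landau_o.big.mult[OF b1 t8]])
  then show ?thesis by (simp add: for_cost_def algebra_simps)
qed

text \<open>Minimality gives \<open>2 ^ e < 2 * n\<close> for the predecessor \<open>e\<close>, so
  the logarithm is below \<open>2 + ln n / ln 2\<close>. For \<open>n \<ge> 3\<close> also
  \<open>ln n \<ge> 1\<close>, and the 2 is absorbed into the factor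
  \<open>2 + 1 / ln 2\<close>.\<close>

lemma log_up_bigo: "(\<lambda>n. real (log_up (n + n))) \<in> O(\<lambda>n. ln (real n))"
proof (rule bigoI[where c = "2 + 1 / ln 2"])
  have "real (log_up (n + n)) \<le> (2 + 1 / ln 2) * ln (real n)" if n: "3 \<le> n" for n
  proof -
    obtain e where e: "log_up (n + n) = Suc e"
      using le_two_power_log_up[of "n + n"] n by (cases "log_up (n + n)") auto
    then have "\<not> n + n \<le> 2 ^ e" using not_less_Least[of e "\<lambda>e. n + n \<le> 2 ^ e"] by (simp add: log_up_def)
    then have "real (2 ^ e) < real (2 * n)" by linarith
    then have "(2::real) ^ e < 2 * real n" by simp
    then have "ln ((2::real) ^ e) < ln (2 * real n)" using n by (subst ln_less_cancel_iff) auto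
    then have "real e * ln 2 < ln 2 + ln (real n)" using n by (simp add: ln_realpow ln_mult)
    then have "real e < 1 + ln (real n) / ln 2" by (simp add: field_simps)
    moreover have "1 \<le> ln (real n)"
      using n exp_le by (subst ln_ge_iff) auto
    ultimately show ?thesis using e by (simp add: algebra_simps)
  qed
  then show "eventually (\<lambda>n. norm (real (log_up (n + n))) \<le> (2 + 1 / ln 2) * norm (ln (real n))) at_top"
    by (intro eventually_sequentiallyI[of 3]) simp
qed

text \<open>Two parts dominate: logarithmically many linear merge passes, and linearly many lines of
  logarithmic cost.\<close>

lemma arec_cost_bigo: "(\<lambda>n. real (arec_cost n)) \<in> O(\<lambda>n. real n * ln (real n))"
proof -
  have ev: "eventually (\<lambda>n. 1 \<le> ln (real n)) at_top"
  proof (rule eventually_sequentiallyI[of 3])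
    fix n :: nat assume "3 \<le> n"
    then show "1 \<le> ln (real n)" using exp_le by (subst ln_ge_iff) auto
  qed
  have one_ln: "(\<lambda>_. 1) \<in> O(\<lambda>n. ln (real n))"
    by (rule bigoI[where c = 1]) (use ev in \<open>eventually_elim; simp\<close>)
  have one_n: "(\<lambda>_. 1) \<in> O(\<lambda>n. real n)"
    by (rule bigoI[where c = 1]) (auto intro: eventually_sequentiallyI[of 1])
  have one_one: "(\<lambda>_. 1) \<in> O(\<lambda>_::nat. 1 :: real)" by simp
  have nn: "(\<lambda>n. real (n + n)) \<in> O(\<lambda>n. real n)" by (simp add: sum_in_bigo)
  have lin: "f \<in> O(\<lambda>n. real n * ln (real n))" if "f \<in> O(\<lambda>n. real n)" for f :: "nat \<Rightarrow> real"
    using landau_o.big.mult[OF that one_ln] by simp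
  have loop: "(\<lambda>n. real (for_cost (b n) C)) \<in> O(\<lambda>n. real n)"
    if "(\<lambda>n. real (b n)) \<in> O(\<lambda>n. real n)" for b C
    using for_cost_bigo[OF that _ one_n one_one, of "\<lambda>_. C"] by simp
  have c: "(\<lambda>_. C) \<in> O(\<lambda>n. real n)" for C using one_n by (rule bigo_const)
  have c_ln: "(\<lambda>_. C) \<in> O(\<lambda>n. ln (real n))" for C using one_ln by (rule bigo_const)
  have prep: "(\<lambda>n. real (prepare_cost n)) \<in> O(\<lambda>n. real n)"
  proof -
    have steps: "(\<lambda>n. real ((n + n + 1) * C)) \<in> O(\<lambda>n. real n)" for C
    proof -
      have "(\<lambda>n. real (n + n) + 1) \<in> O(\<lambda>n. real n)" using nn c by (rule sum_in_bigo(1))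
      moreover have "(\<lambda>_::nat. real C) \<in> O(\<lambda>_. 1 :: real)" by simp
      ultimately have "(\<lambda>n. (real (n + n) + 1) * real C) \<in> O(\<lambda>n. real n * 1)" by (rule landau_o.big.mult)
      then show ?thesis by (simp add: algebra_simps)
    qed
    show ?thesis
      unfolding prepare_cost_def of_nat_add by (intro sum_in_bigo(1) c loop steps) simp
  qed
  have tables: "(\<lambda>n. real (tables_cost n)) \<in> O(\<lambda>n. real n)"
    unfolding tables_cost_def of_nat_add by (intro sum_in_bigo(1) c loop nn[unfolded of_nat_add] nn)
  have pass: "(\<lambda>n. real (pass_cost n)) \<in> O(\<lambda>n. real n)"
    unfolding pass_cost_def of_nat_add by (intro sum_in_bigo(1) c loop nn)
  have sort: "(\<lambda>n. real (for_cost (log_up (n + n)) (pass_cost n))) \<in> O(\<lambda>n. real n * ln (real n))"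
    using for_cost_bigo[OF log_up_bigo pass one_ln one_n] by (simp add: mult.commute)
  have line: "(\<lambda>n. real (line_cost u v (log_up (n + n)))) \<in> O(\<lambda>n. ln (real n))" for u v
  proof -
    have "(\<lambda>n. real (for_cost (log_up (n + n)) C)) \<in> O(\<lambda>n. ln (real n))" for C
      using for_cost_bigo[OF log_up_bigo _ one_ln one_one, of "\<lambda>_. C"] by simp
    then show ?thesis unfolding line_cost_def of_nat_add by (intro sum_in_bigo(1) c_ln)
  qed
  have main: "(\<lambda>n. real (main_cost n)) \<in> O(\<lambda>n. real n * ln (real n))"
  proof -
    have "(\<lambda>n. real (line_cost False True (log_up (n + n)) +
        (line_cost True False (log_up (n + n)) + line_cost True True (log_up (n + n))))) \<in> O(\<lambda>n. ln (real n))"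
      unfolding of_nat_add by (intro sum_in_bigo(1) line)
    from for_cost_bigo[OF nn this one_n one_ln] show ?thesis
      unfolding main_cost_def of_nat_add by (intro sum_in_bigo(1) lin[OF c])
  qed
  have final: "(\<lambda>n. real (for_cost n C)) \<in> O(\<lambda>n. real n * ln (real n))" for C
    by (rule lin[OF loop]) simp
  show ?thesis
    unfolding arec_cost_def of_nat_add
    by (rule sum_in_bigo(1)[OF lin[OF prep] sum_in_bigo(1)[OF sort sum_in_bigo(1)[OF lin[OF tables]
            sum_in_bigo(1)[OF main sum_in_bigo(1)[OF lin[OF c[of "real (cost_bound final_init_code)"]] final]]]]])
qed

theorem theorem24:
  "\<exists>(prog :: com) (T :: nat \<Rightarrow> nat).
     (\<lambda>n. real (T n)) \<in> O(\<lambda>n. real n * ln (real n)) \<and>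
     (\<forall>n p k x cl cu \<Gamma> s.
        arec_instance n p k x cl cu \<Gamma> \<and> arec_input n p k x cl cu \<Gamma> s \<longrightarrow>
        (\<exists>t s'. exec prog s t s' \<and> t \<le> T n \<and> arec_output n p k x cl cu \<Gamma> s'))"
proof (rule exI[of _ arec_code], rule exI[of _ arec_cost], intro conjI allI impI)
  show "(\<lambda>n. real (arec_cost n)) \<in> O(\<lambda>n. real n * ln (real n))" by (rule arec_cost_bigo)
  fix n p k x cl cu \<Gamma> s
  assume "arec_instance n p k x cl cu \<Gamma> \<and> arec_input n p k x cl cu \<Gamma> s"
  then show "\<exists>t s'. exec arec_code s t s' \<and> t \<le> arec_cost n \<and> arec_output n p k x cl cu \<Gamma> s'"
    using tripleD[OF arec.arec_triple] by (simp add: arec_def)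
qed

end
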